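(* There exists a holomorphic function $g$, with domain a neighbourhood of $0\in\mathbb{C}$, such that, letting $\mathcal{A}=\{g\}$, the function $f:z\mapsto g(\sqrt z)$ is well defined, holomorphic in a neighbourhood of $0$ and locally $\emptyset$-definable in $\mathbb{R}_{\mathcal{A}\upharpoonright}$, but no restriction of $f$ to any neighbourhood of $0$ can be obtained from $\mathcal{A}\cup\mathcal{P}_G$ by finitely many applications of composition, Schwarz reflection, monomial division, taking partial derivatives and extracting implicit functions. More precisely, the germ $f_0$ of $f$ at $0$ belongs to $\mathcal{D}^{\emptyset}_0\setminus\mathcal{C}_0$. In particular $\mathcal{C}^{\emptyset}\neq\mathcal{D}^{\emptyset}$ and $\mathcal{C}\neq\mathcal{D}$.
   Context: $\mathcal{P}$ denotes all complex polynomials (in any number of variables), $\mathcal{P}_G$ those with coefficients in $\mathbb{Q}(i)$. $\mathcal{O}_a$ is the set of holomorphic germs at $a\in\mathbb{C}^n$; for $a\in\mathbb{C}^n$ write $a=(a',a_n)$, $z=(z',z_n)$. Sheaves: a "sheaf" $\mathcal{G}$ is a family $\{\mathcal{G}_n(U): n\in\mathbb{N}, U\subseteq\mathbb{C}^n \text{ open}\}$ with $\mathcal{G}_n(U)$ a set of holomorphic functions on $U$, closed under restriction and gluing. Its stalk $\mathcal{G}_a$ at $a$ is the set of germs at $a$ of functions in some $\mathcal{G}_n(U)$ with $a\in U$. A collection of functions such as $\{g\}$ is identified with the smallest such sheaf containing it. Operators on germs: (1) polynomial operators: for $P\in\mathcal{P}$ and $a\in\mathbb{C}^n$, the 0-ary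 operator giving the germ $P_a$; Gaussian polynomial operators: the same with $P\in\mathcal{P}_G$. (2) Schwarz reflection: $f\in\mathcal{O}_a\mapsto(z\mapsto\overline{f(\overline z)})\in\mathcal{O}_{\overline a}$. (3) Composition: $(f,g_1,\dots,g_n)\in\mathcal{O}_a\times(\mathcal{O}_b)^n\mapsto f\circ(g_1,\dots,g_n)\in\mathcal{O}_b$ whenever $(g_1(b),\dots,g_n(b))=a$. (4) Partial derivatives $f\mapsto\partial f/\partial z_j$. (5) Implicit function: $f\in\mathcal{O}_a$ with $f(a)=0$, $\frac{\partial f}{\partial z_n}(a)\neq0$ is mapped to the unique $\varphi\in\mathcal{O}_{a'}$ with $f(z',\varphi(z'))\equiv0$. (6) Monomial division: $f\in\mathcal{O}_a$ with $z'\mapsto f(z',a_n)$ identically zero is mapped to the germ at $a$ of the continuous extension of $f(z)/(z_n-a_n)$. (7) Deramification of order $m\ge1$: $f\in\mathcal{O}_a$ satisfying $f(z)=f(z',a_n+e^{2i\pi/m}(z_n-a_n))$ is mapped to the germ $z\mapsto f(z',a_n+\sqrt[m]{z_n-a_n})\in\mathcal{O}_a$. $\mathcal{B}^*$ is the set of finite compositions of polynomial, Schwarz reflection, composition, partial derivative and implicit function operators; $\mathcal{B}^{\emptyset*}$ the same with Gaussian polynomial operators instead of polynomial operators; $\mathcal{C}^*$ (resp. $\mathcal{C}^{\emptyset*}$) the finite compositions of monomial division operators and operators of $\mathcal{B}^*$ (resp. $\mathcal{B}^{\emptyset*}$); $\mathcal{D}^*$ (resp. $\mathcal{D}^{\emptyset*}$)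 the finite compositions of deramification operators and operators of $\mathcal{C}^*$ (resp. $\mathcal{C}^{\emptyset*}$). Given $\mathcal{A}$, $\mathcal{C},\mathcal{C}^{\emptyset},\mathcal{D},\mathcal{D}^{\emptyset}$ are the smallest sheaves containing $\mathcal{A}$ whose stalks are stable under the operators in $\mathcal{C}^*,\mathcal{C}^{\emptyset*},\mathcal{D}^*,\mathcal{D}^{\emptyset*}$ respectively. Definability: a proper restriction of a holomorphic $h:U\to\mathbb{C}$ is $h\upharpoonright\Delta$ for an open box $\Delta$ relatively compact in $U$. $\mathcal{A}\upharpoonright$ is the collection of proper restrictions of functions in $\mathcal{A}$ to boxes with corners in $\mathbb{Q}(i)$, and $\mathbb{R}_{\mathcal{A}\upharpoonright}=\langle\mathbb{R};0,1,+,\cdot,<,\mathcal{A}\upharpoonright\rangle$, these functions viewed as real maps via $\mathbb{C}\cong\mathbb{R}^2$. A holomorphic $h:U\to\mathbb{C}$ is locally $\emptyset$-definable in $\mathbb{R}_{\mathcal{A}\upharpoonright}$ if all its proper restrictions to boxes with Gaussian rational corners are definable without parameters in $\mathbb{R}_{\mathcal{A}\upharpoonright}$. *)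

theory Defs
  imports "HOL-Analysis.Analysis"
begin

section \<open>Holomorphic functions in a variable number of complex variables\<close>

text \<open>As for \<open>Euclidean_space\<close> in the real case, a point of complex n-space is a sequence
  vanishing from index n on, and n-space carries the subspace topology of the product topology.
  The coordinates are \<open>z 0, \<dots>, z (n - 1)\<close>. In dimension \<open>Suc n\<close> the last coordinate is \<open>z n\<close>,
  the first n coordinates form \<open>z(n := 0)\<close>, and replacing the last coordinate by \<open>w\<close> gives
  \<open>z(n := w)\<close>.\<close>

type_synonym cvec = "nat \<Rightarrow> complex"

definition Cspace :: "nat \<Rightarrow> cvec topology" where
  "Cspace n = top_of_set {z. \<forall>i\<ge>n. z i = 0}"

text \<open>Complex Frechet differentiability at every point of an open set; \<open>c\<close> is the gradient at \<open>a\<close>.\<close>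

definition holomorphic_Cn :: "nat \<Rightarrow> cvec set \<Rightarrow> (cvec \<Rightarrow> complex) \<Rightarrow> bool" where
  "holomorphic_Cn n U h \<longleftrightarrow> openin (Cspace n) U \<and>
     (\<forall>a\<in>U. \<exists>c :: nat \<Rightarrow> complex.
        ((\<lambda>z. (h z - h a - (\<Sum>i<n. c i * (z i - a i))) /
               of_real (L2_set (\<lambda>i. cmod (z i - a i)) {..<n})) \<longlongrightarrow> 0)
          (atin (Cspace n) a))"

definition holomorphic_near :: "nat \<Rightarrow> cvec \<Rightarrow> (cvec \<Rightarrow> complex) \<Rightarrow> bool" where
  "holomorphic_near n a h \<longleftrightarrow> (\<exists>U. a \<in> U \<and> holomorphic_Cn n U h)"

section \<open>Germs\<close>

text \<open>A germ is recorded with its dimension and its base point, so that germs in different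
  dimensions or at different points are different.\<close>

type_synonym germ = "nat \<times> cvec \<times> (cvec \<Rightarrow> complex) set"

definition germ :: "nat \<Rightarrow> cvec \<Rightarrow> (cvec \<Rightarrow> complex) \<Rightarrow> germ" where
  "germ n a h = (n, a, {k. \<forall>\<^sub>F z in nhdsin (Cspace n) a. k z = h z})"

section \<open>Sheaves\<close>

text \<open>The functions in \<open>G n U\<close> are taken in \<open>extensional U\<close>, so that they are determined by their
  values on \<open>U\<close>. Families are ordered by pointwise inclusion.\<close>

type_synonym family = "nat \<Rightarrow> cvec set \<Rightarrow> (cvec \<Rightarrow> complex) set"

definition is_sheaf :: "family \<Rightarrow> bool" where
  "is_sheaf G \<longleftrightarrow>
     (\<forall>n U h. h \<in> G n U \<longrightarrow> holomorphic_Cn n U h \<and> h \<in> extensional U) \<and>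
     (\<forall>n U V h. h \<in> G n U \<longrightarrow> openin (Cspace n) V \<longrightarrow> V \<subseteq> U \<longrightarrow> restrict h V \<in> G n V) \<and>
     (\<forall>n \<U> h. (\<forall>U\<in>\<U>. openin (Cspace n) U \<and> restrict h U \<in> G n U) \<longrightarrow>
        h \<in> extensional (\<Union>\<U>) \<longrightarrow> h \<in> G n (\<Union>\<U>))"

definition stalk :: "family \<Rightarrow> nat \<Rightarrow> cvec \<Rightarrow> germ set" where
  "stalk G n a = {germ n a h | h U. a \<in> U \<and> h \<in> G n U}"

definition stalks :: "family \<Rightarrow> germ set" where
  "stalks G = (\<Union>n. \<Union>a. stalk G n a)"

definition singleton_family :: "nat \<Rightarrow> cvec set \<Rightarrow> (cvec \<Rightarrow> complex) \<Rightarrow> family" where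
  "singleton_family n U h = (\<lambda>m V. if m = n \<and> V = U then {restrict h U} else {})"

definition sheaf_generated :: "family \<Rightarrow> family" where
  "sheaf_generated F = Inf {G. is_sheaf G \<and> F \<le> G}"

section \<open>Operators on germs\<close>

text \<open>A partial operator taking finitely many germs to a germ, as the set of its pairs of an
  argument list and a value.\<close>

type_synonym operator = "(germ list \<times> germ) set"

definition gaussian_rationals :: "complex set" where
  "gaussian_rationals = {z. Re z \<in> \<rat> \<and> Im z \<in> \<rat>}"

definition polynomial_function :: "complex set \<Rightarrow> nat \<Rightarrow> (cvec \<Rightarrow> complex) \<Rightarrow> bool" where
  "polynomial_function K n p \<longleftrightarrow>
     (\<exists>(S :: (nat \<Rightarrow> nat) set) c. finite S \<and> (\<forall>\<alpha>\<in>S. c \<alpha> \<in> K) \<and>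
        p = (\<lambda>z. \<Sum>\<alpha>\<in>S. c \<alpha> * (\<Prod>i<n. z i ^ \<alpha> i)))"

definition polynomial_operators :: "complex set \<Rightarrow> operator set" where
  "polynomial_operators K =
     {{([], germ n a p)} | n a p. a \<in> topspace (Cspace n) \<and> polynomial_function K n p}"

definition schwarz_operator :: "nat \<Rightarrow> cvec \<Rightarrow> operator" where
  "schwarz_operator n a =
     {([germ n a f], germ n (\<lambda>i. cnj (a i)) (\<lambda>z. cnj (f (\<lambda>i. cnj (z i))))) | f.
        holomorphic_near n a f}"

definition composition_operator :: "nat \<Rightarrow> cvec \<Rightarrow> nat \<Rightarrow> cvec \<Rightarrow> operator" where
  "composition_operator n a m b =
     {(germ n a f # map (\<lambda>i. germ m b (g i)) [0..<n],
       germ m b (\<lambda>z. f (\<lambda>i. if i < n then g i z else 0))) | f g.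
        holomorphic_near n a f \<and> (\<forall>i<n. holomorphic_near m b (g i) \<and> g i b = a i)}"

definition derivative_operator :: "nat \<Rightarrow> cvec \<Rightarrow> nat \<Rightarrow> operator" where
  "derivative_operator n a j =
     {([germ n a f], germ n a (\<lambda>z. deriv (\<lambda>w. f (z(j := w))) (z j))) | f. holomorphic_near n a f}"

definition implicit_operator :: "nat \<Rightarrow> cvec \<Rightarrow> operator" where
  "implicit_operator n a =
     {([germ (Suc n) a f], germ n (a(n := 0)) \<phi>) | f \<phi>.
        holomorphic_near (Suc n) a f \<and> f a = 0 \<and> deriv (\<lambda>w. f (a(n := w))) (a n) \<noteq> 0 \<and>
        holomorphic_near n (a(n := 0)) \<phi> \<and> \<phi> (a(n := 0)) = a n \<and>
        (\<forall>\<^sub>F z in nhdsin (Cspace n) (a(n := 0)). f (z(n := \<phi> z)) = 0)}"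

text \<open>The continuous extension of the quotient is automatically holomorphic; the requirement
  \<open>holomorphic_near (Suc n) a h\<close> only records that the value is again a holomorphic germ.\<close>

definition monomial_division_operator :: "nat \<Rightarrow> cvec \<Rightarrow> operator" where
  "monomial_division_operator n a =
     {([germ (Suc n) a f], germ (Suc n) a h) | f h.
        holomorphic_near (Suc n) a f \<and>
        (\<forall>\<^sub>F z in nhdsin (Cspace n) (a(n := 0)). f (z(n := a n)) = 0) \<and>
        holomorphic_near (Suc n) a h \<and>
        (\<exists>V. openin (Cspace (Suc n)) V \<and> a \<in> V \<and> continuous_on V h \<and>
           (\<forall>z\<in>V. z n \<noteq> a n \<longrightarrow> h z = f z / (z n - a n)))}"

text \<open>The root is the principal one (\<open>0 powr r = 0\<close>); by the invariance hypothesis every other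
  choice of the root gives the same value.\<close>

definition deramification_operator :: "nat \<Rightarrow> nat \<Rightarrow> cvec \<Rightarrow> operator" where
  "deramification_operator m n a =
     {([germ (Suc n) a f],
       germ (Suc n) a (\<lambda>z. f (z(n := a n + (z n - a n) powr (1 / of_nat m))))) | f.
        holomorphic_near (Suc n) a f \<and>
        (\<forall>\<^sub>F z in nhdsin (Cspace (Suc n)) a.
           f z = f (z(n := a n + exp (2 * \<i> * of_real pi / of_nat m) * (z n - a n))))}"

text \<open>The k-ary projections are included so that a composite may pass arguments on unchanged,
  repeat them and permute them.\<close>

inductive_set finite_compositions :: "operator set \<Rightarrow> operator set" for \<Omega> :: "operator set" where
  projection: "i < k \<Longrightarrow> {(xs, xs ! i) | xs. length xs = k} \<in> finite_compositions \<Omega>"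
| compose: "\<omega> \<in> \<Omega> \<Longrightarrow> (\<forall>\<eta>\<in>set \<eta>s. \<eta> \<in> finite_compositions \<Omega>) \<Longrightarrow>
    {(xs, y). length xs = k \<and> (\<exists>ys. list_all2 (\<lambda>\<eta> z. (xs, z) \<in> \<eta>) \<eta>s ys \<and> (ys, y) \<in> \<omega>)}
      \<in> finite_compositions \<Omega>"

text \<open>The parameter \<open>K\<close> is the set of coefficients allowed in polynomial operators: \<open>UNIV\<close>, or
  \<open>gaussian_rationals\<close> for the parameter-free versions.\<close>

definition B_ops :: "complex set \<Rightarrow> operator set" where
  "B_ops K = finite_compositions
     (polynomial_operators K \<union>
      {schwarz_operator n a | n a. a \<in> topspace (Cspace n)} \<union>
      {composition_operator n a m b | n a m b. a \<in> topspace (Cspace n) \<and> b \<in> topspace (Cspace m)} \<union>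
      {derivative_operator n a j | n a j. a \<in> topspace (Cspace n) \<and> j < n} \<union>
      {implicit_operator n a | n a. a \<in> topspace (Cspace (Suc n))})"

definition C_ops :: "complex set \<Rightarrow> operator set" where
  "C_ops K = finite_compositions
     ({monomial_division_operator n a | n a. a \<in> topspace (Cspace (Suc n))} \<union> B_ops K)"

definition D_ops :: "complex set \<Rightarrow> operator set" where
  "D_ops K = finite_compositions
     ({deramification_operator m n a | m n a. m \<ge> 1 \<and> a \<in> topspace (Cspace (Suc n))} \<union> C_ops K)"

definition stable_under :: "operator \<Rightarrow> family \<Rightarrow> bool" where
  "stable_under \<omega> G \<longleftrightarrow> (\<forall>xs y. (xs, y) \<in> \<omega> \<longrightarrow> set xs \<subseteq> stalks G \<longrightarrow> y \<in> stalks G)"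

definition smallest_stable_sheaf :: "operator set \<Rightarrow> family \<Rightarrow> family" where
  "smallest_stable_sheaf \<Omega> A = Inf {G. is_sheaf G \<and> A \<le> G \<and> (\<forall>\<omega>\<in>\<Omega>. stable_under \<omega> G)}"

definition C_sheaf :: "complex set \<Rightarrow> family \<Rightarrow> family" where
  "C_sheaf K A = smallest_stable_sheaf (C_ops K) A"

definition D_sheaf :: "complex set \<Rightarrow> family \<Rightarrow> family" where
  "D_sheaf K A = smallest_stable_sheaf (D_ops K) A"

section \<open>First-order definability over the real field\<close>

datatype rterm = Var nat | Zero | One | Plus rterm rterm | Times rterm rterm

datatype 's fmla =
    Equal rterm rterm
  | Less rterm rterm
  | Rel 's "rterm list"
  | Neg "'s fmla"
  | Conj "'s fmla" "'s fmla"
  | Ex nat "'s fmla"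

primrec rterm_value :: "(nat \<Rightarrow> real) \<Rightarrow> rterm \<Rightarrow> real" where
  "rterm_value e (Var x) = e x"
| "rterm_value e Zero = 0"
| "rterm_value e One = 1"
| "rterm_value e (Plus s t) = rterm_value e s + rterm_value e t"
| "rterm_value e (Times s t) = rterm_value e s * rterm_value e t"

primrec rterm_vars :: "rterm \<Rightarrow> nat set" where
  "rterm_vars (Var x) = {x}"
| "rterm_vars Zero = {}"
| "rterm_vars One = {}"
| "rterm_vars (Plus s t) = rterm_vars s \<union> rterm_vars t"
| "rterm_vars (Times s t) = rterm_vars s \<union> rterm_vars t"

primrec satisfies :: "('s \<Rightarrow> real list set) \<Rightarrow> (nat \<Rightarrow> real) \<Rightarrow> 's fmla \<Rightarrow> bool" where
  "satisfies I e (Equal s t) \<longleftrightarrow> rterm_value e s = rterm_value e t"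
| "satisfies I e (Less s t) \<longleftrightarrow> rterm_value e s < rterm_value e t"
| "satisfies I e (Rel R ts) \<longleftrightarrow> map (rterm_value e) ts \<in> I R"
| "satisfies I e (Neg \<phi>) \<longleftrightarrow> \<not> satisfies I e \<phi>"
| "satisfies I e (Conj \<phi> \<psi>) \<longleftrightarrow> satisfies I e \<phi> \<and> satisfies I e \<psi>"
| "satisfies I e (Ex x \<phi>) \<longleftrightarrow> (\<exists>v. satisfies I (e(x := v)) \<phi>)"

primrec free_vars :: "'s fmla \<Rightarrow> nat set" where
  "free_vars (Equal s t) = rterm_vars s \<union> rterm_vars t"
| "free_vars (Less s t) = rterm_vars s \<union> rterm_vars t"
| "free_vars (Rel R ts) = (\<Union>t\<in>set ts. rterm_vars t)"
| "free_vars (Neg \<phi>) = free_vars \<phi>"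
| "free_vars (Conj \<phi> \<psi>) = free_vars \<phi> \<union> free_vars \<psi>"
| "free_vars (Ex x \<phi>) = free_vars \<phi> - {x}"

text \<open>Definability without parameters, in the expansion of the ordered field of reals by the
  relations \<open>I s\<close> for \<open>s \<in> \<Sigma>\<close>, of a set of real k-tuples. \<open>set_fmla \<phi>\<close> is the set of relation
  symbols occurring in \<open>\<phi>\<close>.\<close>

definition zero_definable :: "'s set \<Rightarrow> ('s \<Rightarrow> real list set) \<Rightarrow> nat \<Rightarrow> real list set \<Rightarrow> bool" where
  "zero_definable \<Sigma> I k S \<longleftrightarrow>
     (\<exists>\<phi>. set_fmla \<phi> \<subseteq> \<Sigma> \<and> free_vars \<phi> \<subseteq> {..<k} \<and> S = {map e [0..<k] | e. satisfies I e \<phi>})"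

section \<open>Proper restrictions and local definability\<close>

text \<open>Open boxes with Gaussian rational corners; for complex numbers \<open>box\<close> is the open rectangle
  with sides parallel to the axes.\<close>

definition gaussian_box :: "nat \<Rightarrow> cvec set \<Rightarrow> bool" where
  "gaussian_box n \<Delta> \<longleftrightarrow>
     (\<exists>l u. (\<forall>i<n. l i \<in> gaussian_rationals \<and> u i \<in> gaussian_rationals) \<and>
        \<Delta> = {z \<in> topspace (Cspace n). \<forall>i<n. z i \<in> box (l i) (u i)})"

text \<open>\<open>Cspace n\<close> is closed in the ambient sequence space, so the closure may be taken there.\<close>

definition relatively_compact_in :: "cvec set \<Rightarrow> cvec set \<Rightarrow> bool" where
  "relatively_compact_in \<Delta> U \<longleftrightarrow> compact (closure \<Delta>) \<and> closure \<Delta> \<subseteq> U"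

type_synonym restriction = "nat \<times> cvec set \<times> (cvec \<Rightarrow> complex)"

definition proper_restrictions :: "nat \<Rightarrow> cvec set \<Rightarrow> (cvec \<Rightarrow> complex) \<Rightarrow> restriction set" where
  "proper_restrictions n U h =
     {(n, \<Delta>, restrict h \<Delta>) | \<Delta>. gaussian_box n \<Delta> \<and> relatively_compact_in \<Delta> U}"

definition family_proper_restrictions :: "family \<Rightarrow> restriction set" where
  "family_proper_restrictions A = (\<Union>n. \<Union>U. \<Union>h\<in>A n U. proper_restrictions n U h)"

text \<open>The graph of a restriction as a set of real tuples of length \<open>2 * n + 2\<close>. Restrictions
  enter the language as relation symbols denoting their graphs.\<close>

fun real_graph :: "restriction \<Rightarrow> real list set" where
  "real_graph (n, \<Delta>, h) =
     {concat (map (\<lambda>i. [Re (z i), Im (z i)]) [0..<n]) @ [Re (h z), Im (h z)] | z. z \<in> \<Delta>}"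

definition locally_zero_definable ::
    "family \<Rightarrow> nat \<Rightarrow> cvec set \<Rightarrow> (cvec \<Rightarrow> complex) \<Rightarrow> bool" where
  "locally_zero_definable A n U h \<longleftrightarrow>
     (\<forall>r \<in> proper_restrictions n U h.
        zero_definable (family_proper_restrictions A) real_graph (2 * n + 2) (real_graph r))"

section \<open>Functions of one complex variable\<close>

definition domain1 :: "complex set \<Rightarrow> cvec set" where
  "domain1 U = {z \<in> topspace (Cspace 1). z 0 \<in> U}"

definition function1 :: "complex set \<Rightarrow> (complex \<Rightarrow> complex) \<Rightarrow> cvec \<Rightarrow> complex" where
  "function1 U f = restrict (\<lambda>z. f (z 0)) (domain1 U)"

definition germ1 :: "complex set \<Rightarrow> (complex \<Rightarrow> complex) \<Rightarrow> germ" where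
  "germ1 U f = germ 1 (\<lambda>_. 0) (function1 U f)"

end

theory Submission
  imports Defs "HOL-Complex_Analysis.Complex_Analysis"
begin

text \<open>Take \<open>g = cos\<close>, so that \<open>f z = cos (sqrt z) = \<Sum>k. (- 1) ^ k z ^ k / (2 k)!\<close>. Every operator defining
  \<open>\<C>\<close> computes the \<open>N\<close>-jet of its value rationally from the \<open>(N + s)\<close>-jets of its arguments, and the
  only denominators that grow with \<open>N\<close> are integers at most \<open>N + s\<close>, where \<open>s\<close> counts derivatives and
  monomial divisions. The Taylor coefficients of \<open>cos\<close> of order at most \<open>N\<close> at \<open>b\<close> lie in the ring generated by
  \<open>cos b\<close>, \<open>sin b\<close> and \<open>1 / N!\<close>. Hence for every germ in \<open>\<C>\<close> there are a finite set \<open>P\<close> and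
  an \<open>s\<close> such that the \<open>N\<close>-jet has coefficients in the ring generated by \<open>P\<close> and \<open>1 / (N + s)!\<close>, for all \<open>N\<close>.
  For \<open>f\<close> at 0 the \<open>N\<close>-th coefficient is \<open>\<plusminus> 1 / (2 N)!\<close>, and a finitely generated ring of
  characteristic 0 inverts only finitely many primes, so a prime between \<open>N + s\<close> and \<open>2 N\<close> gives a
  contradiction. Jets are tested along holomorphic curves, which makes the composition operator trivial.\<close>

section \<open>Finitely generated rings invert few primes\<close>

text \<open>Deramification of order 2 turns the coefficient of order 2 N into that of order N, and
  no constant shift \<open>s\<close> can absorb this factor 2. To tell 1 / (N + s)! from 1 / (2 N)!
  the coefficients must be confined to a ring that is not a field, so every division has to be
  accounted for: constants, and the inverses required at a base point, go into \<open>P\<close>, and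
  only its finiteness counts. This treats Gaussian and arbitrary complex coefficients at once. The
  price of testing along curves is that one curve tells nothing about derivatives transversal to it,
  and that it may run inside the hypersurface by whose equation one divides. Both obstacles are
  overcome by moving the curve in a one-parameter family and interpolating in the parameter. On the
  other side, membership in D means membership in every stable sheaf and hence requires one common
  domain. The function f is therefore shown to be a section over the whole plane, its germs away
  from 0 coming from branches of the square root as implicit functions.\<close>

definition subring :: "'a::comm_ring_1 set \<Rightarrow> bool" where
  "subring A \<longleftrightarrow> 1 \<in> A \<and> (\<forall>x\<in>A. \<forall>y\<in>A. x - y \<in> A \<and> x * y \<in> A)"

lemma subring_one: "subring A \<Longrightarrow> 1 \<in> A"
  and subring_diff: "subring A \<Longrightarrow> x \<in> A \<Longrightarrow> y \<in> A \<Longrightarrow> x - y \<in> A"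
  and subring_mult: "subring A \<Longrightarrow> x \<in> A \<Longrightarrow> y \<in> A \<Longrightarrow> x * y \<in> A"
  by (auto simp: subring_def)

lemma subring_zero: "subring A \<Longrightarrow> 0 \<in> A"
  using subring_diff[of A 1 1] subring_one by force

lemma subring_minus: "subring A \<Longrightarrow> x \<in> A \<Longrightarrow> - x \<in> A"
  using subring_diff[of A 0 x] subring_zero by force

lemma subring_add: "subring A \<Longrightarrow> x \<in> A \<Longrightarrow> y \<in> A \<Longrightarrow> x + y \<in> A"
  using subring_diff[of A x "- y"] subring_minus by force

lemma subring_power: "subring A \<Longrightarrow> x \<in> A \<Longrightarrow> x ^ n \<in> A"
  by (induction n) (auto intro: subring_one subring_mult)

lemma subring_sum: "subring A \<Longrightarrow> (\<And>i. i \<in> I \<Longrightarrow> f i \<in> A) \<Longrightarrow> sum f I \<in> A"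
  by (induction I rule: infinite_finite_induct) (auto intro: subring_zero subring_add)

lemma subring_of_nat: "subring A \<Longrightarrow> of_nat n \<in> A"
  by (induction n) (auto intro: subring_zero subring_add subring_one)

lemma subring_of_int: "subring A \<Longrightarrow> of_int k \<in> A"
  by (cases k rule: int_cases2) (auto intro: subring_of_nat subring_minus)

lemma subring_fact: "subring A \<Longrightarrow> fact n \<in> A"
  using subring_of_nat[of A "fact n"] by simp

lemmas subring_closed = subring_zero subring_one subring_diff subring_mult subring_minus subring_add
  subring_power subring_sum subring_of_nat subring_of_int subring_fact

section \<open>Polynomials over a subring and adjunction of one element\<close>

definition polys_over :: "'a::comm_ring_1 set \<Rightarrow> 'a poly set" where
  "polys_over A = {q. \<forall>i. coeff q i \<in> A}"

lemma polys_over_coeff: "q \<in> polys_over A \<Longrightarrow> coeff q i \<in> A"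
  by (simp add: polys_over_def)

lemma polys_over_zero: "subring A \<Longrightarrow> 0 \<in> polys_over A"
  by (simp add: polys_over_def subring_zero)

lemma polys_over_const: "subring A \<Longrightarrow> c \<in> A \<Longrightarrow> [:c:] \<in> polys_over A"
  by (auto simp: polys_over_def coeff_pCons subring_zero split: nat.split)

lemma polys_over_X: "subring A \<Longrightarrow> [:0, 1:] \<in> polys_over A"
  by (auto simp: polys_over_def coeff_pCons subring_zero subring_one split: nat.split)

lemma polys_over_add: "subring A \<Longrightarrow> p \<in> polys_over A \<Longrightarrow> q \<in> polys_over A \<Longrightarrow> p + q \<in> polys_over A"
  and polys_over_diff: "subring A \<Longrightarrow> p \<in> polys_over A \<Longrightarrow> q \<in> polys_over A \<Longrightarrow> p - q \<in> polys_over A"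
  and polys_over_smult: "subring A \<Longrightarrow> c \<in> A \<Longrightarrow> q \<in> polys_over A \<Longrightarrow> smult c q \<in> polys_over A"
  and polys_over_monom: "subring A \<Longrightarrow> c \<in> A \<Longrightarrow> monom c n \<in> polys_over A"
  by (auto simp: polys_over_def intro: subring_closed)

lemma polys_over_mult:
  "subring A \<Longrightarrow> p \<in> polys_over A \<Longrightarrow> q \<in> polys_over A \<Longrightarrow> p * q \<in> polys_over A"
  by (auto simp: polys_over_def coeff_mult intro!: subring_sum subring_mult)

text \<open>The ring A[x], formed inside the ambient ring. As \<open>x\<close> may be algebraic over
  \<open>A\<close>, an element can have several representing polynomials.\<close>

definition adjoin :: "'a::comm_ring_1 set \<Rightarrow> 'a \<Rightarrow> 'a set" where
  "adjoin A x = (\<lambda>q. poly q x) ` polys_over A"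

lemma subring_adjoin:
  assumes "subring A"
  shows "subring (adjoin A x)"
  unfolding subring_def
proof (intro conjI ballI)
  show "1 \<in> adjoin A x"
    unfolding adjoin_def
    using polys_over_const[OF assms subring_one[OF assms]] by (rule rev_image_eqI) simp
next
  fix u v assume "u \<in> adjoin A x" "v \<in> adjoin A x"
  then obtain p q where pq: "p \<in> polys_over A" "q \<in> polys_over A" "u = poly p x" "v = poly q x"
    unfolding adjoin_def by blast
  show "u - v \<in> adjoin A x"
    unfolding adjoin_def using polys_over_diff[OF assms pq(1,2)] by (rule rev_image_eqI) (simp add: pq)
  show "u * v \<in> adjoin A x"
    unfolding adjoin_def using polys_over_mult[OF assms pq(1,2)] by (rule rev_image_eqI) (simp add: pq)
qed

lemma adjoin_superset: "subring A \<Longrightarrow> A \<subseteq> adjoin A x"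
  unfolding adjoin_def using polys_over_const[of A] by (force intro: rev_image_eqI)

lemma adjoin_self: "subring A \<Longrightarrow> x \<in> adjoin A x"
  unfolding adjoin_def using polys_over_X[of A] by (force intro: rev_image_eqI)

text \<open>Over a ring each cancellation of a leading term costs one factor
  \<open>lead_coeff g\<close>; the exponent \<open>k\<close> collects them. Such powers are harmless
  later, where they are absorbed into the element being inverted.\<close>

lemma pseudo_division_over:
  fixes f g :: "'a::idom poly"
  assumes A: "subring A" and g: "g \<in> polys_over A" "g \<noteq> 0" and f: "f \<in> polys_over A"
  shows "\<exists>k. \<exists>q\<in>polys_over A. \<exists>r\<in>polys_over A.
    smult (lead_coeff g ^ k) f = g * q + r \<and> (r = 0 \<or> degree r < degree g)"
  using f
proof (induction "degree f" arbitrary: f rule: less_induct)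
  case less
  consider "f = 0 \<or> degree f < degree g" | "f \<noteq> 0" "degree f = 0" "degree g = 0"
    | "f \<noteq> 0" "degree f > 0" "degree g \<le> degree f"
    by linarith
  then show ?case
  proof cases
    case 1
    then show ?thesis
      using less.prems polys_over_zero[OF A] by (intro exI[of _ 0] bexI[of _ 0] bexI[of _ f]) auto
  next
    \<comment> \<open>No nonzero remainder can have degree below that of a constant
      \<open>g\<close>, so one multiplication by \<open>g\<close> has to leave remainder 0.\<close>
    case 2
    then obtain a b where "f = [:a:]" "g = [:b:]"
      by (metis degree_eq_zeroE)
    then show ?thesis
      using less.prems polys_over_zero[OF A] by (intro exI[of _ 1] bexI[of _ f] bexI[of _ 0]) auto
  next
    case 3
    define t where "t = monom (lead_coeff f) (degree f - degree g)"
    define h where "h = smult (lead_coeff g) f - g * t"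
    have tA: "t \<in> polys_over A"
      unfolding t_def using A less.prems by (intro polys_over_monom) (auto simp: polys_over_coeff)
    have hA: "h \<in> polys_over A"
      unfolding h_def using A less.prems g tA
      by (intro polys_over_diff polys_over_smult polys_over_mult) (auto simp: polys_over_coeff)
    have lf: "lead_coeff f \<noteq> 0" "lead_coeff g \<noteq> 0"
      using 3 g by auto
    have t0: "t \<noteq> 0" "degree t = degree f - degree g"
      using lf by (auto simp: t_def degree_monom_eq)
    have "degree h \<le> degree f"
      unfolding h_def using 3(3) t0 g
      by (intro degree_diff_le) (auto simp: degree_mult_eq)
    moreover have "coeff h (degree f) = 0"
    proof -
      have "lead_coeff t = lead_coeff f"
        unfolding t0(2) by (simp add: t_def)
      then have "coeff (g * t) (degree g + degree t) = lead_coeff g * lead_coeff f"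
        by (simp add: coeff_mult_degree_sum)
      then show ?thesis
        using 3(3) t0 by (simp add: h_def)
    qed
    ultimately have "degree h < degree f"
      using 3(2) by (metis degree_0 leading_coeff_0_iff le_neq_implies_less)
    from less.hyps[OF this hA] obtain k q r where
      kqr: "q \<in> polys_over A" "r \<in> polys_over A" "smult (lead_coeff g ^ k) h = g * q + r"
        "r = 0 \<or> degree r < degree g"
      by blast
    have "smult (lead_coeff g ^ Suc k) f = g * (q + smult (lead_coeff g ^ k) t) + r"
      using kqr(3) by (simp add: h_def smult_diff_right algebra_simps)
    moreover have "q + smult (lead_coeff g ^ k) t \<in> polys_over A"
      using A kqr g tA by (intro polys_over_add polys_over_smult subring_power) (auto simp: polys_over_coeff)
    ultimately show ?thesis
      using kqr by blast
  qed
qed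

text \<open>\<open>few_units A\<close> says that every localization \<open>A[1/d]\<close> inverts only finitely many primes.\<close>

definition few_units :: "'a::comm_ring_1 set \<Rightarrow> bool" where
  "few_units A \<longleftrightarrow> (\<forall>d\<in>A. d \<noteq> 0 \<longrightarrow> finite {p::nat. prime p \<and> (\<exists>k. \<exists>q\<in>A. d ^ k = of_nat p * q)})"

lemma few_units_Ints: "few_units (\<int> :: 'a::field_char_0 set)"
  unfolding few_units_def
proof (intro ballI impI)
  fix d :: 'a assume "d \<in> \<int>" "d \<noteq> 0"
  then obtain m where m: "d = of_int m" "m \<noteq> 0"
    by (auto elim: Ints_cases)
  have "{p::nat. prime p \<and> (\<exists>k. \<exists>q\<in>\<int>. d ^ k = of_nat p * q)} \<subseteq> {p. p dvd nat \<bar>m\<bar>}"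
  proof safe
    fix p k :: nat and q :: 'a assume p: "prime p" and "q \<in> \<int>" and dq: "d ^ k = of_nat p * q"
    then obtain j where "q = of_int j" by (auto elim: Ints_cases)
    then have "of_int (m ^ k) = (of_int (int p * j) :: 'a)"
      using dq m by simp
    then have "int p dvd m ^ k"
      using of_int_eq_iff by (metis dvd_triv_left)
    then have "int p dvd m"
      using p prime_dvd_power[of "int p" m k] by simp
    then show "p dvd nat \<bar>m\<bar>"
      by (simp add: nat_dvd_iff flip: int_dvd_int_iff)
  qed
  moreover have "finite {p. p dvd nat \<bar>m\<bar>}"
    using m by (intro finite_divisors_nat) auto
  ultimately show "finite {p::nat. prime p \<and> (\<exists>k. \<exists>q\<in>\<int>. d ^ k = of_nat p * q)}"
    by (rule finite_subset)
qed

text \<open>Evaluation at \<open>x\<close> is injective on polynomials over \<open>A\<close>, so an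
  equation d^k = p q lifts to polynomials. Comparing coefficients in the degree of \<delta>^k gives
  the same divisibility for the leading coefficient of \<delta>, which lies in
  \<open>A\<close>.\<close>

lemma few_units_adjoin_transcendental:
  fixes x :: "'a::field_char_0"
  assumes A: "subring A" and few: "few_units A"
    and tr: "\<And>q. q \<in> polys_over A \<Longrightarrow> poly q x = 0 \<Longrightarrow> q = 0"
  shows "few_units (adjoin A x)"
  unfolding few_units_def
proof (intro ballI impI)
  fix d assume "d \<in> adjoin A x" "d \<noteq> 0"
  then obtain \<delta> where \<delta>: "\<delta> \<in> polys_over A" "d = poly \<delta> x" "\<delta> \<noteq> 0"
    unfolding adjoin_def by (metis imageE poly_0)
  have "{p::nat. prime p \<and> (\<exists>k. \<exists>q\<in>adjoin A x. d ^ k = of_nat p * q)}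
     \<subseteq> {p::nat. prime p \<and> (\<exists>k. \<exists>q\<in>A. lead_coeff \<delta> ^ k = of_nat p * q)}"
  proof safe
    fix p k :: nat and q assume "q \<in> adjoin A x" and dq: "d ^ k = of_nat p * q"
    then obtain \<kappa> where \<kappa>: "\<kappa> \<in> polys_over A" "q = poly \<kappa> x"
      unfolding adjoin_def by auto
    have pw: "\<delta> ^ k \<in> polys_over A" for k
      by (induction k) (use A \<delta> polys_over_const[OF A subring_one[OF A]] in
        \<open>auto intro: polys_over_mult simp: one_pCons\<close>)
    have "\<delta> ^ k - smult (of_nat p) \<kappa> = 0"
      using A \<delta> \<kappa> dq pw
      by (intro tr polys_over_diff polys_over_smult subring_of_nat) auto
    then have "coeff (\<delta> ^ k) (degree (\<delta> ^ k)) = of_nat p * coeff \<kappa> (degree (\<delta> ^ k))"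
      by (metis coeff_smult right_minus_eq)
    then show "\<exists>k. \<exists>q\<in>A. lead_coeff \<delta> ^ k = of_nat p * q"
      using \<kappa> by (metis lead_coeff_power polys_over_coeff)
  qed
  moreover have "lead_coeff \<delta> \<in> A" "lead_coeff \<delta> \<noteq> 0"
    using \<delta> by (auto simp: polys_over_coeff)
  ultimately show "finite {p::nat. prime p \<and> (\<exists>k. \<exists>q\<in>adjoin A x. d ^ k = of_nat p * q)}"
    using few finite_subset unfolding few_units_def by blast
qed

text \<open>Among the polynomials over \<open>A\<close> whose value at \<open>x\<close> is a nonzero
  multiple of \<open>d\<close>, one of least degree is constant: dividing it by \<open>m\<close>
  shows that its degree is below that of \<open>m\<close>, and dividing \<open>m\<close> by it would
  otherwise leave a remainder of the same kind and of smaller degree.\<close>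

lemma adjoin_algebraic_divides_base:
  fixes x :: "'a::field_char_0"
  assumes A: "subring A" and m: "m \<in> polys_over A" "poly m x = 0" "m \<noteq> 0"
    and min: "\<And>q. q \<in> polys_over A \<Longrightarrow> poly q x = 0 \<Longrightarrow> q = 0 \<or> degree m \<le> degree q"
    and d: "d \<in> adjoin A x" "d \<noteq> 0"
  shows "\<exists>d'\<in>adjoin A x. d * d' \<in> A - {0}"
proof -
  define I where "I = {\<delta> \<in> polys_over A. poly \<delta> x \<noteq> 0 \<and> (\<exists>d'\<in>adjoin A x. poly \<delta> x = d * d')}"
  have AA: "subring (adjoin A x)" using subring_adjoin[OF A] .
  obtain \<delta>0 where "\<delta>0 \<in> polys_over A" "d = poly \<delta>0 x"
    using d unfolding adjoin_def by auto
  then have "\<delta>0 \<in> I"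
    unfolding I_def using d subring_one[OF AA] by (auto intro!: bexI[of _ 1])
  then obtain \<delta> where \<delta>: "\<delta> \<in> I" and least: "\<And>q. q \<in> I \<Longrightarrow> degree \<delta> \<le> degree q"
    using ex_has_least_nat[of "\<lambda>q. q \<in> I" \<delta>0 degree] by blast
  obtain d' where d': "d' \<in> adjoin A x" "poly \<delta> x = d * d'" and \<delta>0: "poly \<delta> x \<noteq> 0" "\<delta> \<in> polys_over A"
    using \<delta> unfolding I_def by auto
  have "\<delta> \<noteq> 0" "lead_coeff m \<noteq> 0" "lead_coeff \<delta> \<noteq> 0" using \<delta>0 m by auto
  have small: "degree \<delta> < degree m"
  proof (rule ccontr)
    assume large: "\<not> degree \<delta> < degree m"
    from pseudo_division_over[OF A m(1,3) \<delta>0(2)] obtain k q r where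
      kqr: "q \<in> polys_over A" "r \<in> polys_over A" "smult (lead_coeff m ^ k) \<delta> = m * q + r"
        "r = 0 \<or> degree r < degree m"
      by blast
    have "lead_coeff m ^ k * poly \<delta> x = poly r x"
      using arg_cong[OF kqr(3), of "\<lambda>q. poly q x"] m by simp
    then have "poly r x \<noteq> 0" "poly r x = d * (lead_coeff m ^ k * d')"
      using \<delta>0 \<open>lead_coeff m \<noteq> 0\<close> d' by (auto simp: algebra_simps)
    moreover have "lead_coeff m ^ k * d' \<in> adjoin A x"
      using AA adjoin_superset[OF A, of x] m d' by (intro subring_mult subring_power) (auto simp: polys_over_coeff)
    ultimately have "r \<in> I"
      unfolding I_def using kqr by auto
    then show False
      using least[of r] kqr(4) large \<open>poly r x \<noteq> 0\<close> by auto
  qed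
  have "degree \<delta> = 0"
  proof (rule ccontr)
    assume pos: "degree \<delta> \<noteq> 0"
    from pseudo_division_over[OF A \<delta>0(2) \<open>\<delta> \<noteq> 0\<close> m(1)] obtain k q r where
      kqr: "q \<in> polys_over A" "r \<in> polys_over A" "smult (lead_coeff \<delta> ^ k) m = \<delta> * q + r"
        "r = 0 \<or> degree r < degree \<delta>"
      by blast
    have e: "poly r x = - (poly \<delta> x * poly q x)"
      using arg_cong[OF kqr(3), of "\<lambda>q. poly q x"] m by (simp add: eq_neg_iff_add_eq_0 add.commute)
    show False
    proof (cases "poly r x = 0")
      \<comment> \<open>Then \<open>q\<close> is a nonzero polynomial of smaller degree than
        \<open>m\<close> that vanishes at \<open>x\<close>, against minimality.\<close>
      case True
      then have "r = 0"
        using min[of r] kqr small by auto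
      have "poly q x = 0"
        using True e \<delta>0 by simp
      then have "q = 0 \<or> degree m \<le> degree q"
        using min kqr by blast
      moreover have "smult (lead_coeff \<delta> ^ k) m \<noteq> 0"
        using m \<open>lead_coeff \<delta> \<noteq> 0\<close> by simp
      then have "q \<noteq> 0" using kqr \<open>r = 0\<close> by auto
      moreover have "degree m = degree \<delta> + degree q"
        using arg_cong[OF kqr(3), of degree] \<open>r = 0\<close> \<open>q \<noteq> 0\<close> \<open>\<delta> \<noteq> 0\<close> \<open>lead_coeff \<delta> \<noteq> 0\<close>
        by (simp add: degree_mult_eq)
      ultimately show False using pos by linarith
    next
      case False
      have "poly r x = d * (- (d' * poly q x))"
        using e d' by simp
      moreover have "- (d' * poly q x) \<in> adjoin A x"
        using AA d' kqr(1) by (intro subring_minus subring_mult) (auto simp: adjoin_def)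
      ultimately have "r \<in> I"
        unfolding I_def using kqr(2) False by blast
      then show False
        using least[of r] kqr(4) False by auto
    qed
  qed
  then have "poly \<delta> x = coeff \<delta> 0"
    by (auto elim!: degree_eq_zeroE)
  then have "d * d' \<in> A - {0}"
    using d'(2) \<delta>0 polys_over_coeff[of \<delta> A 0] by auto
  then show ?thesis
    using d'(1) by blast
qed

text \<open>With d d' = e in \<open>A\<close>, multiplication by powers of d' and of the leading
  coefficient l reduces d^k = p q to an equation whose right side is p times the value of a
  polynomial of degree below that of \<open>m\<close>. Such a polynomial is determined by its value
  at \<open>x\<close>, so constant coefficients can be compared in \<open>A\<close>, and D = l e
  takes the place of \<open>d\<close>.\<close>

lemma few_units_adjoin_algebraic:
  fixes x :: "'a::field_char_0"
  assumes A: "subring A" and few: "few_units A"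
    and m: "m \<in> polys_over A" "poly m x = 0" "m \<noteq> 0"
    and min: "\<And>q. q \<in> polys_over A \<Longrightarrow> poly q x = 0 \<Longrightarrow> q = 0 \<or> degree m \<le> degree q"
  shows "few_units (adjoin A x)"
  unfolding few_units_def
proof (intro ballI impI)
  have AA: "subring (adjoin A x)" using subring_adjoin[OF A] .
  fix d assume d: "d \<in> adjoin A x" "d \<noteq> 0"
  obtain d' where d': "d' \<in> adjoin A x" "d * d' \<in> A" "d * d' \<noteq> 0"
    using adjoin_algebraic_divides_base[OF A m min d] by blast
  define l where "l = lead_coeff m"
  define e where "e = d * d'"
  define D where "D = l * e"
  have l: "l \<in> A" "l \<noteq> 0"
    using m by (auto simp: l_def polys_over_coeff)
  have e: "e \<in> A" "e \<noteq> 0"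
    using d' by (auto simp: e_def)
  \<comment> \<open>Guarantees that the constant term in \<open>w\<close> below has degree less than
    that of \<open>m\<close>.\<close>
  have "degree m \<noteq> 0"
  proof
    assume "degree m = 0"
    then obtain c where "m = [:c:]" by (rule degree_eq_zeroE)
    then show False using m by simp
  qed
  have "{p::nat. prime p \<and> (\<exists>k. \<exists>q\<in>adjoin A x. d ^ k = of_nat p * q)}
     \<subseteq> {p::nat. prime p \<and> (\<exists>k. \<exists>q\<in>A. D ^ k = of_nat p * q)}"
  proof safe
    fix p k :: nat and q assume "q \<in> adjoin A x" and dq: "d ^ k = of_nat p * q"
    then have "d' ^ k * q \<in> adjoin A x"
      using AA d' by (intro subring_mult subring_power)
    then obtain \<kappa> where \<kappa>: "\<kappa> \<in> polys_over A" "d' ^ k * q = poly \<kappa> x"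
      unfolding adjoin_def by auto
    from pseudo_division_over[OF A m(1,3) \<kappa>(1)] obtain j s r where
      r: "s \<in> polys_over A" "r \<in> polys_over A" "smult (l ^ j) \<kappa> = m * s + r"
        "r = 0 \<or> degree r < degree m"
      unfolding l_def by blast
    have "l ^ j * e ^ k = of_nat p * (l ^ j * (d' ^ k * q))"
      using dq by (simp add: power_mult_distrib e_def)
    also have "l ^ j * (d' ^ k * q) = poly r x"
      using arg_cong[OF r(3), of "\<lambda>q. poly q x"] m \<kappa> by simp
    finally have le: "l ^ j * e ^ k = of_nat p * poly r x" .
    define w where "w = smult (of_nat p) r - [:l ^ j * e ^ k:]"
    have "w \<in> polys_over A"
      unfolding w_def using A r l e
      by (intro polys_over_diff polys_over_smult polys_over_const subring_closed) auto
    moreover have "poly w x = 0" by (simp add: w_def le)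
    moreover have "degree w < degree m"
      unfolding w_def using r(4) \<open>degree m \<noteq> 0\<close> by (intro degree_diff_less) auto
    ultimately have "w = 0"
      using min[of w] by auto
    then have "coeff w 0 = 0" by simp
    then have "l ^ j * e ^ k = of_nat p * coeff r 0"
      by (simp add: w_def)
    \<comment> \<open>The surplus factors l^k e^j bring both exponents to the common value j +
      k.\<close>
    then have "D ^ (j + k) = of_nat p * (l ^ k * e ^ j * coeff r 0)"
      by (simp add: D_def power_add power_mult_distrib mult_ac)
    moreover have "l ^ k * e ^ j * coeff r 0 \<in> A"
      using A l e r by (intro subring_closed) (auto simp: polys_over_coeff)
    ultimately show "\<exists>k. \<exists>q\<in>A. D ^ k = of_nat p * q" by blast
  qed
  moreover have "D \<in> A" "D \<noteq> 0"
    using l e A by (auto simp: D_def intro: subring_mult)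
  ultimately show "finite {p::nat. prime p \<and> (\<exists>k. \<exists>q\<in>adjoin A x. d ^ k = of_nat p * q)}"
    using few finite_subset unfolding few_units_def by blast
qed

text \<open>An annihilating polynomial of least degree over \<open>A\<close> takes the place of the
  minimal polynomial over the fraction field.\<close>

lemma few_units_adjoin:
  fixes x :: "'a::field_char_0"
  assumes "subring A" "few_units A"
  shows "few_units (adjoin A x)"
proof (cases "\<exists>q\<in>polys_over A. poly q x = 0 \<and> q \<noteq> 0")
  case True
  then obtain m where "m \<in> polys_over A" "poly m x = 0" "m \<noteq> 0"
      and "\<And>q. q \<in> polys_over A \<Longrightarrow> poly q x = 0 \<Longrightarrow> q \<noteq> 0 \<Longrightarrow> degree m \<le> degree q"
    using ex_has_least_nat[of "\<lambda>q. q \<in> polys_over A \<and> poly q x = 0 \<and> q \<noteq> 0" _ degree] by blast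
  then show ?thesis
    using assms by (intro few_units_adjoin_algebraic[of A m]) auto
next
  case False
  then show ?thesis
    using assms by (intro few_units_adjoin_transcendental) auto
qed

lemma subring_Ints: "subring (\<int> :: 'a::comm_ring_1 set)"
  by (auto simp: subring_def)

lemma few_units_finitely_generated:
  fixes P :: "'a::field_char_0 set"
  assumes "finite P"
  shows "\<exists>A. subring A \<and> few_units A \<and> P \<subseteq> A"
  using assms
proof induction
  case empty
  then show ?case
    using subring_Ints few_units_Ints by auto
next
  case (insert x P)
  from insert.IH obtain A where A: "subring A" "few_units A" "P \<subseteq> A" by (elim exE conjE)
  have "insert x P \<subseteq> adjoin A x"
    using A(3) adjoin_superset[OF A(1), of x] adjoin_self[OF A(1), of x] by (intro insert_subsetI) auto
  then show ?case
    using subring_adjoin[OF A(1)] few_units_adjoin[OF A(1,2)] by metis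
qed

text \<open>Infinitely many primes are non-units of a suitable ring \<open>A\<close> containing
  \<open>P\<close>; one of them beyond \<open>n\<close> is taken. \<open>R\<close> is
  A[1 / (p - 1)!], and since (p - 1)! is prime to \<open>p\<close>, inverting it cannot make
  \<open>p\<close> invertible.\<close>

lemma subring_inverting_below_prime:
  fixes P :: "'a::field_char_0 set"
  assumes "finite P"
  shows "\<exists>p R. prime p \<and> p > n \<and> subring R \<and> P \<subseteq> R \<and> inverse (fact (p - 1)) \<in> R \<and>
    inverse (of_nat p) \<notin> R"
proof -
  obtain A where A: "subring A" "few_units A" "P \<subseteq> A"
    using few_units_finitely_generated[OF assms] by blast
  \<comment> \<open>The case d = 1 of \<open>few_units\<close>: the primes that are units of
    \<open>A\<close> itself.\<close>
  have "finite {p::nat. prime p \<and> (\<exists>q\<in>A. 1 = of_nat p * q)}"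
    using A(2)[unfolded few_units_def, rule_format, OF subring_one[OF A(1)] one_neq_zero] by simp
  then have "infinite ({p::nat. prime p} - {p. prime p \<and> (\<exists>q\<in>A. 1 = of_nat p * q)} - {..n})"
    using primes_infinite by (simp add: Diff_infinite_finite)
  then have "{p::nat. prime p} - {p. prime p \<and> (\<exists>q\<in>A. 1 = of_nat p * q)} - {..n} \<noteq> {}"
    by (metis finite.emptyI)
  then obtain p where p: "prime p" "p > n" and notunit: "\<not> (\<exists>q\<in>A. 1 = of_nat p * q)"
    by (auto simp only: ex_in_conv[symmetric] Diff_iff mem_Collect_eq atMost_iff not_le)
  define d :: nat where "d = fact (p - 1)"
  define R where "R = {x. \<exists>j. of_nat d ^ j * x \<in> A}"
  have "subring R"
    unfolding subring_def
  proof (intro conjI ballI)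
    show "1 \<in> R"
      unfolding R_def using subring_one[OF A(1)] by (auto intro!: exI[of _ 0])
  next
    fix x y assume "x \<in> R" "y \<in> R"
    then obtain i j where ij: "of_nat d ^ i * x \<in> A" "of_nat d ^ j * y \<in> A"
      unfolding R_def by blast
    have "of_nat d ^ (i + j) * (x - y) =
        of_nat d ^ j * (of_nat d ^ i * x) - of_nat d ^ i * (of_nat d ^ j * y)"
      by (simp add: power_add algebra_simps)
    also have "\<dots> \<in> A"
      using A(1) by (intro subring_diff[OF A(1)] subring_mult[OF A(1) _ ij(1)]
        subring_mult[OF A(1) _ ij(2)] subring_power subring_of_nat)
    finally show "x - y \<in> R" unfolding R_def by blast
    have "of_nat d ^ (i + j) * (x * y) = (of_nat d ^ i * x) * (of_nat d ^ j * y)"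
      by (simp add: power_add algebra_simps)
    also have "\<dots> \<in> A"
      by (rule subring_mult[OF A(1) ij])
    finally show "x * y \<in> R" unfolding R_def by blast
  qed
  moreover have "P \<subseteq> R"
    unfolding R_def using A(3) by (auto intro!: exI[of _ 0])
  moreover have "inverse (fact (p - 1)) \<in> R"
    unfolding R_def d_def using subring_one[OF A(1)] by (auto intro!: exI[of _ 1])
  moreover have "inverse (of_nat p) \<notin> R"
  proof
    assume "inverse (of_nat p) \<in> R"
    then obtain j where j: "of_nat d ^ j * inverse (of_nat p) \<in> A"
      unfolding R_def by blast
    have p0: "of_nat p \<noteq> (0::'a)" using p by auto
    have "\<not> p dvd d"
      using p by (simp add: d_def prime_dvd_fact_iff prime_gt_0_nat)
    then have "coprime d p"
      using prime_imp_coprime[OF p(1)] by (simp add: coprime_commute)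
    then have "coprime (int d ^ j) (int p)"
      by simp
    \<comment> \<open>By Bezout, 1 / p = u d^j / p + v, which carries an inverse of \<open>p\<close>
      from \<open>R\<close> back into \<open>A\<close>.\<close>
    then obtain u v where "u * int d ^ j + v * int p = 1"
      by (metis bezout_int coprime_imp_gcd_eq_1)
    then have "(of_int (u * int d ^ j + v * int p) :: 'a) = of_int 1"
      by (rule arg_cong)
    then have uv: "of_int u * of_nat d ^ j + of_int v * of_nat p = (1::'a)"
      by simp
    have "of_nat p * (of_int u * (of_nat d ^ j * inverse (of_nat p)) + of_int v) = (1::'a)"
      using p0 uv by (simp add: field_simps)
    moreover have "of_int u * (of_nat d ^ j * inverse (of_nat p)) + of_int v \<in> A"
      by (intro subring_add[OF A(1)] subring_mult[OF A(1) _ j] subring_of_int[OF A(1)])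
    ultimately show False
      using notunit by metis
  qed
  ultimately show ?thesis
    using p by blast
qed

text \<open>Newton's scheme: splitting off the linear factor of the last node lowers the degree, and
  the values of the quotient at the other nodes require only inverses of differences of nodes, so
  everything stays inside \<open>R\<close>.\<close>

lemma poly_coeff_interpolation:
  fixes Q :: "'a::field poly"
  assumes R: "subring R" and "degree Q \<le> d"
    and "\<And>i. i \<le> d \<Longrightarrow> y i \<in> R" and "\<And>i. i \<le> d \<Longrightarrow> poly Q (y i) \<in> R"
    and "\<And>i j. i < j \<Longrightarrow> j \<le> d \<Longrightarrow> y i \<noteq> y j \<and> inverse (y i - y j) \<in> R"
  shows "Q \<in> polys_over R"
  using assms(2-)
proof (induction d arbitrary: Q)
  case 0
  then obtain c where "Q = [:c:]" by (metis degree_eq_zeroE le_zero_eq)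
  then show ?case
    using 0 R by (auto intro: polys_over_const)
next
  case (Suc d)
  let ?y = "y (Suc d)" and ?q = "synthetic_div Q (y (Suc d))"
  have eq: "[:- ?y, 1:] * ?q + [:poly Q ?y:] = Q"
    by (rule synthetic_div_correct')
  have "?q \<in> polys_over R"
  proof (rule Suc.IH)
    show "degree ?q \<le> d" using Suc.prems by (simp add: degree_synthetic_div)
  next
    fix i assume i: "i \<le> d"
    have ne: "y i - ?y \<noteq> 0" "inverse (y i - ?y) \<in> R"
      using Suc.prems(4)[of i "Suc d"] i by auto
    have "(y i - ?y) * poly ?q (y i) + poly Q ?y = poly Q (y i)"
      using arg_cong[OF eq, of "\<lambda>q. poly q (y i)"] by (simp add: algebra_simps)
    then have "poly ?q (y i) = (poly Q (y i) - poly Q ?y) * inverse (y i - ?y)"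
      using ne by (simp add: field_simps)
    then show "poly ?q (y i) \<in> R"
      using ne R Suc.prems(3) i by (auto intro!: subring_closed)
  qed (use Suc.prems in auto)
  moreover have "[:- ?y, 1:] = [:0, 1:] - [:?y:]" by simp
  then have "[:- ?y, 1:] \<in> polys_over R"
    using R Suc.prems by (metis polys_over_diff polys_over_X polys_over_const order_refl)
  ultimately have "[:- ?y, 1:] * ?q + [:poly Q ?y:] \<in> polys_over R"
    using R Suc.prems by (intro polys_over_add polys_over_mult polys_over_const) auto
  then show ?case unfolding eq .
qed

section \<open>Inverses of small integers and factorials\<close>

lemma inverse_of_nat_mem:
  fixes R :: "'a::field_char_0 set"
  assumes R: "subring R" and "inverse (fact N) \<in> R" "m \<le> N" "m > 0"
  shows "inverse (of_nat m) \<in> R"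
proof -
  have "m dvd fact N" using assms by (intro dvd_fact) auto
  then obtain k where "(fact N :: nat) = m * k" by (elim dvdE)
  then have e: "(fact N :: 'a) = of_nat m * of_nat k"
    by (metis of_nat_fact of_nat_mult)
  have "fact N \<noteq> (0::'a)" by simp
  then have "of_nat k \<noteq> (0::'a)" unfolding e by simp
  then have "inverse (of_nat m) = of_nat k * inverse (fact N :: 'a)"
    unfolding e by simp
  then show ?thesis using assms by (auto intro: subring_closed)
qed

lemma inverse_fact_mem:
  fixes R :: "'a::field_char_0 set"
  assumes R: "subring R" and "inverse (fact N) \<in> R" "m \<le> N"
  shows "inverse (fact m) \<in> R"
proof -
  have "fact m dvd (fact N :: nat)" using assms by (intro fact_dvd)
  then obtain k where "(fact N :: nat) = fact m * k" by (elim dvdE)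
  then have e: "(fact N :: 'a) = fact m * of_nat k"
    by (metis of_nat_fact of_nat_mult)
  have "fact N \<noteq> (0::'a)" by simp
  then have "of_nat k \<noteq> (0::'a)" unfolding e by simp
  then have "inverse (fact m) = of_nat k * inverse (fact N :: 'a)"
    unfolding e by simp
  then show ?thesis using assms by (auto intro: subring_closed)
qed

text \<open>The differences of the nodes 1 - x, ..., d + 1 - x are integers between -d and d, so 1 /
  N! pays for the interpolation. The shift by \<open>x\<close> serves monomial division, where a
  curve of speed x is to be given the speeds 1, ..., d + 1; starting at 1 avoids speed 0.\<close>

lemma poly_coeff_interpolation_shifted_integers:
  fixes R :: "'a::field_char_0 set"
  assumes R: "subring R" "inverse (fact N) \<in> R" "d \<le> N" and Q: "degree Q \<le> d" and x: "x \<in> R"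
    and val: "\<And>i. i \<le> d \<Longrightarrow> poly Q (of_nat (Suc i) - x) \<in> R"
  shows "Q \<in> polys_over R"
proof (rule poly_coeff_interpolation[OF R(1) Q _ val])
  show "of_nat (Suc i) - x \<in> R" for i
    using R(1) x by (intro subring_diff subring_of_nat)
  fix i l :: nat assume "i < l" "l \<le> d"
  then have "inverse (of_nat (l - i)) \<in> R"
    using R(3) by (intro inverse_of_nat_mem[OF R(1,2)]) auto
  then have "- inverse (of_nat (l - i)) \<in> R" by (rule subring_minus[OF R(1)])
  moreover have "- inverse (of_nat (l - i)) = inverse (of_nat (Suc i) - x - (of_nat (Suc l) - x) :: 'a)"
    using \<open>i < l\<close> by (simp add: of_nat_diff flip: inverse_minus_eq)
  ultimately show "of_nat (Suc i) - x \<noteq> of_nat (Suc l) - x \<and> inverse (of_nat (Suc i) - x - (of_nat (Suc l) - x)) \<in> R"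
    using \<open>i < l\<close> by simp
qed

section \<open>Complex differentiability in several variables\<close>

lemma topspace_Cspace: "topspace (Cspace n) = {z. \<forall>i\<ge>n. z i = 0}"
  by (simp add: Cspace_def)

definition polydisc :: "nat \<Rightarrow> cvec \<Rightarrow> real \<Rightarrow> cvec set" where
  "polydisc n a r = {z \<in> topspace (Cspace n). \<forall>i<n. cmod (z i - a i) < r}"

lemma openin_polydisc: "openin (Cspace n) (polydisc n a r)"
proof -
  let ?T = "\<lambda>i. {z :: cvec. cmod (z i - a i) < r}"
  have "open (?T i)" for i
    by (intro open_Collect_less continuous_intros continuous_on_product_coordinates)
  then have "open (\<Inter>i\<in>{..<n}. ?T i)"
    by (intro open_INT) auto
  moreover have "polydisc n a r = topspace (Cspace n) \<inter> (\<Inter>i\<in>{..<n}. ?T i)"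
    by (auto simp: polydisc_def)
  ultimately show ?thesis
    unfolding Cspace_def by (auto simp: openin_open)
qed

text \<open>Only the first \<open>n\<close> coordinates vary, so finitely many of the radii supplied
  by the product topology matter and their minimum is positive.\<close>

lemma openin_Cspace_imp_polydisc:
  assumes "openin (Cspace n) U" "a \<in> U"
  shows "\<exists>r>0. polydisc n a r \<subseteq> U"
proof -
  obtain T where T: "open T" "U = {z. \<forall>i\<ge>n. z i = 0} \<inter> T"
    using assms unfolding Cspace_def by (auto simp: openin_open)
  have "openin (product_topology (\<lambda>i. euclidean) UNIV) T" "a \<in> T"
    using T assms by (auto simp: euclidean_product_topology)
  from product_topology_open_contains_basis[OF this]
  obtain X where X: "a \<in> PiE UNIV X" "\<And>i. openin euclidean (X i)" "PiE UNIV X \<subseteq> T"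
    by (elim exE conjE) (simp only:)
  have "\<exists>r>0. ball (a i) r \<subseteq> X i" for i
  proof -
    have "open (X i)" "a i \<in> X i" using X(1,2) by (auto simp: PiE_iff)
    then show ?thesis by (meson open_contains_ball)
  qed
  then obtain r where r: "\<And>i. r i > 0" "\<And>i. ball (a i) (r i) \<subseteq> X i" by metis
  define e where "e = Min (insert 1 (r ` {..<n}))"
  have e: "e > 0" "\<And>i. i < n \<Longrightarrow> e \<le> r i"
    using r(1) by (auto simp: e_def)
  have "polydisc n a e \<subseteq> U"
  proof
    fix z assume z: "z \<in> polydisc n a e"
    have "z i \<in> X i" for i
    proof (cases "i < n")
      case True
      then have "z i \<in> ball (a i) (r i)"
        using z e(2)[OF True] by (force simp: polydisc_def dist_norm norm_minus_commute)
      then show ?thesis using r by blast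
    next
      case False
      then have "z i = a i" using z assms T by (auto simp: polydisc_def topspace_Cspace)
      then show ?thesis using r(1)[of i] r(2)[of i] by auto
    qed
    then show "z \<in> U" using X(3) z T by (auto simp: polydisc_def topspace_Cspace)
  qed
  then show ?thesis using e by blast
qed

lemma eventually_nhdsin_Cspace:
  assumes "a \<in> topspace (Cspace n)"
  shows "eventually P (nhdsin (Cspace n) a) \<longleftrightarrow> (\<exists>r>0. \<forall>z\<in>polydisc n a r. P z)"
proof
  assume "eventually P (nhdsin (Cspace n) a)"
  then obtain S where S: "openin (Cspace n) S" "a \<in> S" "\<forall>x\<in>S. P x"
    using assms unfolding eventually_nhdsin by auto
  then obtain r where "r > 0" "polydisc n a r \<subseteq> S"
    using openin_Cspace_imp_polydisc[OF S(1,2)] by auto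
  then show "\<exists>r>0. \<forall>z\<in>polydisc n a r. P z"
    using S(3) by (intro exI[of _ r]) auto
next
  assume "\<exists>r>0. \<forall>z\<in>polydisc n a r. P z"
  then obtain r where r: "r > 0" "\<forall>z\<in>polydisc n a r. P z" by auto
  moreover have "a \<in> polydisc n a r"
    using assms \<open>r > 0\<close> by (simp add: polydisc_def)
  ultimately show "eventually P (nhdsin (Cspace n) a)"
    unfolding eventually_nhdsin using openin_polydisc[of n a r]
    by (intro disjI2 exI[of _ "polydisc n a r"]) simp
qed

lemma eventually_nhdsin_self: "eventually P (nhdsin X a) \<Longrightarrow> a \<in> topspace X \<Longrightarrow> P a"
  by (auto simp: eventually_nhdsin)

lemma eventually_eventually_nhdsin:
  "eventually P (nhdsin X a) \<Longrightarrow> \<forall>\<^sub>F z in nhdsin X a. eventually P (nhdsin X z)"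
  unfolding eventually_nhdsin by auto

lemma eventually_nhdsin_topspace: "\<forall>\<^sub>F z in nhdsin X a. z \<in> topspace X"
  unfolding eventually_nhdsin by (metis openin_topspace)

lemma filterlim_Cspace:
  assumes a: "a \<in> topspace (Cspace n)" and "\<forall>\<^sub>F x in F. G x \<in> topspace (Cspace n)"
    and lim: "\<And>i. i < n \<Longrightarrow> ((\<lambda>x. G x i) \<longlongrightarrow> a i) F"
  shows "filterlim G (nhdsin (Cspace n) a) F"
  unfolding filterlim_iff
proof safe
  fix P assume "eventually P (nhdsin (Cspace n) a)"
  then obtain r where r: "r > 0" "\<forall>z\<in>polydisc n a r. P z"
    using eventually_nhdsin_Cspace[OF a, of P] by auto
  have "\<forall>\<^sub>F x in F. \<forall>i\<in>{..<n}. cmod (G x i - a i) < r"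
    using lim r by (intro eventually_ball_finite) (auto simp: tendsto_iff dist_norm)
  with assms(2) show "\<forall>\<^sub>F x in F. P (G x)"
    by eventually_elim (use r in \<open>auto simp: polydisc_def\<close>)
qed

lemma tendsto_coordinate:
  assumes "a \<in> topspace (Cspace n)"
  shows "((\<lambda>z. z i) \<longlongrightarrow> a i) (nhdsin (Cspace n) a)"
proof (cases "i < n")
  case True
  show ?thesis
    unfolding tendsto_iff eventually_nhdsin_Cspace[OF assms]
    using True by (auto simp: polydisc_def dist_norm)
next
  case False
  have "\<forall>\<^sub>F z in nhdsin (Cspace n) a. z i = a i"
    using eventually_nhdsin_topspace by eventually_elim (use False assms in \<open>auto simp: topspace_Cspace\<close>)
  then show ?thesis by (rule tendsto_eventually)
qed

lemma tendsto_nhdsin_atin: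
  assumes "(f \<longlongrightarrow> f a) (atin X a)"
  shows "(f \<longlongrightarrow> f a) (nhdsin X a)"
  unfolding tendsto_def
proof safe
  fix S assume S: "open S" "f a \<in> S"
  then have "\<forall>\<^sub>F x in atin X a. f x \<in> S" using assms by (auto simp: tendsto_def)
  then show "\<forall>\<^sub>F x in nhdsin X a. f x \<in> S"
    unfolding eventually_atin eventually_nhdsin using S by blast
qed

lemma tendsto_atin_nhdsin: "(f \<longlongrightarrow> l) (nhdsin X a) \<Longrightarrow> (f \<longlongrightarrow> l) (atin X a)"
  unfolding atin_def by (rule tendsto_mono[OF inf_le1])

text \<open>Caratheodory's form of differentiability, which makes the chain rule immediate.\<close>

definition cdiff :: "nat \<Rightarrow> (cvec \<Rightarrow> complex) \<Rightarrow> cvec \<Rightarrow> bool" where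
  "cdiff n h a \<longleftrightarrow> a \<in> topspace (Cspace n) \<and>
     (\<exists>u. (\<forall>i<n. (u i \<longlongrightarrow> u i a) (nhdsin (Cspace n) a)) \<and>
       (\<forall>\<^sub>F z in nhdsin (Cspace n) a. h z - h a = (\<Sum>i<n. u i z * (z i - a i))))"

lemma cdiffI:
  assumes "a \<in> topspace (Cspace n)"
    and "\<And>i. i < n \<Longrightarrow> (u i \<longlongrightarrow> u i a) (nhdsin (Cspace n) a)"
    and "\<forall>\<^sub>F z in nhdsin (Cspace n) a. h z - h a = (\<Sum>i<n. u i z * (z i - a i))"
  shows "cdiff n h a"
  unfolding cdiff_def using assms by (intro conjI exI[of _ u]) auto

lemma cdiffE:
  assumes "cdiff n h a"
  obtains u where "\<forall>i<n. (u i \<longlongrightarrow> u i a) (nhdsin (Cspace n) a)"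
    and "\<forall>\<^sub>F z in nhdsin (Cspace n) a. h z - h a = (\<Sum>i<n. u i z * (z i - a i))"
proof -
  from assms obtain u where u: "\<forall>i<n. (u i \<longlongrightarrow> u i a) (nhdsin (Cspace n) a)"
      "\<forall>\<^sub>F z in nhdsin (Cspace n) a. h z - h a = (\<Sum>i<n. u i z * (z i - a i))"
    unfolding cdiff_def by (elim conjE exE)
  show thesis by (rule that[OF u])
qed

lemma frechet_imp_cdiff:
  assumes a: "a \<in> topspace (Cspace n)"
    and lim: "((\<lambda>z. (h z - h a - (\<Sum>i<n. c i * (z i - a i))) /
       of_real (L2_set (\<lambda>i. cmod (z i - a i)) {..<n})) \<longlongrightarrow> 0) (atin (Cspace n) a)"
  shows "cdiff n h a"
proof -
  define L where "L z = L2_set (\<lambda>i. cmod (z i - a i)) {..<n}" for z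
  define \<rho> where "\<rho> z = h z - h a - (\<Sum>i<n. c i * (z i - a i))" for z
  \<comment> \<open>The remainder is shared among the coordinates with weights cnj (z i - a i) /
    L^2. Their products with z i - a i add up to 1, and each weight is at most 1 / L in modulus,
    which makes the slopes continuous at \<open>a\<close>.\<close>
  define u where "u i z = c i + (if z = a then 0 else \<rho> z * cnj (z i - a i) / of_real (L z) ^ 2)" for i z
  have "(u i \<longlongrightarrow> u i a) (nhdsin (Cspace n) a)" if "i < n" for i
  proof (rule tendsto_nhdsin_atin)
    have "((\<lambda>z. u i z - c i) \<longlongrightarrow> 0) (atin (Cspace n) a)"
    proof (rule Lim_null_comparison)
      show "((\<lambda>z. cmod (\<rho> z / of_real (L z))) \<longlongrightarrow> 0) (atin (Cspace n) a)"
        using tendsto_norm[OF lim] by (simp add: \<rho>_def L_def)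
      have "cmod (u i z - c i) \<le> cmod (\<rho> z / of_real (L z))" for z
      proof (cases "z = a")
        case False
        have "cmod (z i - a i) \<le> L z"
          unfolding L_def using that by (intro member_le_L2_set) auto
        moreover have "L z \<ge> 0" by (simp add: L_def L2_set_nonneg)
        ultimately have "cmod (\<rho> z) * cmod (z i - a i) / (L z)\<^sup>2 \<le> cmod (\<rho> z) * L z / (L z)\<^sup>2"
          by (intro divide_right_mono mult_left_mono) auto
        also have "\<dots> = cmod (\<rho> z / of_real (L z))"
          using \<open>L z \<ge> 0\<close> by (simp add: norm_divide power2_eq_square)
        finally show ?thesis
          using False by (simp add: u_def norm_divide norm_mult norm_power complex_mod_cnj
            flip: complex_cnj_diff)
      qed (simp add: u_def)
      then show "\<forall>\<^sub>F z in atin (Cspace n) a. cmod (u i z - c i) \<le> cmod (\<rho> z / of_real (L z))"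
        by simp
    qed
    then have "((\<lambda>z. (u i z - c i) + c i) \<longlongrightarrow> 0 + c i) (atin (Cspace n) a)"
      by (intro tendsto_intros)
    moreover have "u i a = c i" by (simp add: u_def)
    ultimately show "(u i \<longlongrightarrow> u i a) (atin (Cspace n) a)" by simp
  qed
  moreover have "h z - h a = (\<Sum>i<n. u i z * (z i - a i))" if z: "z \<in> topspace (Cspace n)" for z
  proof (cases "z = a")
    case False
    then obtain i where i: "z i \<noteq> a i" by blast
    then have "i < n" using z a by (metis (mono_tags, lifting) mem_Collect_eq not_le topspace_Cspace)
    have "L z \<noteq> 0"
      using i \<open>i < n\<close> by (auto simp: L_def L2_set_eq_0_iff)
    have "(\<Sum>i<n. cnj (z i - a i) * (z i - a i)) = of_real (\<Sum>i<n. (cmod (z i - a i))\<^sup>2)"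
      unfolding of_real_sum by (intro sum.cong refl) (subst complex_norm_square, rule mult.commute)
    also have "\<dots> = of_real (L z) ^ 2"
      by (simp add: L_def L2_set_def sum_nonneg flip: of_real_power)
    finally have s: "(\<Sum>i<n. cnj (z i - a i) * (z i - a i)) = of_real (L z) ^ 2" .
    have "(\<Sum>i<n. u i z * (z i - a i)) = (\<Sum>i<n. c i * (z i - a i)) +
        \<rho> z / of_real (L z) ^ 2 * (\<Sum>i<n. cnj (z i - a i) * (z i - a i))"
      unfolding sum_distrib_left sum.distrib[symmetric] using False
      by (intro sum.cong refl) (simp add: u_def distrib_right mult.assoc del: complex_cnj_diff)
    also have "\<dots> = (\<Sum>i<n. c i * (z i - a i)) + \<rho> z"
      unfolding s using \<open>L z \<noteq> 0\<close> by simp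
    finally show ?thesis by (simp add: \<rho>_def)
  qed auto
  then have "\<forall>\<^sub>F z in nhdsin (Cspace n) a. h z - h a = (\<Sum>i<n. u i z * (z i - a i))"
    using eventually_nhdsin_topspace[of "Cspace n" a] by (auto elim: eventually_mono)
  ultimately show ?thesis
    using a by (intro cdiffI)
qed

lemma cdiff_imp_frechet:
  assumes "cdiff n h a"
  shows "\<exists>c. ((\<lambda>z. (h z - h a - (\<Sum>i<n. c i * (z i - a i))) /
       of_real (L2_set (\<lambda>i. cmod (z i - a i)) {..<n})) \<longlongrightarrow> 0) (atin (Cspace n) a)"
proof -
  obtain u where u: "\<forall>i<n. (u i \<longlongrightarrow> u i a) (nhdsin (Cspace n) a)"
    and ev: "\<forall>\<^sub>F z in nhdsin (Cspace n) a. h z - h a = (\<Sum>i<n. u i z * (z i - a i))"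
    using assms by (rule cdiffE)
  define L where "L z = L2_set (\<lambda>i. cmod (z i - a i)) {..<n}" for z
  have "((\<lambda>z. (h z - h a - (\<Sum>i<n. u i a * (z i - a i))) / of_real (L z)) \<longlongrightarrow> 0) (nhdsin (Cspace n) a)"
  proof (rule Lim_null_comparison)
    have "((\<lambda>z. \<Sum>i<n. cmod (u i z - u i a)) \<longlongrightarrow> (\<Sum>i<n. cmod (u i a - u i a))) (nhdsin (Cspace n) a)"
      using u by (intro tendsto_intros) auto
    then show "((\<lambda>z. \<Sum>i<n. cmod (u i z - u i a)) \<longlongrightarrow> 0) (nhdsin (Cspace n) a)"
      by simp
    show "\<forall>\<^sub>F z in nhdsin (Cspace n) a.
        cmod ((h z - h a - (\<Sum>i<n. u i a * (z i - a i))) / of_real (L z)) \<le> (\<Sum>i<n. cmod (u i z - u i a))"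
      using ev
    proof eventually_elim
      case (elim z)
      have L: "cmod (z i - a i) \<le> L z" if "i < n" for i
        unfolding L_def using that by (intro member_le_L2_set) auto
      have "L z \<ge> 0" by (simp add: L_def L2_set_nonneg)
      have "cmod (\<Sum>i<n. (u i z - u i a) * (z i - a i)) \<le> (\<Sum>i<n. cmod (u i z - u i a) * L z)"
        using L by (intro sum_norm_le) (auto simp: norm_mult intro: mult_left_mono)
      also have "\<dots> = (\<Sum>i<n. cmod (u i z - u i a)) * L z"
        by (simp add: sum_distrib_right)
      finally have "cmod (h z - h a - (\<Sum>i<n. u i a * (z i - a i))) \<le> (\<Sum>i<n. cmod (u i z - u i a)) * L z"
        unfolding elim by (simp add: sum_subtractf[symmetric] algebra_simps)
      then show ?case
        using \<open>L z \<ge> 0\<close> by (cases "L z = 0") (auto simp: norm_divide divide_simps sum_nonneg)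
    qed
  qed
  then show ?thesis
    unfolding L_def by (intro exI[of _ "\<lambda>i. u i a"]) (rule tendsto_atin_nhdsin)
qed

lemma holomorphic_Cn_iff:
  "holomorphic_Cn n U h \<longleftrightarrow> openin (Cspace n) U \<and> (\<forall>a\<in>U. cdiff n h a)"
proof -
  have "cdiff n h a \<longleftrightarrow> (\<exists>c. ((\<lambda>z. (h z - h a - (\<Sum>i<n. c i * (z i - a i))) /
       of_real (L2_set (\<lambda>i. cmod (z i - a i)) {..<n})) \<longlongrightarrow> 0) (atin (Cspace n) a))"
    if "openin (Cspace n) U" "a \<in> U" for a
    using openin_subset[OF that(1)] that(2) cdiff_imp_frechet[of n h a] frechet_imp_cdiff[of a n h]
    by auto
  then show ?thesis unfolding holomorphic_Cn_def by auto
qed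

lemma holomorphic_near_iff:
  "holomorphic_near n a h \<longleftrightarrow> a \<in> topspace (Cspace n) \<and> (\<forall>\<^sub>F z in nhdsin (Cspace n) a. cdiff n h z)"
proof
  assume "holomorphic_near n a h"
  then obtain U where U: "a \<in> U" "openin (Cspace n) U" "\<forall>z\<in>U. cdiff n h z"
    unfolding holomorphic_near_def holomorphic_Cn_iff by auto
  then have "a \<in> topspace (Cspace n)" using openin_subset[OF U(2)] by auto
  then show "a \<in> topspace (Cspace n) \<and> (\<forall>\<^sub>F z in nhdsin (Cspace n) a. cdiff n h z)"
    unfolding eventually_nhdsin using U by auto
next
  assume "a \<in> topspace (Cspace n) \<and> (\<forall>\<^sub>F z in nhdsin (Cspace n) a. cdiff n h z)"
  then obtain U where "openin (Cspace n) U" "a \<in> U" "\<forall>z\<in>U. cdiff n h z"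
    unfolding eventually_nhdsin by auto
  then show "holomorphic_near n a h"
    unfolding holomorphic_near_def holomorphic_Cn_iff by auto
qed

lemma cdiff_topspace: "cdiff n h a \<Longrightarrow> a \<in> topspace (Cspace n)"
  by (simp add: cdiff_def)

lemma cdiff_tendsto:
  assumes "cdiff n h a"
  shows "(h \<longlongrightarrow> h a) (nhdsin (Cspace n) a)"
proof -
  obtain u where u: "\<forall>i<n. (u i \<longlongrightarrow> u i a) (nhdsin (Cspace n) a)"
    and ev: "\<forall>\<^sub>F z in nhdsin (Cspace n) a. h z - h a = (\<Sum>i<n. u i z * (z i - a i))"
    using assms by (rule cdiffE)
  have "((\<lambda>z. h a + (\<Sum>i<n. u i z * (z i - a i))) \<longlongrightarrow> h a + (\<Sum>i<n. u i a * (a i - a i))) (nhdsin (Cspace n) a)"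
    using u tendsto_coordinate[OF cdiff_topspace[OF assms]] by (intro tendsto_intros) auto
  then have "((\<lambda>z. h a + (\<Sum>i<n. u i z * (z i - a i))) \<longlongrightarrow> h a) (nhdsin (Cspace n) a)"
    by simp
  moreover have "\<forall>\<^sub>F z in nhdsin (Cspace n) a. h a + (\<Sum>i<n. u i z * (z i - a i)) = h z"
    using ev by eventually_elim (simp add: diff_eq_eq)
  ultimately show ?thesis
    by (rule Lim_transform_eventually)
qed

lemma cdiff_cong:
  assumes ev: "\<forall>\<^sub>F z in nhdsin (Cspace n) a. h z = k z"
  shows "cdiff n h a \<longleftrightarrow> cdiff n k a"
proof -
  have "cdiff n k a" if hd: "cdiff n h a" and ev: "\<forall>\<^sub>F z in nhdsin (Cspace n) a. h z = k z" for h k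
  proof -
    obtain u where u: "\<forall>i<n. (u i \<longlongrightarrow> u i a) (nhdsin (Cspace n) a)"
      and u2: "\<forall>\<^sub>F z in nhdsin (Cspace n) a. h z - h a = (\<Sum>i<n. u i z * (z i - a i))"
      using hd by (rule cdiffE)
    have "h a = k a" using eventually_nhdsin_self[OF ev cdiff_topspace[OF hd]] .
    from u2 ev have "\<forall>\<^sub>F z in nhdsin (Cspace n) a. k z - k a = (\<Sum>i<n. u i z * (z i - a i))"
      by eventually_elim (use \<open>h a = k a\<close> in simp)
    then show ?thesis
      using cdiff_topspace[OF hd] u by (intro cdiffI) auto
  qed
  from this[of h k] this[of k h] show ?thesis
    using ev by (auto simp: eq_commute)
qed

lemma cdiff_const: "a \<in> topspace (Cspace n) \<Longrightarrow> cdiff n (\<lambda>_. c) a"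
  unfolding cdiff_def by (intro conjI exI[of _ "\<lambda>_ _. 0"]) auto

lemma cdiff_coordinate: "a \<in> topspace (Cspace n) \<Longrightarrow> j < n \<Longrightarrow> cdiff n (\<lambda>z. z j) a"
  unfolding cdiff_def
  by (intro conjI exI[of _ "\<lambda>i _. if i = j then 1 else 0"]) (auto simp: if_distrib[of "\<lambda>x. x * _"] sum.delta cong: if_cong)

lemma cdiff_add:
  assumes "cdiff n f a" "cdiff n g a"
  shows "cdiff n (\<lambda>z. f z + g z) a"
proof -
  obtain u where u: "\<forall>i<n. (u i \<longlongrightarrow> u i a) (nhdsin (Cspace n) a)"
    and u2: "\<forall>\<^sub>F z in nhdsin (Cspace n) a. f z - f a = (\<Sum>i<n. u i z * (z i - a i))"
    using assms(1) by (rule cdiffE)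
  obtain v where v: "\<forall>i<n. (v i \<longlongrightarrow> v i a) (nhdsin (Cspace n) a)"
    and v2: "\<forall>\<^sub>F z in nhdsin (Cspace n) a. g z - g a = (\<Sum>i<n. v i z * (z i - a i))"
    using assms(2) by (rule cdiffE)
  have "\<forall>\<^sub>F z in nhdsin (Cspace n) a. (f z + g z) - (f a + g a) = (\<Sum>i<n. (u i z + v i z) * (z i - a i))"
    using u2 v2
  proof eventually_elim
    case (elim z)
    have "(f z + g z) - (f a + g a) = (f z - f a) + (g z - g a)" by simp
    then show ?case unfolding elim by (simp add: sum.distrib distrib_right)
  qed
  then show ?thesis
    using cdiff_topspace[OF assms(1)] u v
    by (intro cdiffI[where u = "\<lambda>i z. u i z + v i z"]) (auto intro: tendsto_add)
qed

lemma cdiff_mult: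
  assumes "cdiff n f a" "cdiff n g a"
  shows "cdiff n (\<lambda>z. f z * g z) a"
proof -
  obtain u where u: "\<forall>i<n. (u i \<longlongrightarrow> u i a) (nhdsin (Cspace n) a)"
    and u2: "\<forall>\<^sub>F z in nhdsin (Cspace n) a. f z - f a = (\<Sum>i<n. u i z * (z i - a i))"
    using assms(1) by (rule cdiffE)
  obtain v where v: "\<forall>i<n. (v i \<longlongrightarrow> v i a) (nhdsin (Cspace n) a)"
    and v2: "\<forall>\<^sub>F z in nhdsin (Cspace n) a. g z - g a = (\<Sum>i<n. v i z * (z i - a i))"
    using assms(2) by (rule cdiffE)
  have "\<forall>\<^sub>F z in nhdsin (Cspace n) a. f z * g z - f a * g a =
      (\<Sum>i<n. (g a * u i z + f z * v i z) * (z i - a i))"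
    using u2 v2
  proof eventually_elim
    case (elim z)
    have "f z * g z - f a * g a = g a * (f z - f a) + f z * (g z - g a)" by (simp add: algebra_simps)
    then show ?case unfolding elim
      by (simp only: sum_distrib_left sum.distrib[symmetric]) (simp add: algebra_simps)
  qed
  then show ?thesis
    using cdiff_topspace[OF assms(1)] u v cdiff_tendsto[OF assms(1)]
    by (intro cdiffI[where u = "\<lambda>i z. g a * u i z + f z * v i z"]) (auto intro!: tendsto_intros)
qed

lemma cdiff_sum:
  "a \<in> topspace (Cspace n) \<Longrightarrow> (\<And>i. i \<in> I \<Longrightarrow> cdiff n (f i) a) \<Longrightarrow> cdiff n (\<lambda>z. \<Sum>i\<in>I. f i z) a"
  by (induction I rule: infinite_finite_induct) (auto intro: cdiff_const cdiff_add)

lemma cdiff_prod: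
  "a \<in> topspace (Cspace n) \<Longrightarrow> (\<And>i. i \<in> I \<Longrightarrow> cdiff n (f i) a) \<Longrightarrow> cdiff n (\<lambda>z. \<Prod>i\<in>I. f i z) a"
  by (induction I rule: infinite_finite_induct) (auto intro: cdiff_const cdiff_mult)

lemma cdiff_power: "cdiff n f a \<Longrightarrow> cdiff n (\<lambda>z. f z ^ k) a"
  by (induction k) (auto intro: cdiff_const cdiff_mult cdiff_topspace)

lemma cdiff_polynomial:
  "a \<in> topspace (Cspace n) \<Longrightarrow> polynomial_function K n p \<Longrightarrow> cdiff n p a"
  unfolding polynomial_function_def
  by (auto intro!: cdiff_sum cdiff_mult cdiff_prod cdiff_const cdiff_power cdiff_coordinate)

text \<open>Entries from \<open>n\<close> on are cut off to 0, so the result lies in n-space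
  whatever \<open>v\<close> is. Unfolded, this is the argument that
  \<open>composition_operator\<close> passes to \<open>f\<close>.\<close>

definition cvec_of :: "nat \<Rightarrow> (nat \<Rightarrow> complex) \<Rightarrow> cvec" where
  "cvec_of n v = (\<lambda>i. if i < n then v i else 0)"

lemma cvec_of_topspace [simp]: "cvec_of n v \<in> topspace (Cspace n)"
  by (simp add: cvec_of_def topspace_Cspace)

lemma cvec_of_nth: "i < n \<Longrightarrow> cvec_of n v i = v i"
  by (simp add: cvec_of_def)

lemma cvec_of_eq: "a \<in> topspace (Cspace n) \<Longrightarrow> (\<And>i. i < n \<Longrightarrow> v i = a i) \<Longrightarrow> cvec_of n v = a"
  by (auto simp: cvec_of_def topspace_Cspace)

lemma filterlim_cvec_of:
  assumes "a \<in> topspace (Cspace n)" and "\<And>i. i < n \<Longrightarrow> ((\<lambda>x. G x i) \<longlongrightarrow> a i) F"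
  shows "filterlim (\<lambda>x. cvec_of n (G x)) (nhdsin (Cspace n) a) F"
  by (intro filterlim_Cspace) (use assms in \<open>auto simp: cvec_of_nth\<close>)

lemma filterlim_cdiff:
  assumes a: "a \<in> topspace (Cspace n)" and g: "\<And>i. i < n \<Longrightarrow> cdiff m (g i) b" "\<And>i. i < n \<Longrightarrow> g i b = a i"
  shows "filterlim (\<lambda>z. cvec_of n (\<lambda>i. g i z)) (nhdsin (Cspace n) a) (nhdsin (Cspace m) b)"
  using cdiff_tendsto[OF g(1)] g(2) a by (intro filterlim_cvec_of) auto

lemma cdiff_compose:
  assumes b: "b \<in> topspace (Cspace m)" and f: "cdiff n f a"
    and g: "\<And>i. i < n \<Longrightarrow> cdiff m (g i) b" "\<And>i. i < n \<Longrightarrow> g i b = a i"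
  shows "cdiff m (\<lambda>z. f (cvec_of n (\<lambda>i. g i z))) b"
proof -
  have a: "a \<in> topspace (Cspace n)" using f by (rule cdiff_topspace)
  obtain u where u: "\<forall>i<n. (u i \<longlongrightarrow> u i a) (nhdsin (Cspace n) a)"
    and u2: "\<forall>\<^sub>F z in nhdsin (Cspace n) a. f z - f a = (\<Sum>i<n. u i z * (z i - a i))"
    using f by (rule cdiffE)
  define V where "V i v \<longleftrightarrow> (\<forall>j<m. (v j \<longlongrightarrow> v j b) (nhdsin (Cspace m) b)) \<and>
      (\<forall>\<^sub>F z in nhdsin (Cspace m) b. g i z - g i b = (\<Sum>j<m. v j z * (z j - b j)))" for i v
  have "\<exists>v. V i v" if "i < n" for i
    using g(1)[OF that] unfolding cdiff_def V_def by (elim conjE)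
  then obtain v where V: "\<And>i. i < n \<Longrightarrow> V i (v i)" by metis
  have v: "\<And>i j. i < n \<Longrightarrow> j < m \<Longrightarrow> (v i j \<longlongrightarrow> v i j b) (nhdsin (Cspace m) b)"
    and v2: "\<And>i. i < n \<Longrightarrow> \<forall>\<^sub>F z in nhdsin (Cspace m) b. g i z - g i b = (\<Sum>j<m. v i j z * (z j - b j))"
    using V unfolding V_def by auto
  let ?G = "\<lambda>z. cvec_of n (\<lambda>i. g i z)"
  have lim: "filterlim ?G (nhdsin (Cspace n) a) (nhdsin (Cspace m) b)"
    by (rule filterlim_cdiff[OF a g])
  have Gb: "?G b = a" using a g(2) by (intro cvec_of_eq) auto
  define w where "w j z = (\<Sum>i<n. u i (?G z) * v i j z)" for j z
  have "(w j \<longlongrightarrow> w j b) (nhdsin (Cspace m) b)" if "j < m" for j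
    unfolding w_def Gb using that v filterlim_compose[OF u[rule_format] lim] by (intro tendsto_intros) auto
  moreover have "\<forall>\<^sub>F z in nhdsin (Cspace m) b. f (?G z) - f (?G b) = (\<Sum>j<m. w j z * (z j - b j))"
  proof -
    have "\<forall>\<^sub>F z in nhdsin (Cspace m) b. \<forall>i\<in>{..<n}. g i z - g i b = (\<Sum>j<m. v i j z * (z j - b j))"
      using v2 by (intro eventually_ball_finite) auto
    moreover have "\<forall>\<^sub>F z in nhdsin (Cspace m) b. f (?G z) - f a = (\<Sum>i<n. u i (?G z) * (?G z i - a i))"
      using lim[unfolded filterlim_iff, rule_format, OF u2] .
    ultimately show ?thesis
    proof eventually_elim
      case (elim z)
      have "f (?G z) - f (?G b) = (\<Sum>i<n. u i (?G z) * (g i z - g i b))"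
        unfolding Gb elim(2) using g(2) by (intro sum.cong refl) (simp add: cvec_of_nth)
      also have "\<dots> = (\<Sum>i<n. \<Sum>j<m. u i (?G z) * v i j z * (z j - b j))"
        using elim(1) by (intro sum.cong refl) (simp add: sum_distrib_left mult.assoc)
      also have "\<dots> = (\<Sum>j<m. w j z * (z j - b j))"
        unfolding w_def sum_distrib_right by (rule sum.swap)
      finally show ?case .
    qed
  qed
  ultimately show ?thesis
    using b by (intro cdiffI)
qed

lemma cdiff_one_variable:
  assumes "a \<in> topspace (Cspace 1)" "\<phi> field_differentiable at (a 0)"
  shows "cdiff 1 (\<lambda>z. \<phi> (z 0)) a"
proof -
  obtain \<phi>' where "(\<phi> has_field_derivative \<phi>') (at (a 0))"
    using assms(2) unfolding field_differentiable_def by blast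
  then obtain q where q: "\<And>z. \<phi> z - \<phi> (a 0) = q z * (z - a 0)" "isCont q (a 0)"
    unfolding CARAT_DERIV by blast
  have "((\<lambda>z. q (z 0)) \<longlongrightarrow> q (a 0)) (nhdsin (Cspace 1) a)"
    by (rule isCont_tendsto_compose[OF q(2) tendsto_coordinate[OF assms(1)]])
  then show ?thesis
    using assms(1) q(1) by (intro cdiffI[where u = "\<lambda>_ z. q (z 0)"]) auto
qed

text \<open>The gradient is specified by its effect on differentiable curves through the point,
  which is the form in which it is used; one \<open>c\<close> serves all curves.\<close>

definition has_gradient :: "nat \<Rightarrow> (cvec \<Rightarrow> complex) \<Rightarrow> cvec \<Rightarrow> (nat \<Rightarrow> complex) \<Rightarrow> bool" where
  "has_gradient n h a c \<longleftrightarrow> (\<forall>\<gamma> \<gamma>' t. (\<forall>i<n. (\<gamma> i has_field_derivative \<gamma>' i) (at t) \<and> \<gamma> i t = a i) \<longrightarrow>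
    ((\<lambda>t. h (cvec_of n (\<lambda>i. \<gamma> i t))) has_field_derivative (\<Sum>i<n. c i * \<gamma>' i)) (at t))"

lemma cdiff_has_gradient:
  assumes h: "cdiff n h a"
  shows "\<exists>c. has_gradient n h a c"
proof -
  have a: "a \<in> topspace (Cspace n)" using h by (rule cdiff_topspace)
  obtain u where u: "\<forall>i<n. (u i \<longlongrightarrow> u i a) (nhdsin (Cspace n) a)"
    and ev: "\<forall>\<^sub>F z in nhdsin (Cspace n) a. h z - h a = (\<Sum>i<n. u i z * (z i - a i))"
    using h by (rule cdiffE)
  show ?thesis
    unfolding has_gradient_def
  proof (intro exI[of _ "\<lambda>i. u i a"] allI impI)
    fix \<gamma> \<gamma>' :: "nat \<Rightarrow> _" and t :: complex
    assume *: "\<forall>i<n. (\<gamma> i has_field_derivative \<gamma>' i) (at t) \<and> \<gamma> i t = a i"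
    then have der: "\<And>i. i < n \<Longrightarrow> (\<gamma> i has_field_derivative \<gamma>' i) (at t)" and t: "\<And>i. i < n \<Longrightarrow> \<gamma> i t = a i"
      by auto
    let ?G = "\<lambda>s. cvec_of n (\<lambda>i. \<gamma> i s)"
    have Gt: "?G t = a" using a t by (intro cvec_of_eq) auto
    have "(\<gamma> i \<longlongrightarrow> a i) (at t)" if "i < n" for i
      using DERIV_isCont[OF der[OF that]] t[OF that] by (simp add: isCont_def)
    then have lim: "filterlim ?G (nhdsin (Cspace n) a) (at t)"
      using a by (intro filterlim_cvec_of)
    have "((\<lambda>s. \<Sum>i<n. u i (?G s) * ((\<gamma> i s - \<gamma> i t) / (s - t))) \<longlongrightarrow> (\<Sum>i<n. u i a * \<gamma>' i)) (at t)"
      using der filterlim_compose[OF u[rule_format] lim]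
      by (intro tendsto_sum tendsto_mult) (auto simp: has_field_derivative_iff)
    moreover have "\<forall>\<^sub>F s in at t. (\<Sum>i<n. u i (?G s) * ((\<gamma> i s - \<gamma> i t) / (s - t))) = (h (?G s) - h (?G t)) / (s - t)"
      using lim[unfolded filterlim_iff, rule_format, OF ev]
    proof eventually_elim
      case (elim s)
      show ?case
        unfolding Gt elim sum_divide_distrib
        by (intro sum.cong refl) (simp add: t cvec_of_nth)
    qed
    ultimately have "((\<lambda>s. (h (?G s) - h (?G t)) / (s - t)) \<longlongrightarrow> (\<Sum>i<n. u i a * \<gamma>' i)) (at t)"
      by (rule Lim_transform_eventually)
    then show "((\<lambda>t. h (?G t)) has_field_derivative (\<Sum>i<n. u i a * \<gamma>' i)) (at t)"
      by (simp add: has_field_derivative_iff)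
  qed
qed

lemma cdiff_curve:
  assumes h: "cdiff n h a" and g: "\<And>i. i < n \<Longrightarrow> \<gamma> i field_differentiable at t" "\<And>i. i < n \<Longrightarrow> \<gamma> i t = a i"
  shows "(\<lambda>t. h (cvec_of n (\<lambda>i. \<gamma> i t))) field_differentiable at t"
proof -
  obtain \<gamma>' where "\<And>i. i < n \<Longrightarrow> (\<gamma> i has_field_derivative \<gamma>' i) (at t)"
    using g(1) unfolding field_differentiable_def by metis
  then show ?thesis
    using cdiff_has_gradient[OF h] g(2) unfolding field_differentiable_def has_gradient_def by metis
qed

lemma fun_upd_topspace: "a \<in> topspace (Cspace n) \<Longrightarrow> j < n \<Longrightarrow> a(j := w) \<in> topspace (Cspace n)"
  by (simp add: topspace_Cspace)

lemma fun_upd_eq_cvec_of: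
  "a \<in> topspace (Cspace n) \<Longrightarrow> j < n \<Longrightarrow> a(j := w) = cvec_of n (\<lambda>i. if i = j then w else a i)"
  by (auto simp: topspace_Cspace cvec_of_def)

lemma filterlim_conjugate:
  assumes a: "a \<in> topspace (Cspace n)"
  shows "filterlim (\<lambda>z i. cnj (z i)) (nhdsin (Cspace n) a) (nhdsin (Cspace n) (\<lambda>i. cnj (a i)))"
proof (rule filterlim_Cspace[OF a])
  let ?a = "\<lambda>i. cnj (a i)"
  have a': "?a \<in> topspace (Cspace n)" using a by (simp add: topspace_Cspace)
  show "\<forall>\<^sub>F z in nhdsin (Cspace n) ?a. (\<lambda>i. cnj (z i)) \<in> topspace (Cspace n)"
    using eventually_nhdsin_topspace by eventually_elim (simp add: topspace_Cspace)
  show "((\<lambda>z. cnj (z i)) \<longlongrightarrow> a i) (nhdsin (Cspace n) ?a)" for i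
    using tendsto_cnj[OF tendsto_coordinate[OF a', of i]] by simp
qed

lemma cdiff_conjugate:
  assumes "cdiff n h a"
  shows "cdiff n (\<lambda>z. cnj (h (\<lambda>i. cnj (z i)))) (\<lambda>i. cnj (a i))"
proof -
  have a: "a \<in> topspace (Cspace n)" using assms by (rule cdiff_topspace)
  let ?a = "\<lambda>i. cnj (a i)"
  have a': "?a \<in> topspace (Cspace n)" using a by (simp add: topspace_Cspace)
  obtain u where u: "\<forall>i<n. (u i \<longlongrightarrow> u i a) (nhdsin (Cspace n) a)"
    and u2: "\<forall>\<^sub>F z in nhdsin (Cspace n) a. h z - h a = (\<Sum>i<n. u i z * (z i - a i))"
    using assms by (rule cdiffE)
  note lim = filterlim_conjugate[OF a]
  have "((\<lambda>z. cnj (u i (\<lambda>i. cnj (z i)))) \<longlongrightarrow> cnj (u i a)) (nhdsin (Cspace n) ?a)" if "i < n" for i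
    using tendsto_cnj[OF filterlim_compose[OF u[rule_format, OF that] lim]] .
  moreover have "\<forall>\<^sub>F z in nhdsin (Cspace n) ?a. cnj (h (\<lambda>i. cnj (z i))) - cnj (h a) =
      (\<Sum>i<n. cnj (u i (\<lambda>i. cnj (z i))) * (z i - ?a i))"
    using filterlim_iff[THEN iffD1, OF lim, rule_format, OF u2]
  proof eventually_elim
    case (elim z)
    from arg_cong[OF this, of cnj] show ?case by simp
  qed
  ultimately show ?thesis
    using a' by (intro cdiffI[where u = "\<lambda>i z. cnj (u i (\<lambda>i. cnj (z i)))"]) auto
qed

section \<open>Partial derivatives\<close>

text \<open>Cauchy's inequalities are applied on discs of radius \<rho> / 3 about points of the
  closed unit disc, which stay in the large ball because 1 + \<rho> / 3 < \<rho>. Taylor's formula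
  with one and with two terms then yields the constants 3 = 1! * 3 and 18 = 2! * 3^2.\<close>

lemma cauchy_remainder_bounds:
  assumes hol: "\<phi> holomorphic_on ball 0 \<rho>" and \<rho>: "2 \<le> \<rho>" and M: "\<And>z. z \<in> ball 0 \<rho> \<Longrightarrow> cmod (\<phi> z) \<le> M"
  shows "cmod (\<phi> 1 - \<phi> 0) \<le> 3 * M / \<rho>" and "cmod (\<phi> 1 - \<phi> 0 - deriv \<phi> 0) \<le> 18 * M / \<rho>\<^sup>2"
proof -
  have B: "cmod ((deriv ^^ k) \<phi> w) \<le> fact k * M / (\<rho> / 3) ^ k" if w: "w \<in> cball 0 1" for w k
  proof (rule Cauchy_inequality)
    have sub: "cball w (\<rho> / 3) \<subseteq> ball 0 \<rho>"
    proof
      fix x assume "x \<in> cball w (\<rho> / 3)"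
      then have "cmod (x - w) \<le> \<rho> / 3" by (simp add: dist_norm norm_minus_commute)
      then show "x \<in> ball 0 \<rho>" using w \<rho> norm_triangle_ineq[of "x - w" w] by simp
    qed
    show "\<phi> holomorphic_on ball w (\<rho> / 3)"
      using sub ball_subset_cball by (intro holomorphic_on_subset[OF hol]) blast
    show "continuous_on (cball w (\<rho> / 3)) \<phi>"
      using sub by (intro holomorphic_on_imp_continuous_on holomorphic_on_subset[OF hol])
    show "0 < \<rho> / 3" using \<rho> by simp
    show "cmod (\<phi> x) \<le> M" if "cmod (w - x) = \<rho> / 3" for x
      using that sub by (intro M) (auto simp: dist_norm)
  qed
  have sub: "cball 0 1 \<subseteq> ball (0::complex) \<rho>" using \<rho> by auto
  have der: "((deriv ^^ i) \<phi> has_field_derivative (deriv ^^ Suc i) \<phi> x) (at x within cball 0 1)"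
    if "x \<in> cball 0 1" for i x
    using holomorphic_derivI[OF holomorphic_higher_deriv[OF hol]] that sub
    by (auto intro: DERIV_subset)
  have T: "cmod ((deriv ^^ 0) \<phi> 1 - (\<Sum>i\<le>k. (deriv ^^ i) \<phi> 0 * (1 - 0) ^ i / fact i)) \<le>
      (fact (Suc k) * M / (\<rho> / 3) ^ Suc k) * cmod (1 - 0) ^ Suc k / fact k" for k
    by (rule complex_Taylor[where S = "cball 0 1" and f = "\<lambda>i. (deriv ^^ i) \<phi>"])
      (use B[of _ "Suc k"] der in auto)
  show "cmod (\<phi> 1 - \<phi> 0) \<le> 3 * M / \<rho>"
    using T[of 0] by (simp add: mult.commute)
  show "cmod (\<phi> 1 - \<phi> 0 - deriv \<phi> 0) \<le> 18 * M / \<rho>\<^sup>2"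
    using T[of 1] by (simp add: power2_eq_square diff_diff_eq power_divide)
qed

section \<open>Cauchy estimates on polydiscs, by restriction to complex lines\<close>

context
  fixes n :: nat and h :: "cvec \<Rightarrow> complex" and a b z :: cvec and r M \<sigma> :: real
  assumes h: "\<And>z. z \<in> polydisc n a r \<Longrightarrow> cdiff n h z \<and> cmod (h z) \<le> M"
    and b: "b \<in> polydisc n a (r / 2)" and z: "z \<in> topspace (Cspace n)"
    and \<sigma>: "\<And>i. i < n \<Longrightarrow> cmod (z i - b i) \<le> \<sigma>" "0 < \<sigma>" "\<sigma> \<le> r / 4"
begin

text \<open>The complex line through \<open>b\<close> (parameter 0) and \<open>z\<close> (parameter
  1). As z - b is at most \<sigma> in each coordinate, the parameter can run over the disc of radius
  r / (2 \<sigma>) without leaving the polydisc.\<close>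

private definition "\<phi> s = h (cvec_of n (\<lambda>i. b i + s * (z i - b i)))"

private lemma line: "s \<in> ball 0 (r / (2 * \<sigma>)) \<Longrightarrow> cvec_of n (\<lambda>i. b i + s * (z i - b i)) \<in> polydisc n a r"
proof -
  assume "s \<in> ball 0 (r / (2 * \<sigma>))"
  then have l: "cmod s * \<sigma> < r / 2" using \<sigma> by (simp add: field_simps)
  have "cmod (b i + s * (z i - b i) - a i) < r" if "i < n" for i
  proof -
    have "cmod (b i + s * (z i - b i) - a i) \<le> cmod (b i - a i) + cmod s * cmod (z i - b i)"
    proof -
      have "b i + s * (z i - b i) - a i = (b i - a i) + s * (z i - b i)" by simp
      then show ?thesis by (metis norm_mult norm_triangle_ineq)
    qed
    also have "\<dots> \<le> cmod (b i - a i) + cmod s * \<sigma>"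
      using \<sigma>(1)[OF that] by (intro add_left_mono mult_left_mono) auto
    also have "\<dots> < r" using l b that by (force simp: polydisc_def)
    finally show ?thesis .
  qed
  then show ?thesis by (simp add: polydisc_def cvec_of_nth)
qed

private lemma ends: "\<phi> 0 = h b" "\<phi> 1 = h z"
  using b z by (auto simp: \<phi>_def polydisc_def intro!: arg_cong[where f = h] cvec_of_eq)

private lemma holo: "\<phi> holomorphic_on ball 0 (r / (2 * \<sigma>))"
  unfolding \<phi>_def[abs_def] holomorphic_on_open[OF open_ball] field_differentiable_def[symmetric]
proof
  fix s :: complex assume "s \<in> ball 0 (r / (2 * \<sigma>))"
  then have "cdiff n h (cvec_of n (\<lambda>i. b i + s * (z i - b i)))"
    using line h by simp
  then show "(\<lambda>s. h (cvec_of n (\<lambda>i. b i + s * (z i - b i)))) field_differentiable at s"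
    by (rule cdiff_curve) (auto simp: cvec_of_nth intro!: derivative_intros)
qed

private lemma large: "2 \<le> r / (2 * \<sigma>)"
  using \<sigma> by (simp add: field_simps)

private lemma bound: "s \<in> ball 0 (r / (2 * \<sigma>)) \<Longrightarrow> cmod (\<phi> s) \<le> M"
  unfolding \<phi>_def using line h by simp

text \<open>This is 3 M / \<rho> for \<rho> = r / (2 \<sigma>). It depends on \<open>h\<close> only
  through \<open>M\<close>, so it is uniform over families with a common bound.\<close>

lemma polydisc_lipschitz: "cmod (h z - h b) \<le> 6 * M / r * \<sigma>"
  using cauchy_remainder_bounds(1)[OF holo large bound] \<sigma>(2) by (simp add: ends field_simps)

text \<open>Again \<rho> = r / (2 \<sigma>), whence 72 = 18 * 2^2. A quadratic error whose constant
  depends on \<open>h\<close> only through \<open>M\<close> survives the passage to a limit of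
  functions.\<close>

lemma polydisc_quadratic:
  assumes c: "has_gradient n h b c"
  shows "cmod (h z - h b - (\<Sum>i<n. c i * (z i - b i))) \<le> 72 * M / r\<^sup>2 * \<sigma>\<^sup>2"
proof -
  have "deriv \<phi> 0 = (\<Sum>i<n. c i * (z i - b i))"
    unfolding \<phi>_def[abs_def] by (rule DERIV_imp_deriv, rule c[unfolded has_gradient_def, rule_format]) (auto intro!: derivative_eq_intros)
  then show ?thesis
    using cauchy_remainder_bounds(2)[OF holo large bound] by (simp add: ends power_divide power_mult_distrib)
qed

end

lemma eventually_cdiff_bounded:
  assumes a: "a \<in> topspace (Cspace n)" and ev: "\<forall>\<^sub>F z in nhdsin (Cspace n) a. cdiff n h z"
  obtains r M where "r > 0" "M > 0" "\<And>z. z \<in> polydisc n a r \<Longrightarrow> cdiff n h z \<and> cmod (h z) \<le> M"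
proof -
  have "(h \<longlongrightarrow> h a) (nhdsin (Cspace n) a)"
    using eventually_nhdsin_self[OF ev a] by (rule cdiff_tendsto)
  then have "\<forall>\<^sub>F z in nhdsin (Cspace n) a. dist (h z) (h a) < 1"
    by (simp add: tendsto_iff)
  with ev have "\<forall>\<^sub>F z in nhdsin (Cspace n) a. cdiff n h z \<and> cmod (h z) \<le> cmod (h a) + 1"
  proof eventually_elim
    case (elim z)
    then show ?case using norm_triangle_ineq2[of "h z" "h a"] by (simp add: dist_norm)
  qed
  then obtain r where "r > 0" "\<forall>z\<in>polydisc n a r. cdiff n h z \<and> cmod (h z) \<le> cmod (h a) + 1"
    unfolding eventually_nhdsin_Cspace[OF a] by auto
  then show thesis
    by (intro that[of r "cmod (h a) + 1"]) (auto simp: add_nonneg_pos)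
qed

text \<open>The expression in \<open>derivative_operator\<close>. It is total because
  \<open>deriv\<close> is, and meaningful where \<open>h\<close> is differentiable in the j-th
  coordinate.\<close>

definition partial :: "nat \<Rightarrow> (cvec \<Rightarrow> complex) \<Rightarrow> cvec \<Rightarrow> complex" where
  "partial j h z = deriv (\<lambda>w. h (z(j := w))) (z j)"

lemma partial_has_field_derivative:
  assumes "cdiff n h (z(j := x))" "j < n" "z \<in> topspace (Cspace n)"
  shows "((\<lambda>w. h (z(j := w))) has_field_derivative partial j h (z(j := x))) (at x)"
proof -
  have "(\<lambda>w. h (cvec_of n (\<lambda>i. if i = j then w else z i))) field_differentiable at x"
  proof (rule cdiff_curve[OF assms(1)])
    show "(\<lambda>w. if i = j then w else z i) field_differentiable at x" for i
      by (cases "i = j") auto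
  qed auto
  then have "(\<lambda>w. h (z(j := w))) field_differentiable at x"
    using assms by (simp add: fun_upd_eq_cvec_of)
  then show ?thesis
    by (simp add: partial_def DERIV_deriv_iff_field_differentiable)
qed

lemma bounded_imp_convergent_subsequence_coordinates:
  fixes c :: "nat \<Rightarrow> nat \<Rightarrow> complex"
  assumes "\<And>i. i < n \<Longrightarrow> bounded (range (\<lambda>k. c k i))"
  shows "\<exists>l r. strict_mono (r :: nat \<Rightarrow> nat) \<and> (\<forall>i<n. (\<lambda>k. c (r k) i) \<longlonglongrightarrow> l i)"
  using assms
proof (induction n)
  case 0
  show ?case by (intro exI[of _ "\<lambda>_. 0"] exI[of _ id]) (auto simp: strict_mono_def)
next
  case (Suc n)
  then obtain l r where r: "strict_mono (r :: nat \<Rightarrow> nat)" "\<forall>i<n. (\<lambda>k. c (r k) i) \<longlonglongrightarrow> l i"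
    by (meson less_SucI)
  have "bounded (range (\<lambda>k. c (r k) n))"
    by (rule bounded_subset[OF Suc.prems[of n]]) auto
  then obtain y s where s: "strict_mono (s :: nat \<Rightarrow> nat)" "((\<lambda>k. c (r k) n) \<circ> s) \<longlonglongrightarrow> y"
    using bounded_imp_convergent_subsequence by metis
  have "(\<lambda>k. c (r (s k)) i) \<longlonglongrightarrow> (l(n := y)) i" if "i < Suc n" for i
  proof (cases "i = n")
    case False
    then show ?thesis
      using LIMSEQ_subseq_LIMSEQ[OF r(2)[rule_format, of i] s(1)] that by (simp add: o_def)
  qed (use s in \<open>simp add: o_def\<close>)
  moreover have "strict_mono (r \<circ> s)" using r(1) s(1) by (rule strict_mono_o)
  ultimately show ?case by (intro exI[of _ "l(n := y)"] exI[of _ "r \<circ> s"]) (simp add: o_def)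
qed

text \<open>The difference quotients in direction \<open>j\<close> are bounded holomorphic functions with quadratic
  remainders that are uniform in the step, and this passes to the limit.\<close>

lemma cdiff_partial:
  assumes a: "a \<in> topspace (Cspace n)" and ev: "\<forall>\<^sub>F z in nhdsin (Cspace n) a. cdiff n h z" and j: "j < n"
  shows "cdiff n (partial j h) a"
proof -
  obtain r M where r: "r > 0" "M > 0" and h: "\<And>z. z \<in> polydisc n a r \<Longrightarrow> cdiff n h z \<and> cmod (h z) \<le> M"
    using eventually_cdiff_bounded[OF a ev] by metis
  \<comment> \<open>Steps r / 4, r / 8, r / 12, ...: shifting by \<epsilon> k maps the polydisc of
    radius r / 2 into that of radius \<open>r\<close>.\<close>
  define \<epsilon> where "\<epsilon> k = r / 4 * inverse (real (Suc k))" for k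
  have \<epsilon>: "0 < \<epsilon> k" "\<epsilon> k \<le> r / 4" for k
    using r by (auto simp: \<epsilon>_def field_simps)
  have \<epsilon>0: "\<epsilon> \<longlonglongrightarrow> 0"
    unfolding \<epsilon>_def using tendsto_mult_left[OF LIMSEQ_inverse_real_of_nat, of "r / 4"] by simp
  define q where "q k z = (h (z(j := z j + of_real (\<epsilon> k))) - h z) / of_real (\<epsilon> k)" for k z
  define M' where "M' = 6 * M / r"
  have mem: "z(j := z j + w) \<in> polydisc n a r" if "z \<in> polydisc n a (r / 2)" "cmod w \<le> r / 4" for z w
  proof -
    have "cmod (z j + w - a j) \<le> cmod (z j - a j) + cmod w"
      using norm_triangle_ineq[of "z j - a j" w] by (simp add: algebra_simps)
    then have "cmod (z j + w - a j) < r" using that j r by (force simp: polydisc_def)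
    then show ?thesis using that j r by (auto simp: polydisc_def fun_upd_topspace intro: less_trans)
  qed
  have sub: "z \<in> polydisc n a r" if "z \<in> polydisc n a (r / 2)" for z
    using that r by (force simp: polydisc_def)
  have q: "cdiff n (q k) z \<and> cmod (q k z) \<le> M'" if z: "z \<in> polydisc n a (r / 2)" for k z
  proof
    have zt: "z \<in> topspace (Cspace n)" using z by (simp add: polydisc_def)
    have "cmod (of_real (\<epsilon> k)) \<le> r / 4" using \<epsilon>[of k] by simp
    note m = mem[OF z this]
    have "cdiff n (\<lambda>y. h (cvec_of n (\<lambda>i. y i + (if i = j then of_real (\<epsilon> k) else 0)))) z"
      using zt conjunct1[OF h[OF m]]
      by (rule cdiff_compose) (auto intro!: cdiff_add cdiff_coordinate cdiff_const zt)
    moreover have "\<forall>\<^sub>F y in nhdsin (Cspace n) z.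
        h (cvec_of n (\<lambda>i. y i + (if i = j then of_real (\<epsilon> k) else 0))) = h (y(j := y j + of_real (\<epsilon> k)))"
      using eventually_nhdsin_topspace
    proof eventually_elim
      case (elim y)
      then show ?case by (intro arg_cong[where f = h] cvec_of_eq fun_upd_topspace j) auto
    qed
    ultimately have "cdiff n (\<lambda>y. h (y(j := y j + of_real (\<epsilon> k)))) z"
      by (rule cdiff_cong[THEN iffD1, rotated])
    then have "cdiff n (\<lambda>y. (h (y(j := y j + of_real (\<epsilon> k))) + (-1) * h y) * inverse (of_real (\<epsilon> k))) z"
      using h[OF sub[OF z]] by (intro cdiff_mult cdiff_add cdiff_const zt) auto
    then show "cdiff n (q k) z" by (simp add: q_def[abs_def] divide_inverse)
    have "cmod (h (z(j := z j + of_real (\<epsilon> k))) - h z) \<le> 6 * M / r * \<epsilon> k"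
      by (rule polydisc_lipschitz[OF h z]) (use m \<epsilon>[of k] in \<open>auto simp: polydisc_def\<close>)
    then show "cmod (q k z) \<le> M'"
      using \<epsilon>(1)[of k] by (simp add: q_def M'_def norm_divide field_simps)
  qed
  have qlim: "(\<lambda>k. q k z) \<longlonglongrightarrow> partial j h z" if z: "z \<in> polydisc n a (r / 2)" for z
  proof -
    have "((\<lambda>w. h (z(j := w))) has_field_derivative partial j h (z(j := z j))) (at (z j))"
      by (rule partial_has_field_derivative) (use h[OF sub[OF z]] z j in \<open>auto simp: polydisc_def\<close>)
    then have "((\<lambda>w. (h (z(j := z j + w)) - h z) / w) \<longlongrightarrow> partial j h z) (at 0)"
      by (simp add: DERIV_def)
    moreover have "filterlim (\<lambda>k. complex_of_real (\<epsilon> k)) (at 0) sequentially"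
      unfolding filterlim_at using \<epsilon>(1) tendsto_of_real[OF \<epsilon>0]
      by (auto simp: less_imp_neq[THEN not_sym] intro!: always_eventually)
    ultimately show ?thesis
      unfolding q_def by (rule filterlim_compose)
  qed
  have ain: "a \<in> polydisc n a (r / 2)" "a \<in> polydisc n a (r / 2 / 2)" using a r by (auto simp: polydisc_def)
  \<comment> \<open>The constant of \<open>polydisc_quadratic\<close> for the difference quotients,
    which are bounded by M' on the polydisc of radius r / 2; it is the same for every step.\<close>
  define K where "K = 72 * M' / (r / 2)\<^sup>2"
  define Q where "Q k c \<longleftrightarrow> (\<forall>z \<sigma>. z \<in> topspace (Cspace n) \<longrightarrow> (\<forall>i<n. cmod (z i - a i) \<le> \<sigma>) \<longrightarrow>
      0 < \<sigma> \<longrightarrow> \<sigma> \<le> r / 8 \<longrightarrow> cmod (q k z - q k a - (\<Sum>i<n. c i * (z i - a i))) \<le> K * \<sigma>\<^sup>2)" for k c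
  have "\<exists>c. Q k c" for k
  proof -
    obtain c where c: "has_gradient n (q k) a c"
      using cdiff_has_gradient[OF conjunct1[OF q[OF ain(1)]]] by auto
    have "Q k c"
      unfolding Q_def K_def
      by (intro allI impI polydisc_quadratic[OF q ain(2) _ _ _ _ c]) (auto simp: field_simps)
    then show ?thesis by (intro exI[of _ c])
  qed
  then obtain c where "\<And>k. Q k (c k)" by metis
  then have c: "cmod (q k z - q k a - (\<Sum>i<n. c k i * (z i - a i))) \<le> K * \<sigma>\<^sup>2"
    if "z \<in> topspace (Cspace n)" "\<forall>i<n. cmod (z i - a i) \<le> \<sigma>" "0 < \<sigma>" "\<sigma> \<le> r / 8" for k z \<sigma>
    using that unfolding Q_def by auto
  have "bounded (range (\<lambda>k. c k i))" if i: "i < n" for i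
  proof -
    define \<sigma> where "\<sigma> = r / 8"
    have \<sigma>: "\<sigma> > 0" using r by (simp add: \<sigma>_def)
    let ?z = "a(i := a i + of_real \<sigma>)"
    have z: "?z \<in> topspace (Cspace n)" "?z \<in> polydisc n a (r / 2)"
      using a i r by (auto simp: polydisc_def fun_upd_topspace \<sigma>_def)
    \<comment> \<open>Evaluating the quadratic estimate at a + \<sigma> e_i isolates the i-th entry
      of the gradient.\<close>
    have "cmod (c k i) \<le> (2 * M' + K * \<sigma>\<^sup>2) / \<sigma>" for k
    proof -
      have "(\<Sum>l<n. c k l * (?z l - a l)) = (\<Sum>l<n. if l = i then c k i * of_real \<sigma> else 0)"
        by (intro sum.cong refl) auto
      also have "\<dots> = c k i * of_real \<sigma>" using i by simp
      finally have sum: "(\<Sum>l<n. c k l * (?z l - a l)) = c k i * of_real \<sigma>" .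
      have "cmod (q k ?z - q k a - (\<Sum>l<n. c k l * (?z l - a l))) \<le> K * \<sigma>\<^sup>2"
        by (rule c[OF z(1)]) (use \<sigma> in \<open>auto simp: \<sigma>_def\<close>)
      then have "cmod (q k ?z - q k a - c k i * of_real \<sigma>) \<le> K * \<sigma>\<^sup>2"
        unfolding sum .
      moreover have "cmod (c k i * of_real \<sigma>) \<le> cmod (q k ?z - q k a - c k i * of_real \<sigma>) + (cmod (q k ?z) + cmod (q k a))"
        using norm_triangle_ineq4[of "q k ?z - q k a" "q k ?z - q k a - c k i * of_real \<sigma>"]
          norm_triangle_ineq4[of "q k ?z" "q k a"] by simp
      ultimately have "cmod (c k i) * \<sigma> \<le> 2 * M' + K * \<sigma>\<^sup>2"
        using q[OF z(2), of k] q[OF ain(1), of k] \<sigma> by (simp add: norm_mult)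
      then show ?thesis using \<sigma> by (simp add: field_simps)
    qed
    then show ?thesis unfolding bounded_iff by blast
  qed
  then obtain l s where s: "strict_mono (s :: nat \<Rightarrow> nat)" and l: "\<forall>i<n. (\<lambda>k. c (s k) i) \<longlonglongrightarrow> l i"
    using bounded_imp_convergent_subsequence_coordinates[of n c] by metis
  \<comment> \<open>The estimate is a closed condition, so it passes to the limit of the quotients
    and to the limit \<open>l\<close> of a subsequence of their gradients; hence \<open>l\<close> is
    the Frechet derivative.\<close>
  have quad: "cmod (partial j h z - partial j h a - (\<Sum>i<n. l i * (z i - a i))) \<le> K * \<sigma>\<^sup>2"
    if z: "z \<in> topspace (Cspace n)" "\<forall>i<n. cmod (z i - a i) \<le> \<sigma>" "0 < \<sigma>" "\<sigma> \<le> r / 8" for z \<sigma>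
  proof (rule tendsto_upperbound)
    have "cmod (z i - a i) < r / 2" if "i < n" for i
      using z(2)[rule_format, OF that] z(4) r(1) by simp
    then have "z \<in> polydisc n a (r / 2)" using z(1) by (simp add: polydisc_def)
    then show "(\<lambda>k. cmod (q (s k) z - q (s k) a - (\<Sum>i<n. c (s k) i * (z i - a i)))) \<longlonglongrightarrow>
        cmod (partial j h z - partial j h a - (\<Sum>i<n. l i * (z i - a i)))"
      using l LIMSEQ_subseq_LIMSEQ[OF qlim s] ain(1)
      by (intro tendsto_intros) (auto simp: o_def)
  qed (use c[OF z] in auto)
  let ?L = "\<lambda>z. L2_set (\<lambda>i. cmod (z i - a i)) {..<n}"
  have L0: "(?L \<longlongrightarrow> 0) (nhdsin (Cspace n) a)"
  proof (rule Lim_null_comparison)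
    have "((\<lambda>z. \<Sum>i<n. cmod (z i - a i)) \<longlongrightarrow> (\<Sum>i<n. cmod (a i - a i))) (nhdsin (Cspace n) a)"
      by (intro tendsto_intros tendsto_coordinate a)
    then show "((\<lambda>z. \<Sum>i<n. cmod (z i - a i)) \<longlongrightarrow> 0) (nhdsin (Cspace n) a)" by simp
    show "\<forall>\<^sub>F z in nhdsin (Cspace n) a. norm (?L z) \<le> (\<Sum>i<n. cmod (z i - a i))"
      by (intro always_eventually allI) (simp add: L2_set_nonneg L2_set_le_sum)
  qed
  show ?thesis
  proof (rule frechet_imp_cdiff[OF a, where c = l], rule tendsto_atin_nhdsin, rule Lim_null_comparison)
    show "((\<lambda>z. K * ?L z) \<longlongrightarrow> 0) (nhdsin (Cspace n) a)"
      using tendsto_mult_left[OF L0, of K] by simp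
    have "\<forall>\<^sub>F z in nhdsin (Cspace n) a. ?L z < r / 8"
      using order_tendstoD(2)[OF L0, of "r / 8"] r by simp
    with eventually_nhdsin_topspace show "\<forall>\<^sub>F z in nhdsin (Cspace n) a.
      cmod ((partial j h z - partial j h a - (\<Sum>i<n. l i * (z i - a i))) / of_real (?L z)) \<le> K * ?L z"
    proof eventually_elim
      case (elim z)
      have "?L z \<ge> 0" by (rule L2_set_nonneg)
      show ?case
      proof (cases "?L z = 0")
        case False
        then have "0 < ?L z" using \<open>?L z \<ge> 0\<close> by (simp only: less_le eq_commute[of 0] simp_thms)
        have "\<forall>i<n. cmod (z i - a i) \<le> ?L z"
          by (intro allI impI member_le_L2_set) auto
        then have "cmod (partial j h z - partial j h a - (\<Sum>i<n. l i * (z i - a i))) \<le> K * (?L z)\<^sup>2"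
          using elim \<open>0 < ?L z\<close> by (intro quad) simp_all
        then show ?thesis
          using \<open>0 < ?L z\<close> by (simp add: norm_divide pos_divide_le_eq power2_eq_square mult.assoc)
      qed simp
    qed
  qed
qed

lemma eventually_cdiff_partial:
  assumes "\<forall>\<^sub>F z in nhdsin (Cspace n) a. cdiff n h z" and j: "j < n"
  shows "\<forall>\<^sub>F z in nhdsin (Cspace n) a. cdiff n (partial j h) z"
  using eventually_eventually_nhdsin[OF assms(1)] eventually_nhdsin_topspace
  by eventually_elim (use j cdiff_partial in auto)

section \<open>Taylor expansions along curves\<close>

lemma has_fps_expansion_tendsto:
  fixes f :: "complex \<Rightarrow> complex"
  assumes "f has_fps_expansion F"
  shows "(f \<longlongrightarrow> fps_nth F 0) (nhds 0)"
proof -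
  have "isCont f 0"
    using has_fps_expansion_imp_continuous[OF assms, of UNIV] by simp
  then have "(f \<longlongrightarrow> f 0) (nhds 0)"
    by (simp add: isCont_def flip: tendsto_at_iff_tendsto_nhds)
  then show ?thesis
    using has_fps_expansion_imp_0_eq_fps_nth_0[OF assms] by simp
qed

lemma has_fps_expansion_eventually_differentiable:
  fixes f :: "complex \<Rightarrow> complex"
  assumes "f has_fps_expansion F"
  shows "\<forall>\<^sub>F t in nhds 0. f field_differentiable at t"
proof -
  obtain s where "open s" "0 \<in> s" "f holomorphic_on s"
    using has_fps_expansion_imp_holomorphic[OF assms] by metis
  then show ?thesis
    unfolding eventually_nhds using holomorphic_on_imp_differentiable_at by metis
qed

lemma eventually_differentiable_imp_has_fps_expansion:
  fixes f :: "complex \<Rightarrow> complex"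
  assumes "\<forall>\<^sub>F t in nhds 0. f field_differentiable at t"
  shows "f has_fps_expansion fps_expansion f 0"
proof -
  obtain s where s: "open s" "0 \<in> s" "\<forall>t\<in>s. f field_differentiable at t"
    using assms unfolding eventually_nhds by auto
  then have "f holomorphic_on s"
    by (auto simp: holomorphic_on_def field_differentiable_at_within)
  then have "f analytic_on {0}"
    using s by (auto simp: analytic_at)
  then show ?thesis
    by (rule analytic_at_imp_has_fps_expansion_0)
qed

lemma has_fps_expansion_factor_power:
  fixes f :: "complex \<Rightarrow> complex"
  assumes f: "f has_fps_expansion F" and z: "\<forall>i<k. fps_nth F i = 0"
  shows "eval_fps (fps_shift k F) has_fps_expansion fps_shift k F"
    and "\<forall>\<^sub>F t in nhds 0. f t = t ^ k * eval_fps (fps_shift k F) t"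
proof -
  have rad: "fps_conv_radius (fps_shift k F) > 0"
    using f by (simp add: has_fps_expansion_def)
  then show S: "eval_fps (fps_shift k F) has_fps_expansion fps_shift k F"
    by (rule eval_fps_has_fps_expansion)
  have F: "fps_X ^ k * fps_shift k F = F"
    by (rule fps_ext) (auto simp: fps_X_power_mult_nth z)
  have "(\<lambda>t. t ^ k * eval_fps (fps_shift k F) t) has_fps_expansion fps_X ^ k * fps_shift k F"
    by (intro has_fps_expansion_mult has_fps_expansion_fps_X_power S)
  then have "\<forall>\<^sub>F t in nhds 0. eval_fps F t = t ^ k * eval_fps (fps_shift k F) t"
    unfolding F by (simp add: has_fps_expansion_def)
  moreover have "\<forall>\<^sub>F t in nhds 0. eval_fps F t = f t"
    using f by (simp add: has_fps_expansion_def)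
  ultimately show "\<forall>\<^sub>F t in nhds 0. f t = t ^ k * eval_fps (fps_shift k F) t"
    by eventually_elim simp
qed

text \<open>By induction the lower coefficients vanish, so f / t^k extends continuously to 0 with
  the k-th coefficient as its value there, while the bound makes it tend to 0.\<close>

lemma bigo_imp_fps_nth_eq_0:
  fixes f :: "complex \<Rightarrow> complex"
  assumes f: "f has_fps_expansion F" and le: "\<forall>\<^sub>F t in nhds 0. cmod (f t) \<le> C * cmod t ^ Suc K"
  shows "k \<le> K \<Longrightarrow> fps_nth F k = 0"
proof (induction k rule: less_induct)
  case (less k)
  let ?S = "fps_shift k F"
  have z: "\<forall>i<k. fps_nth F i = 0"
    using less by simp
  have lim: "(eval_fps ?S \<longlongrightarrow> fps_nth F k) (at 0)"
    using tendsto_mono[OF at_within_le_nhds has_fps_expansion_tendsto[OF has_fps_expansion_factor_power(1)[OF f z]]]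
    by simp
  have "(eval_fps ?S \<longlongrightarrow> 0) (at 0)"
  proof (rule Lim_null_comparison)
    have "((\<lambda>t. C * cmod t ^ (Suc K - k)) \<longlongrightarrow> C * cmod 0 ^ (Suc K - k)) (at 0)"
      by (intro tendsto_intros)
    then show "((\<lambda>t. C * cmod t ^ (Suc K - k)) \<longlongrightarrow> 0) (at 0)"
      using less.prems by (simp add: power_0_left)
    have "\<forall>\<^sub>F t in at 0. cmod (f t) \<le> C * cmod t ^ Suc K"
        "\<forall>\<^sub>F t in at 0. f t = t ^ k * eval_fps ?S t" "\<forall>\<^sub>F t in at 0. t \<noteq> (0::complex)"
      using le has_fps_expansion_factor_power(2)[OF f z]
      by (auto simp: eventually_at_filter elim: eventually_mono)
    then show "\<forall>\<^sub>F t in at 0. cmod (eval_fps ?S t) \<le> C * cmod t ^ (Suc K - k)"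
    proof eventually_elim
      case (elim t)
      have "cmod t ^ k * cmod (eval_fps ?S t) \<le> cmod t ^ k * (C * cmod t ^ (Suc K - k))"
        using elim less.prems
        by (simp add: norm_mult norm_power mult.left_commute flip: power_add)
      then show ?case using elim by simp
    qed
  qed
  then show ?case
    using tendsto_unique[OF _ lim] by auto
qed

lemma fps_nth_eq_0_imp_bigo:
  fixes f :: "complex \<Rightarrow> complex"
  assumes f: "f has_fps_expansion F" and z: "\<And>k. k \<le> K \<Longrightarrow> fps_nth F k = 0"
  shows "\<exists>C>0. \<forall>\<^sub>F t in nhds 0. cmod (f t) \<le> C * cmod t ^ Suc K"
proof -
  let ?S = "fps_shift (Suc K) F"
  have z': "\<forall>k<Suc K. fps_nth F k = 0" using z by simp
  have "\<forall>\<^sub>F t in nhds 0. dist (eval_fps ?S t) (fps_nth ?S 0) < 1"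
    using has_fps_expansion_tendsto[OF has_fps_expansion_factor_power(1)[OF f z']]
    by (simp add: tendsto_iff)
  then have "\<forall>\<^sub>F t in nhds 0. cmod (f t) \<le> (cmod (fps_nth ?S 0) + 1) * cmod t ^ Suc K"
    using has_fps_expansion_factor_power(2)[OF f z']
  proof eventually_elim
    case (elim t)
    then have "cmod (eval_fps ?S t) \<le> cmod (fps_nth ?S 0) + 1"
      using norm_triangle_ineq2[of "eval_fps ?S t" "fps_nth ?S 0"] by (simp add: dist_norm)
    then show ?case
      unfolding elim(2) norm_mult norm_power by (subst mult.commute) (intro mult_right_mono, auto)
  qed
  then show ?thesis by (intro exI[of _ "cmod (fps_nth ?S 0) + 1"]) (auto simp: add_nonneg_pos)
qed

text \<open>Curves are germs at parameter 0 and are carried together with their power series,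
  because jets are conditions on coefficients.\<close>

definition curve_at :: "nat \<Rightarrow> cvec \<Rightarrow> (nat \<Rightarrow> complex \<Rightarrow> complex) \<Rightarrow> (nat \<Rightarrow> complex fps) \<Rightarrow> bool" where
  "curve_at n a \<gamma> \<Gamma> \<longleftrightarrow> a \<in> topspace (Cspace n) \<and> (\<forall>i<n. \<gamma> i has_fps_expansion \<Gamma> i \<and> fps_nth (\<Gamma> i) 0 = a i)"

abbreviation curve :: "nat \<Rightarrow> (nat \<Rightarrow> complex \<Rightarrow> complex) \<Rightarrow> complex \<Rightarrow> cvec" where
  "curve n \<gamma> t \<equiv> cvec_of n (\<lambda>i. \<gamma> i t)"

lemma curve_at_0: "curve_at n a \<gamma> \<Gamma> \<Longrightarrow> i < n \<Longrightarrow> \<gamma> i 0 = a i"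
  unfolding curve_at_def using has_fps_expansion_imp_0_eq_fps_nth_0 by metis

lemma filterlim_curve:
  assumes "curve_at n a \<gamma> \<Gamma>"
  shows "filterlim (curve n \<gamma>) (nhdsin (Cspace n) a) (nhds 0)"
proof (rule filterlim_cvec_of)
  show "(\<gamma> i \<longlongrightarrow> a i) (nhds 0)" if "i < n" for i
    using has_fps_expansion_tendsto[of "\<gamma> i" "\<Gamma> i"] assms that by (simp add: curve_at_def)
qed (use assms in \<open>simp add: curve_at_def\<close>)

lemma eventually_curve:
  "curve_at n a \<gamma> \<Gamma> \<Longrightarrow> eventually P (nhdsin (Cspace n) a) \<Longrightarrow> \<forall>\<^sub>F t in nhds 0. P (curve n \<gamma> t)"
  using filterlim_curve[unfolded filterlim_iff] by simp

lemma has_fps_expansion_curve: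
  assumes ev: "\<forall>\<^sub>F z in nhdsin (Cspace n) a. cdiff n h z" and c: "curve_at n a \<gamma> \<Gamma>"
  shows "(\<lambda>t. h (curve n \<gamma> t)) has_fps_expansion fps_expansion (\<lambda>t. h (curve n \<gamma> t)) 0"
proof (rule eventually_differentiable_imp_has_fps_expansion)
  have "\<forall>\<^sub>F t in nhds 0. \<forall>i\<in>{..<n}. \<gamma> i field_differentiable at t"
    using c has_fps_expansion_eventually_differentiable
    by (intro eventually_ball_finite) (auto simp: curve_at_def)
  with eventually_curve[OF c ev]
  show "\<forall>\<^sub>F t in nhds 0. (\<lambda>t. h (curve n \<gamma> t)) field_differentiable at t"
  proof eventually_elim
    case (elim t)
    show ?case by (rule cdiff_curve[OF elim(1)]) (use elim(2) in \<open>auto simp: cvec_of_nth\<close>)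
  qed
qed

text \<open>\<open>h\<close> is Lipschitz near \<open>a\<close>, and the two curves differ by O(t^(N
  + 1)). This is what allows a curve to be replaced by its polynomial truncation.\<close>

lemma jet_dependence:
  assumes ev: "\<forall>\<^sub>F z in nhdsin (Cspace n) a. cdiff n h z"
    and c: "curve_at n a \<gamma> \<Gamma>" "curve_at n a \<gamma>' \<Gamma>'"
    and eq: "\<And>i k. i < n \<Longrightarrow> k \<le> N \<Longrightarrow> fps_nth (\<Gamma> i) k = fps_nth (\<Gamma>' i) k"
    and H: "(\<lambda>t. h (curve n \<gamma> t)) has_fps_expansion H" "(\<lambda>t. h (curve n \<gamma>' t)) has_fps_expansion H'"
    and k: "k \<le> N"
  shows "fps_nth H k = fps_nth H' k"
proof -
  have a: "a \<in> topspace (Cspace n)" using c by (simp add: curve_at_def)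
  obtain r M where r: "r > 0" "M > 0" and h: "\<And>z. z \<in> polydisc n a r \<Longrightarrow> cdiff n h z \<and> cmod (h z) \<le> M"
    using eventually_cdiff_bounded[OF a ev] by metis
  have "\<exists>C>0. \<forall>\<^sub>F t in nhds 0. cmod (\<gamma> i t - \<gamma>' i t) \<le> C * cmod t ^ Suc N" if "i < n" for i
    using c eq that
    by (intro fps_nth_eq_0_imp_bigo[where F = "\<Gamma> i - \<Gamma>' i"] has_fps_expansion_diff) (auto simp: curve_at_def)
  then obtain C where C: "\<And>i. i < n \<Longrightarrow> C i > 0"
      "\<And>i. i < n \<Longrightarrow> \<forall>\<^sub>F t in nhds 0. cmod (\<gamma> i t - \<gamma>' i t) \<le> C i * cmod t ^ Suc N"
    by metis
  \<comment> \<open>The summand 1 keeps D positive for n = 0 as well.\<close>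
  define D where "D = 1 + (\<Sum>i<n. C i)"
  have "0 \<le> (\<Sum>i<n. C i)"
    by (rule sum_nonneg) (use C(1) in \<open>auto intro: less_imp_le\<close>)
  moreover have "C i \<le> (\<Sum>i<n. C i)" if "i < n" for i
    by (rule member_le_sum) (use that C(1) in \<open>auto intro: less_imp_le\<close>)
  ultimately have D: "D > 0" "\<And>i. i < n \<Longrightarrow> C i \<le> D"
    unfolding D_def by force+
  have e1: "\<forall>\<^sub>F t in nhds 0. \<forall>i\<in>{..<n}. cmod (\<gamma> i t - \<gamma>' i t) \<le> C i * cmod t ^ Suc N"
    using C(2) by (intro eventually_ball_finite) auto
  have "\<forall>\<^sub>F z in nhdsin (Cspace n) a. z \<in> polydisc n a (r / 2)"
    unfolding eventually_nhdsin_Cspace[OF a] using r by (intro exI[of _ "r / 2"]) auto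
  note e2 = eventually_curve[OF c(2) this]
  have "((\<lambda>t::complex. D * cmod t ^ Suc N) \<longlongrightarrow> D * cmod 0 ^ Suc N) (nhds 0)"
    by (intro tendsto_intros filterlim_ident)
  then have e3: "\<forall>\<^sub>F t in nhds (0::complex). D * cmod t ^ Suc N < r / 4"
    using r by (intro order_tendstoD(2)) auto
  have "\<forall>\<^sub>F t in nhds 0. cmod (h (curve n \<gamma> t) - h (curve n \<gamma>' t)) \<le> (6 * M / r * D) * cmod t ^ Suc N"
    using e1 e2 e3
  proof eventually_elim
    case (elim t)
    show ?case
    \<comment> \<open>At t = 0 the distance bound D |t|^(N + 1) is 0, which
      \<open>polydisc_lipschitz\<close> does not admit.\<close>
    proof (cases "t = 0")
      case True
      have "curve n \<gamma> 0 = curve n \<gamma>' 0"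
        using curve_at_0[OF c(1)] curve_at_0[OF c(2)] by (auto simp: cvec_of_def)
      then show ?thesis using True by simp
    next
      case False
      have "cmod (h (curve n \<gamma> t) - h (curve n \<gamma>' t)) \<le> 6 * M / r * (D * cmod t ^ Suc N)"
      proof (rule polydisc_lipschitz[OF h elim(2)])
        fix i assume i: "i < n"
        have "cmod (\<gamma> i t - \<gamma>' i t) \<le> C i * cmod t ^ Suc N" using elim(1) i by auto
        also have "\<dots> \<le> D * cmod t ^ Suc N" using D(2)[OF i] by (intro mult_right_mono) auto
        finally show "cmod (curve n \<gamma> t i - curve n \<gamma>' t i) \<le> D * cmod t ^ Suc N"
          using i by (simp add: cvec_of_nth)
      qed (use False elim D in auto)
      then show ?thesis by (simp add: mult.assoc)
    qed
  qed
  then have "fps_nth (H - H') k = 0"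
    by (rule bigo_imp_fps_nth_eq_0[OF has_fps_expansion_diff[OF H] _ k])
  then show ?thesis by simp
qed

lemma eventually_cdiff_partial_funpow:
  assumes "\<forall>\<^sub>F z in nhdsin (Cspace n) a. cdiff n h z" "j < n"
  shows "\<forall>\<^sub>F z in nhdsin (Cspace n) a. cdiff n ((partial j ^^ i) h) z"
  by (induction i) (use assms eventually_cdiff_partial in auto)

text \<open>One bound on the partial derivative of order K + 1 near \<open>a\<close> serves all base
  points \<open>b\<close>. The uniformity matters because the base point will move along a curve
  together with the increment.\<close>

lemma taylor_remainder_partial:
  assumes a: "a \<in> topspace (Cspace n)" and ev: "\<forall>\<^sub>F z in nhdsin (Cspace n) a. cdiff n h z" and j: "j < n"
  shows "\<exists>r>0. \<exists>B. \<forall>b w. b \<in> polydisc n a r \<longrightarrow> cmod w < r \<longrightarrow>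
    cmod (h (b(j := b j + w)) - (\<Sum>i\<le>K. (partial j ^^ i) h b * w ^ i / fact i)) \<le> B * cmod w ^ Suc K"
proof -
  let ?h = "\<lambda>i. (partial j ^^ i) h"
  have e1: "\<forall>\<^sub>F z in nhdsin (Cspace n) a. \<forall>i\<in>{..Suc K}. cdiff n (?h i) z"
    using eventually_cdiff_partial_funpow[OF ev j] by (intro eventually_ball_finite) auto
  obtain r0 B where r0: "r0 > 0" "B > 0" "\<And>z. z \<in> polydisc n a r0 \<Longrightarrow> cdiff n (?h (Suc K)) z \<and> cmod (?h (Suc K) z) \<le> B"
    using eventually_cdiff_bounded[OF a eventually_cdiff_partial_funpow[OF ev j]] by metis
  have "\<forall>\<^sub>F z in nhdsin (Cspace n) a. z \<in> polydisc n a r0"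
    unfolding eventually_nhdsin_Cspace[OF a] using r0 by (intro exI[of _ r0]) auto
  with e1 have "\<forall>\<^sub>F z in nhdsin (Cspace n) a. (\<forall>i\<in>{..Suc K}. cdiff n (?h i) z) \<and> cmod (?h (Suc K) z) \<le> B"
    by eventually_elim (use r0(3) in auto)
  then obtain r where r: "r > 0" "\<forall>z\<in>polydisc n a r. (\<forall>i\<in>{..Suc K}. cdiff n (?h i) z) \<and> cmod (?h (Suc K) z) \<le> B"
    unfolding eventually_nhdsin_Cspace[OF a] by auto
  have main: "cmod (h (b(j := b j + w)) - (\<Sum>i\<le>K. ?h i b * w ^ i / fact i)) \<le> (B / fact K) * cmod w ^ Suc K"
    if b: "b \<in> polydisc n a (r / 2)" and w: "cmod w < r / 2" for b w
  proof -
    let ?S = "ball (b j) (r / 2)"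
    have mem: "b(j := x) \<in> polydisc n a r" if "x \<in> ?S" for x
    proof -
      have "cmod (x - a j) \<le> cmod (x - b j) + cmod (b j - a j)"
        using norm_triangle_ineq[of "x - b j" "b j - a j"] by simp
      then have "cmod (x - a j) < r"
        using that b j by (force simp: polydisc_def dist_norm norm_minus_commute)
      then show ?thesis using b j r by (force simp: polydisc_def fun_upd_topspace)
    qed
    have bt: "b \<in> topspace (Cspace n)" using b by (simp add: polydisc_def)
    have "cmod (?h 0 (b(j := b j + w)) - (\<Sum>i\<le>K. ?h i (b(j := b j)) * ((b j + w) - b j) ^ i / fact i))
        \<le> B * cmod ((b j + w) - b j) ^ Suc K / fact K"
    proof (rule complex_Taylor[where S = ?S and f = "\<lambda>i x. ?h i (b(j := x))"])
      fix i x assume "x \<in> ?S" "i \<le> K"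
      then have "cdiff n (?h i) (b(j := x))" using r mem by auto
      then have "((\<lambda>w. ?h i (b(j := w))) has_field_derivative partial j (?h i) (b(j := x))) (at x)"
        by (rule partial_has_field_derivative[OF _ j bt])
      then show "((\<lambda>w. ?h i (b(j := w))) has_field_derivative ?h (Suc i) (b(j := x))) (at x within ?S)"
        by (simp add: has_field_derivative_at_within)
    next
      fix x assume "x \<in> ?S"
      then show "cmod (?h (Suc K) (b(j := x))) \<le> B" using r(2) mem by simp
    qed (use r w in \<open>auto simp: dist_norm\<close>)
    then show ?thesis by simp
  qed
  show ?thesis
    by (rule exI[of _ "r / 2"], intro conjI exI[of _ "B / fact K"]) (use r main in auto)
qed

text \<open>As w(t) = O(t), the uniform remainder is O(t^(K + 1)) and does not reach the
  coefficients up to order K. It is used with w = c t, to vary a curve, and with the tail of the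
  solution of an implicit equation.\<close>

lemma taylor_along_curve:
  assumes ev: "\<forall>\<^sub>F z in nhdsin (Cspace n) a. cdiff n h z" and j: "j < n" and c: "curve_at n a \<gamma> \<Gamma>"
    and \<Phi>: "\<And>i. (\<lambda>t. (partial j ^^ i) h (curve n \<gamma> t)) has_fps_expansion \<Phi> i"
    and w: "w has_fps_expansion W" "fps_nth W 0 = 0"
    and H: "(\<lambda>t. h (curve n (\<lambda>i t. if i = j then \<gamma> i t + w t else \<gamma> i t) t)) has_fps_expansion H"
    and k: "k \<le> K"
  shows "fps_nth H k = fps_nth (\<Sum>i\<le>K. fps_const (inverse (fact i)) * \<Phi> i * W ^ i) k"
proof -
  have a: "a \<in> topspace (Cspace n)" using c by (simp add: curve_at_def)
  obtain r B where r: "r > 0" and B: "\<And>b w. b \<in> polydisc n a r \<Longrightarrow> cmod w < r \<Longrightarrow>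
      cmod (h (b(j := b j + w)) - (\<Sum>i\<le>K. (partial j ^^ i) h b * w ^ i / fact i)) \<le> B * cmod w ^ Suc K"
    using taylor_remainder_partial[OF a ev j, of K] by auto
  obtain C where C: "C > 0" "\<forall>\<^sub>F t in nhds 0. cmod (w t) \<le> C * cmod t ^ Suc 0"
    using fps_nth_eq_0_imp_bigo[OF w(1), of 0] w(2) by auto
  have "\<forall>\<^sub>F z in nhdsin (Cspace n) a. z \<in> polydisc n a r"
    unfolding eventually_nhdsin_Cspace[OF a] using r by (intro exI[of _ r]) auto
  note e1 = eventually_curve[OF c this]
  have e2: "\<forall>\<^sub>F t in nhds 0. cmod (w t) < r"
    using tendsto_norm[OF has_fps_expansion_tendsto[OF w(1)]] w(2) r order_tendstoD(2)[of "\<lambda>t. cmod (w t)" 0 _ r] by simp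
  let ?T = "\<lambda>t. \<Sum>i\<le>K. inverse (fact i) * (partial j ^^ i) h (curve n \<gamma> t) * w t ^ i"
  have T: "?T has_fps_expansion (\<Sum>i\<le>K. fps_const (inverse (fact i)) * \<Phi> i * W ^ i)"
    by (intro has_fps_expansion_sum has_fps_expansion_mult has_fps_expansion_power has_fps_expansion_const \<Phi> w)
  have "\<forall>\<^sub>F t in nhds 0. cmod (h (curve n (\<lambda>i t. if i = j then \<gamma> i t + w t else \<gamma> i t) t) - ?T t) \<le> (\<bar>B\<bar> * C ^ Suc K) * cmod t ^ Suc K"
    using e1 e2 C(2)
  proof eventually_elim
    case (elim t)
    let ?b = "curve n \<gamma> t"
    have "curve n (\<lambda>i t. if i = j then \<gamma> i t + w t else \<gamma> i t) t = ?b(j := ?b j + w t)"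
      using j by (intro cvec_of_eq fun_upd_topspace) (auto simp: cvec_of_nth)
    moreover have "?T t = (\<Sum>i\<le>K. (partial j ^^ i) h ?b * w t ^ i / fact i)"
      by (intro sum.cong refl) (simp add: field_simps)
    ultimately have "cmod (h (curve n (\<lambda>i t. if i = j then \<gamma> i t + w t else \<gamma> i t) t) - ?T t) \<le> B * cmod (w t) ^ Suc K"
      using B[OF elim(1,2)] by simp
    also have "\<dots> \<le> \<bar>B\<bar> * (C * cmod t) ^ Suc K"
      using elim(3) by (intro mult_mono power_mono) auto
    finally show ?case by (simp add: power_mult_distrib mult_ac)
  qed
  then have "fps_nth (H - (\<Sum>i\<le>K. fps_const (inverse (fact i)) * \<Phi> i * W ^ i)) k = 0"
    by (rule bigo_imp_fps_nth_eq_0[OF has_fps_expansion_diff[OF H T] _ k])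
  then show ?thesis by simp
qed

section \<open>Control of the denominators of jets\<close>

lemma has_fps_expansion_unique:
  fixes f :: "complex \<Rightarrow> complex"
  shows "f has_fps_expansion F \<Longrightarrow> f has_fps_expansion G \<Longrightarrow> F = G"
  by (metis fps_expansion_eqI)

lemma has_fps_expansion_eventually_eq:
  assumes "f has_fps_expansion F" and ev: "\<forall>\<^sub>F t in nhds 0. f t = g t"
  shows "g has_fps_expansion F"
proof -
  have e: "\<forall>\<^sub>F t in nhds 0. eval_fps F t = f t" and rad: "fps_conv_radius F > 0"
    using assms(1) by (auto simp: has_fps_expansion_def)
  from e ev have "\<forall>\<^sub>F t in nhds 0. eval_fps F t = g t"
    by eventually_elim simp
  then show ?thesis using rad by (simp add: has_fps_expansion_def)
qed

lemma has_fps_expansion_of_poly: "poly p has_fps_expansion fps_of_poly (p :: complex poly)"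
  by (simp add: has_fps_expansion_def)

lemma has_fps_expansion_cnj:
  assumes "f has_fps_expansion F"
  shows "(\<lambda>t. cnj (f (cnj t))) has_fps_expansion Abs_fps (\<lambda>k. cnj (fps_nth F k))"
proof (rule has_fps_expansionI)
  have "\<forall>\<^sub>F z in nhds 0. z \<in> eball 0 (fps_conv_radius F)"
    using assms by (intro eventually_nhds_in_open) (auto simp: has_fps_expansion_def zero_ereal_def)
  moreover have "\<forall>\<^sub>F z in nhds 0. eval_fps F z = f z"
    using assms by (simp add: has_fps_expansion_def)
  ultimately have "\<forall>\<^sub>F z in nhds 0. (\<lambda>n. fps_nth F n * z ^ n) sums f z"
    by eventually_elim (use summable_fps in \<open>auto simp: eval_fps_def sums_iff\<close>)
  moreover have "filterlim cnj (nhds 0) (nhds 0)"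
    using tendsto_cnj[OF filterlim_ident, of 0] by simp
  ultimately have "\<forall>\<^sub>F z in nhds 0. (\<lambda>n. fps_nth F n * cnj z ^ n) sums f (cnj z)"
    by (rule eventually_compose_filterlim)
  then show "\<forall>\<^sub>F u in nhds 0. (\<lambda>n. fps_nth (Abs_fps (\<lambda>k. cnj (fps_nth F k))) n * u ^ n) sums cnj (f (cnj u))"
  proof eventually_elim
    case (elim u)
    then have "(\<lambda>n. cnj (fps_nth F n * cnj u ^ n)) sums cnj (f (cnj u))"
      by (simp only: sums_cnj)
    then show ?case by simp
  qed
qed

section \<open>Truncated power series with coefficients in a ring\<close>

definition jets_in :: "'a set \<Rightarrow> nat \<Rightarrow> 'a::zero fps set" where
  "jets_in R N = {F. \<forall>k\<le>N. fps_nth F k \<in> R}"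

lemma jets_inD: "F \<in> jets_in R N \<Longrightarrow> k \<le> N \<Longrightarrow> fps_nth F k \<in> R"
  by (simp add: jets_in_def)

lemma jets_in_mono: "F \<in> jets_in R N \<Longrightarrow> M \<le> N \<Longrightarrow> F \<in> jets_in R M"
  by (simp add: jets_in_def)

lemma jets_in_const: "subring R \<Longrightarrow> c \<in> R \<Longrightarrow> fps_const c \<in> jets_in R N"
  and jets_in_X: "subring R \<Longrightarrow> fps_X \<in> jets_in R N"
  and jets_in_add: "subring R \<Longrightarrow> F \<in> jets_in R N \<Longrightarrow> G \<in> jets_in R N \<Longrightarrow> F + G \<in> jets_in R N"
  and jets_in_diff: "subring R \<Longrightarrow> F \<in> jets_in R N \<Longrightarrow> G \<in> jets_in R N \<Longrightarrow> F - G \<in> jets_in R N"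
  by (auto simp: jets_in_def subring_zero subring_one subring_add subring_diff)

lemma jets_in_mult:
  "subring R \<Longrightarrow> F \<in> jets_in R N \<Longrightarrow> G \<in> jets_in R N \<Longrightarrow> F * G \<in> jets_in R N"
  by (auto simp: jets_in_def fps_mult_nth intro!: subring_sum subring_mult)

lemma jets_in_power: "subring R \<Longrightarrow> F \<in> jets_in R N \<Longrightarrow> F ^ i \<in> jets_in R N"
  using jets_in_const[OF _ subring_one] by (induction i) (auto intro: jets_in_mult)

lemma jets_in_prod: "subring R \<Longrightarrow> (\<And>i. i \<in> I \<Longrightarrow> F i \<in> jets_in R N) \<Longrightarrow> (\<Prod>i\<in>I. F i) \<in> jets_in R N"
  using jets_in_const[OF _ subring_one] by (induction I rule: infinite_finite_induct) (auto intro: jets_in_mult)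

lemma jets_in_sum: "subring R \<Longrightarrow> (\<And>i. i \<in> I \<Longrightarrow> F i \<in> jets_in R N) \<Longrightarrow> (\<Sum>i\<in>I. F i) \<in> jets_in R N"
  using jets_in_const[OF _ subring_zero] by (induction I rule: infinite_finite_induct) (auto intro: jets_in_add)

lemma jets_in_compose:
  "subring R \<Longrightarrow> F \<in> jets_in R N \<Longrightarrow> G \<in> jets_in R N \<Longrightarrow> F oo G \<in> jets_in R N"
  using jets_in_power[of R G N]
  by (auto simp: jets_in_def fps_compose_nth intro!: subring_sum subring_mult)

text \<open>The coefficients of \<open>H\<close> are found recursively, and each step divides by the
  constant term of \<open>G\<close> only. Thus a single inverse suffices for all orders.\<close>

lemma jets_in_cancel_unit:
  fixes R :: "complex set"
  assumes R: "subring R" and GH: "G * H \<in> jets_in R N" and G: "G \<in> jets_in R N"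
    and u: "inverse (fps_nth G 0) \<in> R" "fps_nth G 0 \<noteq> 0"
  shows "H \<in> jets_in R N"
proof -
  have "fps_nth H k \<in> R" if "k \<le> N" for k
    using that
  proof (induction k rule: less_induct)
    case (less k)
    have "fps_nth (G * H) k = fps_nth G 0 * fps_nth H k + (\<Sum>i\<in>{1..k}. fps_nth G i * fps_nth H (k - i))"
      unfolding fps_mult_nth by (simp add: sum.atLeast_Suc_atMost)
    then have e: "fps_nth H k = (fps_nth (G * H) k - (\<Sum>i\<in>{1..k}. fps_nth G i * fps_nth H (k - i))) * inverse (fps_nth G 0)"
      using u by (simp add: field_simps)
    have "(\<Sum>i\<in>{1..k}. fps_nth G i * fps_nth H (k - i)) \<in> R"
      using G less by (intro subring_sum[OF R] subring_mult[OF R]) (auto intro: jets_inD)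
    then show ?case
      unfolding e using less.prems by (intro subring_mult[OF R] subring_diff[OF R] u jets_inD[OF GH])
  qed
  then show ?thesis by (simp add: jets_in_def)
qed

text \<open>The invariant separating the two sheaves. The point is that \<open>s\<close> does not depend on \<open>N\<close>.\<close>

definition jets_controlled :: "nat \<Rightarrow> (cvec \<Rightarrow> complex) \<Rightarrow> cvec \<Rightarrow> complex set \<Rightarrow> nat \<Rightarrow> bool" where
  "jets_controlled n h b P s \<longleftrightarrow>
     (\<forall>N R \<gamma> \<Gamma> H. subring R \<longrightarrow> P \<subseteq> R \<longrightarrow> inverse (fact (N + s)) \<in> R \<longrightarrow> curve_at n b \<gamma> \<Gamma> \<longrightarrow>
        (\<forall>i<n. \<Gamma> i \<in> jets_in R N) \<longrightarrow> (\<lambda>t. h (curve n \<gamma> t)) has_fps_expansion H \<longrightarrow> H \<in> jets_in R N)"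

lemma jets_controlledI:
  assumes "\<And>N R \<gamma> \<Gamma> H. subring R \<Longrightarrow> P \<subseteq> R \<Longrightarrow> inverse (fact (N + s)) \<in> R \<Longrightarrow> curve_at n b \<gamma> \<Gamma> \<Longrightarrow>
    (\<And>i. i < n \<Longrightarrow> \<Gamma> i \<in> jets_in R N) \<Longrightarrow> (\<lambda>t. h (curve n \<gamma> t)) has_fps_expansion H \<Longrightarrow> H \<in> jets_in R N"
  shows "jets_controlled n h b P s"
  unfolding jets_controlled_def using assms by auto

lemma jets_controlledD:
  assumes "jets_controlled n h b P s" "subring R" "P \<subseteq> R" "inverse (fact (N + s)) \<in> R" "curve_at n b \<gamma> \<Gamma>"
    "\<And>i. i < n \<Longrightarrow> \<Gamma> i \<in> jets_in R N" "(\<lambda>t. h (curve n \<gamma> t)) has_fps_expansion H"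
  shows "H \<in> jets_in R N"
  using assms unfolding jets_controlled_def by auto

lemma jets_controlledD':
  assumes "jets_controlled n h b P s" "subring R" "P \<subseteq> R" "inverse (fact S) \<in> R" "N + s \<le> S" "curve_at n b \<gamma> \<Gamma>"
    "\<And>i. i < n \<Longrightarrow> \<Gamma> i \<in> jets_in R N" "(\<lambda>t. h (curve n \<gamma> t)) has_fps_expansion H"
  shows "H \<in> jets_in R N"
  by (rule jets_controlledD[OF assms(1-3) inverse_fact_mem[OF assms(2,4,5)] assms(6-)])

lemma jets_controlled_cong:
  assumes ev: "\<forall>\<^sub>F z in nhdsin (Cspace n) b. h z = k z" and h: "jets_controlled n h b P s"
  shows "jets_controlled n k b P s"
proof (rule jets_controlledI)
  fix N R \<gamma> \<Gamma> H
  assume *: "subring R" "P \<subseteq> R" "inverse (fact (N + s)) \<in> R" and c: "curve_at n b \<gamma> \<Gamma>"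
    and \<Gamma>: "\<And>i. i < n \<Longrightarrow> \<Gamma> i \<in> jets_in R N" and H: "(\<lambda>t. k (curve n \<gamma> t)) has_fps_expansion H"
  have "\<forall>\<^sub>F t in nhds 0. k (curve n \<gamma> t) = h (curve n \<gamma> t)"
    by (rule eventually_curve[OF c]) (use ev in \<open>simp add: eq_commute\<close>)
  from jets_controlledD[OF h * c \<Gamma> has_fps_expansion_eventually_eq[OF H this]]
  show "H \<in> jets_in R N" by auto
qed

text \<open>Some operators consult coefficients of the curve beyond order \<open>N\<close>, which
  need not lie in \<open>R\<close>. Truncating the curve puts all its coefficients into
  \<open>R\<close> and, by \<open>jet_dependence\<close>, leaves the \<open>N\<close>-jet of
  \<open>h\<close> along it unchanged.\<close>

lemma jets_controlled_by_polynomial_curves: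
  assumes ev: "\<forall>\<^sub>F z in nhdsin (Cspace n) b. cdiff n h z"
    and pc: "\<And>N R \<gamma> \<Gamma> H. subring R \<Longrightarrow> P \<subseteq> R \<Longrightarrow> inverse (fact (N + s)) \<in> R \<Longrightarrow> curve_at n b \<gamma> \<Gamma> \<Longrightarrow>
    (\<And>i M. i < n \<Longrightarrow> \<Gamma> i \<in> jets_in R M) \<Longrightarrow> (\<lambda>t. h (curve n \<gamma> t)) has_fps_expansion H \<Longrightarrow> H \<in> jets_in R N"
  shows "jets_controlled n h b P s"
proof (rule jets_controlledI)
  fix N R \<gamma> \<Gamma> H
  assume *: "subring R" "P \<subseteq> R" "inverse (fact (N + s)) \<in> R" and c: "curve_at n b \<gamma> \<Gamma>"
    and \<Gamma>: "\<And>i. i < n \<Longrightarrow> \<Gamma> i \<in> jets_in R N" and H: "(\<lambda>t. h (curve n \<gamma> t)) has_fps_expansion H"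
  define p where "p i = (\<Sum>k\<le>N. monom (fps_nth (\<Gamma> i) k) k)" for i
  have p: "coeff (p i) k = (if k \<le> N then fps_nth (\<Gamma> i) k else 0)" for i k
    by (auto simp: p_def coeff_sum)
  have c': "curve_at n b (\<lambda>i. poly (p i)) (\<lambda>i. fps_of_poly (p i))"
    using c by (auto simp: curve_at_def has_fps_expansion_of_poly p)
  note H' = has_fps_expansion_curve[OF ev c']
  have "fps_expansion (\<lambda>t. h (curve n (\<lambda>i. poly (p i)) t)) 0 \<in> jets_in R N"
    by (rule pc[OF * c' _ H']) (use \<Gamma> *(1) in \<open>auto simp: jets_in_def p subring_zero\<close>)
  moreover have "fps_nth H k = fps_nth (fps_expansion (\<lambda>t. h (curve n (\<lambda>i. poly (p i)) t)) 0) k" if "k \<le> N" for k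
    by (rule jet_dependence[OF ev c c' _ H H' that]) (simp add: p)
  ultimately show "H \<in> jets_in R N"
    by (simp add: jets_in_def)
qed

text \<open>Shearing the curve by \<open>c t e\<^sub>j\<close> and interpolating in \<open>c\<close> gives access to the jets of the partial
  derivatives; the interpolation nodes being integers, this costs only the denominator \<open>1 / K!\<close>.\<close>

lemma coefficient_polynomial:
  assumes ev: "\<forall>\<^sub>F z in nhdsin (Cspace n) b. cdiff n h z" and j: "j < n" and c: "curve_at n b \<gamma> \<Gamma>"
  shows "\<exists>Q. degree Q \<le> K \<and>
    (\<forall>c H. (\<lambda>t. h (curve n (\<lambda>i t. if i = j then \<gamma> i t + c * t else \<gamma> i t) t)) has_fps_expansion H \<longrightarrow> poly Q c = fps_nth H K) \<and>
    (\<forall>H. (\<lambda>t. partial j h (curve n \<gamma> t)) has_fps_expansion H \<longrightarrow> 0 < K \<longrightarrow> coeff Q 1 = fps_nth H (K - 1))"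
proof -
  define \<Phi> where "\<Phi> i = fps_expansion (\<lambda>t. (partial j ^^ i) h (curve n \<gamma> t)) 0" for i
  have \<Phi>: "(\<lambda>t. (partial j ^^ i) h (curve n \<gamma> t)) has_fps_expansion \<Phi> i" for i
    unfolding \<Phi>_def by (rule has_fps_expansion_curve[OF eventually_cdiff_partial_funpow[OF ev j] c])
  \<comment> \<open>Along the curve moved by c t in direction j, the i-th Taylor term carries the
    factor c^i t^i / i!, so its part of order K involves the coefficient of order K - i of the i-th
    partial derivative.\<close>
  define Q where "Q = (\<Sum>i\<le>K. monom (inverse (fact i) * fps_nth (\<Phi> i) (K - i)) i)"
  have "degree Q \<le> K"
    unfolding Q_def by (intro degree_sum_le) (auto intro: order_trans[OF degree_monom_le])
  moreover have "poly Q c = fps_nth H K"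
    if H: "(\<lambda>t. h (curve n (\<lambda>i t. if i = j then \<gamma> i t + c * t else \<gamma> i t) t)) has_fps_expansion H" for c H
  proof -
    have W: "(\<lambda>t. c * t) has_fps_expansion fps_const c * fps_X"
      by (intro has_fps_expansion_mult has_fps_expansion_const has_fps_expansion_fps_X)
    have "fps_nth H K = fps_nth (\<Sum>i\<le>K. fps_const (inverse (fact i)) * \<Phi> i * (fps_const c * fps_X) ^ i) K"
      by (rule taylor_along_curve[OF ev j \<open>curve_at n b \<gamma> \<Gamma>\<close> \<Phi> W _ H]) auto
    also have "\<dots> = (\<Sum>i\<le>K. inverse (fact i) * fps_nth (\<Phi> i) (K - i) * c ^ i)"
      unfolding fps_sum_nth
    proof (intro sum.cong refl)
      fix i assume "i \<in> {..K}"
      have e: "fps_const (inverse (fact i)) * \<Phi> i * (fps_const c * fps_X) ^ i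
          = fps_const (inverse (fact i) * c ^ i) * (fps_X ^ i * \<Phi> i)"
        by (simp only: power_mult_distrib fps_const_power mult_ac fps_const_mult[symmetric])
      show "fps_nth (fps_const (inverse (fact i)) * \<Phi> i * (fps_const c * fps_X) ^ i) K = inverse (fact i) * fps_nth (\<Phi> i) (K - i) * c ^ i"
        unfolding e using \<open>i \<in> {..K}\<close> by (simp add: fps_X_power_mult_nth)
    qed
    finally show ?thesis by (simp add: Q_def poly_sum poly_monom)
  qed
  moreover have "coeff Q 1 = fps_nth H (K - 1)"
    if "(\<lambda>t. partial j h (curve n \<gamma> t)) has_fps_expansion H" "0 < K" for H
  proof -
    have "H = \<Phi> 1" using has_fps_expansion_unique[OF that(1)] \<Phi>[of 1] by simp
    then show ?thesis using that(2) by (simp add: Q_def coeff_sum)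
  qed
  ultimately show ?thesis by (intro exI[of _ Q]) auto
qed

lemma curve_at_shear:
  assumes "curve_at n b \<gamma> \<Gamma>" "w has_fps_expansion W" "fps_nth W 0 = 0"
  shows "curve_at n b (\<lambda>i t. if i = j then \<gamma> i t + w t else \<gamma> i t) (\<lambda>i. if i = j then \<Gamma> i + W else \<Gamma> i)"
  unfolding curve_at_def
proof (intro conjI allI impI)
  fix i assume "i < n"
  with assms show "(\<lambda>t. if i = j then \<gamma> i t + w t else \<gamma> i t) has_fps_expansion (if i = j then \<Gamma> i + W else \<Gamma> i)"
    by (cases "i = j") (auto simp: curve_at_def intro: has_fps_expansion_add)
qed (use assms in \<open>auto simp: curve_at_def\<close>)

lemma has_fps_expansion_linear: "(\<lambda>t. c * t) has_fps_expansion fps_const c * fps_X" for c :: complex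
  by (intro has_fps_expansion_mult has_fps_expansion_const has_fps_expansion_fps_X)

text \<open>The coefficient of order k + 1 of \<open>h\<close> along the sheared curve is a
  polynomial in the shear whose linear coefficient is the k-th coefficient of the derivative along
  the original curve. Raising \<open>s\<close> by one pays both for the lost order and for the k + 2
  interpolation nodes.\<close>

lemma jets_controlled_partial:
  assumes ev: "\<forall>\<^sub>F z in nhdsin (Cspace n) b. cdiff n h z" and h: "jets_controlled n h b P s" and j: "j < n"
  shows "jets_controlled n (partial j h) b P (Suc s)"
proof (rule jets_controlled_by_polynomial_curves[OF eventually_cdiff_partial[OF ev j]])
  fix N R \<gamma> \<Gamma> H
  assume R: "subring R" "P \<subseteq> R" "inverse (fact (N + Suc s)) \<in> R" and c: "curve_at n b \<gamma> \<Gamma>"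
    and \<Gamma>: "\<And>i M. i < n \<Longrightarrow> \<Gamma> i \<in> jets_in R M" and H: "(\<lambda>t. partial j h (curve n \<gamma> t)) has_fps_expansion H"
  have "fps_nth H k \<in> R" if k: "k \<le> N" for k
  proof -
    obtain Q where Q: "degree Q \<le> Suc k" "coeff Q 1 = fps_nth H k"
      and Qc: "\<And>c H. (\<lambda>t. h (curve n (\<lambda>i t. if i = j then \<gamma> i t + c * t else \<gamma> i t) t)) has_fps_expansion H
        \<Longrightarrow> poly Q c = fps_nth H (Suc k)"
      using coefficient_polynomial[OF ev j c, of "Suc k"] H by auto
    have "Q \<in> polys_over R"
    proof (rule poly_coeff_interpolation_shifted_integers[OF R(1,3) _ Q(1) subring_zero[OF R(1)]])
      show "poly Q (of_nat (Suc m) - 0) \<in> R" for m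
      proof -
        have c': "curve_at n b (\<lambda>i t. if i = j then \<gamma> i t + of_nat (Suc m) * t else \<gamma> i t)
            (\<lambda>i. if i = j then \<Gamma> i + fps_const (of_nat (Suc m)) * fps_X else \<Gamma> i)"
          by (rule curve_at_shear[OF c has_fps_expansion_linear]) simp
        note H' = has_fps_expansion_curve[OF ev c']
        have "fps_expansion (\<lambda>t. h (curve n (\<lambda>i t. if i = j then \<gamma> i t + of_nat (Suc m) * t else \<gamma> i t) t)) 0 \<in> jets_in R (Suc k)"
          by (rule jets_controlledD'[OF h R _ c' _ H'])
            (use k R(1) \<Gamma> in \<open>auto intro!: jets_in_add jets_in_mult jets_in_const jets_in_X subring_of_nat simp del: of_nat_Suc\<close>)
        then show ?thesis
          using Qc[OF H'] by (simp del: of_nat_Suc add: jets_inD)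
      qed
    qed (use k in simp)
    then show ?thesis using Q(2) polys_over_coeff[of Q R 1] by simp
  qed
  then show "H \<in> jets_in R N" by (simp add: jets_in_def)
qed

text \<open>Here the base point lies on the hypersurface z n = b n. The curve may run inside it,
  where the equation between \<open>f\<close> and \<open>h\<close> reads 0 = 0; so its speed in the
  last coordinate is changed to m + 1 for m = 0, ..., k. Then \<gamma> n - b n becomes t times a
  series with the invertible constant term m + 1, and division by t loses one order. Interpolating
  in the shear leads back to the given curve.\<close>

lemma jets_controlled_monomial_division:
  assumes ev: "\<forall>\<^sub>F z in nhdsin (Cspace (Suc n)) b. cdiff (Suc n) h z"
    and fh: "\<forall>\<^sub>F z in nhdsin (Cspace (Suc n)) b. f z = (z n - b n) * h z"
    and f: "jets_controlled (Suc n) f b P s"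
  shows "jets_controlled (Suc n) h b P (Suc s)"
proof (rule jets_controlled_by_polynomial_curves[OF ev])
  fix N R \<gamma> \<Gamma> H
  assume R: "subring R" "P \<subseteq> R" "inverse (fact (N + Suc s)) \<in> R" and c: "curve_at (Suc n) b \<gamma> \<Gamma>"
    and \<Gamma>: "\<And>i M. i < Suc n \<Longrightarrow> \<Gamma> i \<in> jets_in R M" and H: "(\<lambda>t. h (curve (Suc n) \<gamma> t)) has_fps_expansion H"
  \<comment> \<open>The speed of the curve in the last coordinate; a shear by m + 1 - x changes it
    to m + 1.\<close>
  define x where "x = fps_nth (\<Gamma> n) 1"
  have x: "x \<in> R" using \<Gamma>[of n 1] by (auto simp: x_def jets_in_def)
  have bn: "b n \<in> R" "fps_nth (\<Gamma> n) 0 = b n" using \<Gamma>[of n 0] c by (auto simp: jets_in_def curve_at_def)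
  have "fps_nth H k \<in> R" if k: "k \<le> N" for k
  proof -
    obtain Q where Q: "degree Q \<le> k"
      and Qc: "\<And>c H. (\<lambda>t. h (curve (Suc n) (\<lambda>i t. if i = n then \<gamma> i t + c * t else \<gamma> i t) t)) has_fps_expansion H
        \<Longrightarrow> poly Q c = fps_nth H k"
      using coefficient_polynomial[OF ev lessI c, of k] by auto
    have "Q \<in> polys_over R"
    proof (rule poly_coeff_interpolation_shifted_integers[OF R(1,3) _ Q x])
      show "poly Q (of_nat (Suc m) - x) \<in> R" if "m \<le> k" for m
      proof -
        define y where "y = of_nat (Suc m) - x"
        have y: "y \<in> R" unfolding y_def using R x by (intro subring_diff subring_of_nat)
        let ?\<gamma> = "\<lambda>i t. if i = n then \<gamma> i t + y * t else \<gamma> i t"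
        let ?\<Gamma> = "\<lambda>i. if i = n then \<Gamma> i + fps_const y * fps_X else \<Gamma> i"
        have c': "curve_at (Suc n) b ?\<gamma> ?\<Gamma>"
          by (rule curve_at_shear[OF c has_fps_expansion_linear]) simp
        have \<Gamma>': "?\<Gamma> i \<in> jets_in R M" if "i < Suc n" for i M
          using \<Gamma>[OF that, of M] R(1) y by (auto intro!: jets_in_add jets_in_mult jets_in_const jets_in_X)
        define H' where "H' = fps_expansion (\<lambda>t. h (curve (Suc n) ?\<gamma> t)) 0"
        have H': "(\<lambda>t. h (curve (Suc n) ?\<gamma> t)) has_fps_expansion H'"
          unfolding H'_def by (rule has_fps_expansion_curve[OF ev c'])
        define D where "D = ?\<Gamma> n - fps_const (b n)"
        have D: "(\<lambda>t. ?\<gamma> n t - b n) has_fps_expansion D"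
          unfolding D_def using c' by (intro has_fps_expansion_diff has_fps_expansion_const) (auto simp: curve_at_def)
        have "(\<lambda>t. (?\<gamma> n t - b n) * h (curve (Suc n) ?\<gamma> t)) has_fps_expansion D * H'"
          by (intro has_fps_expansion_mult D H')
        moreover have "\<forall>\<^sub>F t in nhds 0. (?\<gamma> n t - b n) * h (curve (Suc n) ?\<gamma> t) = f (curve (Suc n) ?\<gamma> t)"
          using eventually_curve[OF c' fh] by eventually_elim (simp add: cvec_of_nth)
        ultimately have F: "(\<lambda>t. f (curve (Suc n) ?\<gamma> t)) has_fps_expansion D * H'"
          by (rule has_fps_expansion_eventually_eq)
        \<comment> \<open>One order more than is wanted for H', to be used up by the division by t;
          it is available because \<open>Suc N + s\<close> equals \<open>N + Suc s\<close>.\<close>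
        have DH: "D * H' \<in> jets_in R (Suc N)"
          by (rule jets_controlledD'[OF f R _ c' \<Gamma>' F]) simp
        define G where "G = fps_shift 1 D"
        have DG: "D = fps_X * G"
          by (rule fps_ext) (use bn in \<open>auto simp: G_def D_def fps_X_mult_nth not_less_eq\<close>)
        have G0: "fps_nth G 0 = of_nat (Suc m)"
          by (simp add: G_def D_def x_def y_def)
        have GR: "G \<in> jets_in R N"
          using \<Gamma>'[of n "Suc N"] bn jets_in_const[OF R(1) bn(1), of "Suc N"] R(1)
          by (auto simp: G_def D_def jets_in_def intro!: subring_diff)
        have "fps_nth (G * H') l \<in> R" if "l \<le> N" for l
          using jets_inD[OF DH, of "Suc l"] that by (simp add: DG mult.assoc fps_X_mult_nth)
        then have GH: "G * H' \<in> jets_in R N" by (simp add: jets_in_def)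
        have "H' \<in> jets_in R N"
        proof (rule jets_in_cancel_unit[OF R(1) GH GR])
          show "inverse (fps_nth G 0) \<in> R"
            unfolding G0 using \<open>m \<le> k\<close> k by (intro inverse_of_nat_mem[OF R(1,3)]) auto
          show "fps_nth G 0 \<noteq> 0" unfolding G0 using of_nat_neq_0 .
        qed
        then show ?thesis
          unfolding y_def[symmetric] using Qc[OF H'] k by (simp add: jets_inD)
      qed
    qed (use k in simp)
    \<comment> \<open>Shear 0 is the original curve, so the constant coefficient of Q is the one
      sought.\<close>
    moreover have "(\<lambda>i. if i = n then \<gamma> i t + 0 * t else \<gamma> i t) = (\<lambda>i. \<gamma> i t)" for t
      by auto
    then have "poly Q 0 = fps_nth H k"
      by (intro Qc) (simp only: H)
    ultimately show ?thesis
      using polys_over_coeff[of Q R 0] by (simp add: poly_0_coeff_0)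
  qed
  then show "H \<in> jets_in R N" by (simp add: jets_in_def)
qed

text \<open>Off the hypersurface the divisor is a unit along every curve; its inverse at the base
  point joins \<open>P\<close>, and no order is lost. Such base points occur arbitrarily close to
  the hypersurface, so stability of the stalks involves them too.\<close>

lemma jets_controlled_quotient:
  assumes b: "b \<in> topspace (Cspace (Suc n))" "b n \<noteq> \<alpha>"
    and ev: "\<forall>\<^sub>F z in nhdsin (Cspace (Suc n)) b. cdiff (Suc n) h z"
    and fh: "\<forall>\<^sub>F z in nhdsin (Cspace (Suc n)) b. f z = (z n - \<alpha>) * h z"
    and f: "jets_controlled (Suc n) f b P s"
  shows "jets_controlled (Suc n) h b (insert \<alpha> (insert (inverse (b n - \<alpha>)) P)) s"
proof (rule jets_controlledI)
  fix N R \<gamma> \<Gamma> H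
  assume R: "subring R" "insert \<alpha> (insert (inverse (b n - \<alpha>)) P) \<subseteq> R" "inverse (fact (N + s)) \<in> R"
    and c: "curve_at (Suc n) b \<gamma> \<Gamma>"
    and \<Gamma>: "\<And>i. i < Suc n \<Longrightarrow> \<Gamma> i \<in> jets_in R N" and H: "(\<lambda>t. h (curve (Suc n) \<gamma> t)) has_fps_expansion H"
  define D where "D = \<Gamma> n - fps_const \<alpha>"
  have "(\<lambda>t. (\<gamma> n t - \<alpha>) * h (curve (Suc n) \<gamma> t)) has_fps_expansion D * H"
    unfolding D_def using c by (intro has_fps_expansion_mult has_fps_expansion_diff has_fps_expansion_const H) (auto simp: curve_at_def)
  moreover have "\<forall>\<^sub>F t in nhds 0. (\<gamma> n t - \<alpha>) * h (curve (Suc n) \<gamma> t) = f (curve (Suc n) \<gamma> t)"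
    using eventually_curve[OF c fh] by eventually_elim (simp add: cvec_of_nth)
  ultimately have F: "(\<lambda>t. f (curve (Suc n) \<gamma> t)) has_fps_expansion D * H"
    by (rule has_fps_expansion_eventually_eq)
  have "D * H \<in> jets_in R N"
    by (rule jets_controlledD[OF f R(1) _ R(3) c \<Gamma> F]) (use R in auto)
  moreover have "D \<in> jets_in R N"
    unfolding D_def using R \<Gamma> by (intro jets_in_diff jets_in_const) auto
  ultimately show "H \<in> jets_in R N"
    by (rule jets_in_cancel_unit[OF R(1)]) (use b R c in \<open>auto simp: D_def curve_at_def\<close>)
qed

text \<open>The \<open>g i\<close> map a curve through \<open>b\<close> with \<open>N\<close>-jet in
  \<open>R\<close> to one through \<open>a\<close> of the same kind, and the hypothesis on
  \<open>f\<close> applies to it.\<close>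

lemma jets_controlled_compose:
  assumes f: "jets_controlled n f a P s"
    and ev: "\<And>i. i < n \<Longrightarrow> \<forall>\<^sub>F z in nhdsin (Cspace m) b. cdiff m (g i) z"
    and g: "\<And>i. i < n \<Longrightarrow> jets_controlled m (g i) b (Q i) (q i)"
    and gb: "\<And>i. i < n \<Longrightarrow> g i b = a i" and a: "a \<in> topspace (Cspace n)" and b: "b \<in> topspace (Cspace m)"
  shows "jets_controlled m (\<lambda>z. f (cvec_of n (\<lambda>i. g i z))) b (P \<union> (\<Union>i<n. Q i)) (s + (\<Sum>i<n. q i))"
proof (rule jets_controlledI)
  fix N R \<gamma> \<Gamma> H
  assume R: "subring R" "P \<union> (\<Union>i<n. Q i) \<subseteq> R" "inverse (fact (N + (s + (\<Sum>i<n. q i)))) \<in> R"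
    and c: "curve_at m b \<gamma> \<Gamma>"
    and \<Gamma>: "\<And>i. i < m \<Longrightarrow> \<Gamma> i \<in> jets_in R N"
    and H: "(\<lambda>t. f (cvec_of n (\<lambda>i. g i (curve m \<gamma> t)))) has_fps_expansion H"
  define \<Delta> where "\<Delta> i = fps_expansion (\<lambda>t. g i (curve m \<gamma> t)) 0" for i
  have \<Delta>: "(\<lambda>t. g i (curve m \<gamma> t)) has_fps_expansion \<Delta> i" if "i < n" for i
    unfolding \<Delta>_def by (rule has_fps_expansion_curve[OF ev[OF that] c])
  have "curve m \<gamma> 0 = b"
    using b curve_at_0[OF c] by (intro cvec_of_eq)
  then have c': "curve_at n a (\<lambda>i t. g i (curve m \<gamma> t)) \<Delta>"
    unfolding curve_at_def using a \<Delta> gb has_fps_expansion_imp_0_eq_fps_nth_0[OF \<Delta>] by auto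
  have \<Delta>R: "\<Delta> i \<in> jets_in R N" if "i < n" for i
  proof (rule jets_controlledD'[OF g[OF that] R(1) _ R(3) _ c \<Gamma> \<Delta>[OF that]])
    show "N + q i \<le> N + (s + (\<Sum>i<n. q i))"
      using member_le_sum[of i "{..<n}" q] that by auto
  qed (use R that in auto)
  show "H \<in> jets_in R N"
    by (rule jets_controlledD'[OF f R(1) _ R(3) _ c' \<Delta>R H]) (use R in auto)
qed

text \<open>The hypothesis on \<open>f\<close> is applied to the conjugate curve and to the
  conjugate of the ring \<open>R\<close>, which it covers because the invariant quantifies over all
  rings containing \<open>P\<close>.\<close>

lemma jets_controlled_conjugate:
  assumes f: "jets_controlled n f a P s"
  shows "jets_controlled n (\<lambda>z. cnj (f (\<lambda>i. cnj (z i)))) (\<lambda>i. cnj (a i)) (cnj ` P) s"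
proof (rule jets_controlledI)
  fix N R \<gamma> \<Gamma> H
  assume R: "subring R" "cnj ` P \<subseteq> R" "inverse (fact (N + s)) \<in> R"
    and c: "curve_at n (\<lambda>i. cnj (a i)) \<gamma> \<Gamma>"
    and \<Gamma>: "\<And>i. i < n \<Longrightarrow> \<Gamma> i \<in> jets_in R N"
    and H: "(\<lambda>t. cnj (f (\<lambda>i. cnj (curve n \<gamma> t i)))) has_fps_expansion H"
  have R': "subring (cnj ` R)"
    unfolding subring_def
  proof (intro conjI ballI)
    show "1 \<in> cnj ` R" using subring_one[OF R(1)] by (rule rev_image_eqI) simp
    fix x y assume "x \<in> cnj ` R" "y \<in> cnj ` R"
    then obtain u v where uv: "u \<in> R" "v \<in> R" "x = cnj u" "y = cnj v" by auto
    show "x - y \<in> cnj ` R" using subring_diff[OF R(1) uv(1,2)] by (rule rev_image_eqI) (simp add: uv)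
    show "x * y \<in> cnj ` R" using subring_mult[OF R(1) uv(1,2)] by (rule rev_image_eqI) (simp add: uv)
  qed
  have PR': "P \<subseteq> cnj ` R"
  proof
    fix x assume "x \<in> P"
    then have "cnj x \<in> R" using R(2) by auto
    then show "x \<in> cnj ` R" by (rule rev_image_eqI) simp
  qed
  have fR': "inverse (fact (N + s)) \<in> cnj ` R"
    using R(3) by (rule rev_image_eqI) simp
  let ?\<gamma> = "\<lambda>i t. cnj (\<gamma> i (cnj t))" and ?\<Gamma> = "\<lambda>i. Abs_fps (\<lambda>k. cnj (fps_nth (\<Gamma> i) k))"
  have c': "curve_at n a ?\<gamma> ?\<Gamma>"
    using c by (auto simp: curve_at_def topspace_Cspace intro: has_fps_expansion_cnj)
  have "(\<lambda>t. cnj (cnj (f (\<lambda>i. cnj (curve n \<gamma> (cnj t) i))))) has_fps_expansion Abs_fps (\<lambda>k. cnj (fps_nth H k))"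
    by (rule has_fps_expansion_cnj[OF H])
  moreover have "(\<lambda>i. cnj (curve n \<gamma> (cnj t) i)) = curve n ?\<gamma> t" for t
    by (auto simp: cvec_of_def)
  ultimately have H': "(\<lambda>t. f (curve n ?\<gamma> t)) has_fps_expansion Abs_fps (\<lambda>k. cnj (fps_nth H k))"
    by simp
  have "Abs_fps (\<lambda>k. cnj (fps_nth H k)) \<in> jets_in (cnj ` R) N"
    by (rule jets_controlledD[OF f R' PR' fR' c' _ H']) (use \<Gamma> in \<open>auto simp: jets_in_def\<close>)
  then show "H \<in> jets_in R N"
    by (auto simp: jets_in_def inj_image_mem_iff inj_def)
qed

text \<open>The coefficients themselves are put into \<open>P\<close>, so they may be arbitrary
  complex numbers.\<close>

lemma jets_controlled_polynomial:
  assumes b: "b \<in> topspace (Cspace n)"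
  shows "jets_controlled n (\<lambda>z. \<Sum>\<alpha>\<in>S. c \<alpha> * (\<Prod>i<n. z i ^ \<alpha> i)) b (c ` S) 0"
proof (rule jets_controlledI)
  fix N R \<gamma> \<Gamma> H
  assume R: "subring R" "c ` S \<subseteq> R"
    and cu: "curve_at n b \<gamma> \<Gamma>" and \<Gamma>: "\<And>i. i < n \<Longrightarrow> \<Gamma> i \<in> jets_in R N"
    and H: "(\<lambda>t. \<Sum>\<alpha>\<in>S. c \<alpha> * (\<Prod>i<n. curve n \<gamma> t i ^ \<alpha> i)) has_fps_expansion H"
  have "(\<lambda>t. \<Sum>\<alpha>\<in>S. c \<alpha> * (\<Prod>i<n. \<gamma> i t ^ \<alpha> i)) has_fps_expansion (\<Sum>\<alpha>\<in>S. fps_const (c \<alpha>) * (\<Prod>i<n. \<Gamma> i ^ \<alpha> i))"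
    using cu by (intro has_fps_expansion_sum has_fps_expansion_mult has_fps_expansion_const
      has_fps_expansion_prod has_fps_expansion_power) (auto simp: curve_at_def)
  moreover have "(\<Prod>i<n. curve n \<gamma> t i ^ \<alpha> i) = (\<Prod>i<n. \<gamma> i t ^ \<alpha> i)" for t \<alpha>
    by (intro prod.cong refl) (simp add: cvec_of_nth)
  ultimately have "H = (\<Sum>\<alpha>\<in>S. fps_const (c \<alpha>) * (\<Prod>i<n. \<Gamma> i ^ \<alpha> i))"
    using has_fps_expansion_unique[OF H] by simp
  also have "\<dots> \<in> jets_in R N"
    using R \<Gamma> by (intro jets_in_sum jets_in_mult jets_in_prod jets_in_power jets_in_const) auto
  finally show "H \<in> jets_in R N" .
qed

text \<open>W is divisible by t^k, so its higher powers are divisible by t^(2 k) and do not reach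
  order k. The expansion is linear in the first unknown coefficient.\<close>

lemma fps_mult_power_nth_low:
  fixes W \<Phi> :: "complex fps"
  assumes W: "\<And>l. l < k \<Longrightarrow> fps_nth W l = 0" and k: "0 < k"
  shows "fps_nth (\<Phi> * W ^ i) k = (if i = 0 then fps_nth \<Phi> k else if i = 1 then fps_nth \<Phi> 0 * fps_nth W k else 0)"
proof -
  define V where "V = fps_shift k W"
  have "W = fps_X ^ k * V"
    by (rule fps_ext) (auto simp: V_def fps_X_power_mult_nth W)
  then have "W ^ i = fps_X ^ (k * i) * V ^ i"
    by (simp only: power_mult_distrib power_mult)
  then have "\<Phi> * W ^ i = fps_X ^ (k * i) * (\<Phi> * V ^ i)"
    by (simp only: mult_ac)
  then have "fps_nth (\<Phi> * W ^ i) k = (if k < k * i then 0 else fps_nth (\<Phi> * V ^ i) (k - k * i))"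
    by (simp only: fps_X_power_mult_nth)
  moreover have "k < k * i" if "i \<noteq> 0" "i \<noteq> 1"
    using k that by (cases i) auto
  ultimately show ?thesis
    using k by (auto simp: V_def)
qed

text \<open>Newton iteration, one coefficient at a time: if p is the part of \<phi> along the curve
  below order k and W the rest, the vanishing of \<open>f\<close> at p + W says in order k that 0 =
  [t^k] f(\<gamma>, p) + d0 W_k, where d0 is the partial derivative at the base point. Every step
  divides by the same d0, so its inverse joins \<open>P\<close> and \<open>s\<close> stays
  unchanged.\<close>

lemma jets_controlled_implicit:
  assumes b: "b \<in> topspace (Cspace n)"
    and evf: "\<forall>\<^sub>F z in nhdsin (Cspace (Suc n)) (b(n := \<phi> b)). cdiff (Suc n) f z"
    and ev\<phi>: "\<forall>\<^sub>F z in nhdsin (Cspace n) b. cdiff n \<phi> z"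
    and zero: "\<forall>\<^sub>F z in nhdsin (Cspace n) b. f (z(n := \<phi> z)) = 0"
    and d: "partial n f (b(n := \<phi> b)) \<noteq> 0"
    and f: "jets_controlled (Suc n) f (b(n := \<phi> b)) P s"
  shows "jets_controlled n \<phi> b (insert (\<phi> b) (insert (inverse (partial n f (b(n := \<phi> b)))) P)) s"
proof (rule jets_controlledI)
  fix N R \<gamma> \<Gamma> \<Psi>
  let ?a = "b(n := \<phi> b)"
  assume R: "subring R" "insert (\<phi> b) (insert (inverse (partial n f ?a)) P) \<subseteq> R" "inverse (fact (N + s)) \<in> R"
    and c: "curve_at n b \<gamma> \<Gamma>" and \<Gamma>: "\<And>i. i < n \<Longrightarrow> \<Gamma> i \<in> jets_in R N"
    and \<Psi>: "(\<lambda>t. \<phi> (curve n \<gamma> t)) has_fps_expansion \<Psi>"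
  define d0 where "d0 = partial n f ?a"
  have d0: "d0 \<noteq> 0" using d by (simp add: d0_def)
  define \<psi> where "\<psi> t = \<phi> (curve n \<gamma> t)" for t
  have c0: "curve n \<gamma> 0 = b" using b curve_at_0[OF c] by (intro cvec_of_eq)
  have a: "?a \<in> topspace (Cspace (Suc n))" using b by (simp add: topspace_Cspace)
  have "fps_nth \<Psi> k \<in> R" if "k \<le> N" for k
    using that
  proof (induction k rule: less_induct)
    case (less k)
    show ?case
    proof (cases "k = 0")
      case True
      then show ?thesis
        using has_fps_expansion_imp_0_eq_fps_nth_0[OF \<Psi>] c0 R(2) by simp
    next
      case False
      define p where "p = (\<Sum>l<k. monom (fps_nth \<Psi> l) l)"
      have p: "coeff p l = (if l < k then fps_nth \<Psi> l else 0)" for l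
        by (auto simp: p_def coeff_sum)
      define W where "W = \<Psi> - fps_of_poly p"
      have W: "(\<lambda>t. \<psi> t - poly p t) has_fps_expansion W"
        unfolding W_def \<psi>_def by (intro has_fps_expansion_diff \<Psi> has_fps_expansion_of_poly)
      have W0: "fps_nth W l = 0" if "l < k" for l using that by (simp add: W_def p)
      let ?\<gamma> = "\<lambda>i. if i = n then poly p else \<gamma> i" and ?\<Gamma> = "\<lambda>i. if i = n then fps_of_poly p else \<Gamma> i"
      have c': "curve_at (Suc n) ?a ?\<gamma> ?\<Gamma>"
        using c a has_fps_expansion_imp_0_eq_fps_nth_0[OF \<Psi>] c0 False
        by (auto simp: curve_at_def has_fps_expansion_of_poly p less_Suc_eq)
      define \<Phi> where "\<Phi> i = fps_expansion (\<lambda>t. (partial n ^^ i) f (curve (Suc n) ?\<gamma> t)) 0" for i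
      have \<Phi>: "(\<lambda>t. (partial n ^^ i) f (curve (Suc n) ?\<gamma> t)) has_fps_expansion \<Phi> i" for i
        unfolding \<Phi>_def by (rule has_fps_expansion_curve[OF eventually_cdiff_partial_funpow[OF evf lessI] c'])
      have "\<forall>\<^sub>F t in nhds 0. 0 = f (curve (Suc n) (\<lambda>i t. if i = n then ?\<gamma> i t + (\<psi> t - poly p t) else ?\<gamma> i t) t)"
        using eventually_curve[OF c zero]
      proof eventually_elim
        case (elim t)
        have "curve (Suc n) (\<lambda>i t. if i = n then ?\<gamma> i t + (\<psi> t - poly p t) else ?\<gamma> i t) t = (curve n \<gamma> t)(n := \<psi> t)"
          by (auto simp: cvec_of_def)
        then show ?case using elim by (simp add: \<psi>_def)
      qed
      with has_fps_expansion_0 have Z: "(\<lambda>t. f (curve (Suc n) (\<lambda>i t. if i = n then ?\<gamma> i t + (\<psi> t - poly p t) else ?\<gamma> i t) t)) has_fps_expansion 0"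
        by (rule has_fps_expansion_eventually_eq)
      have "0 = fps_nth (\<Sum>i\<le>k. fps_const (inverse (fact i)) * \<Phi> i * W ^ i) k"
        using taylor_along_curve[OF evf lessI c' \<Phi> W W0 Z order_refl[of k]] False by simp
      also have "\<dots> = (\<Sum>i\<le>k. if i = 0 then fps_nth (\<Phi> 0) k else if i = 1 then fps_nth (\<Phi> 1) 0 * fps_nth W k else 0)"
        unfolding fps_sum_nth using False by (intro sum.cong refl) (auto simp: fps_mult_power_nth_low[OF W0])
      also have "\<dots> = fps_nth (\<Phi> 0) k + fps_nth (\<Phi> 1) 0 * fps_nth W k"
      proof -
        have "{..k} = insert 0 (insert 1 {2..k})" using False by auto
        then show ?thesis by simp
      qed
      also have "fps_nth (\<Phi> 1) 0 = d0"
      proof -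
        have "curve (Suc n) ?\<gamma> 0 = ?a" using a curve_at_0[OF c'] by (intro cvec_of_eq)
        then show ?thesis using has_fps_expansion_imp_0_eq_fps_nth_0[OF \<Phi>[of 1]] by (simp add: d0_def)
      qed
      also have "fps_nth W k = fps_nth \<Psi> k" by (simp add: W_def p)
      finally have e: "fps_nth \<Psi> k = - (fps_nth (\<Phi> 0) k * inverse d0)"
        using d0 by (simp add: field_simps add_eq_0_iff)
      \<comment> \<open>By the induction hypothesis p has its coefficients in \<open>R\<close>, so
        \<open>f\<close> is controlled along the truncated curve.\<close>
      have "\<Phi> 0 \<in> jets_in R k"
      proof (rule jets_controlledD'[OF f R(1) _ R(3) _ c'])
        fix i assume "i < Suc n"
        then show "?\<Gamma> i \<in> jets_in R k"
          using \<Gamma> less.IH less.prems R(1) jets_in_mono[of _ R N k]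
          by (auto simp: less_Suc_eq) (auto simp: jets_in_def p subring_zero)
      qed (use R \<Phi>[of 0] less.prems in auto)
      then show ?thesis
        unfolding e using R(2) unfolding d0_def by (intro subring_minus[OF R(1)] subring_mult[OF R(1)]) (auto intro: jets_inD)
    qed
  qed
  then show "\<Psi> \<in> jets_in R N" by (simp add: jets_in_def)
qed

text \<open>By the addition theorem the expansion at b 0 combines those of cos and sin at 0. The
  base point thus contributes only the two numbers in \<open>P\<close>, and the order only the
  factorials up to \<open>N\<close>.\<close>

lemma jets_controlled_cos:
  assumes b: "b \<in> topspace (Cspace 1)"
  shows "jets_controlled 1 (\<lambda>z. cos (z 0)) b {cos (b 0), sin (b 0)} 0"
proof (rule jets_controlledI)
  fix N R \<gamma> \<Gamma> H
  assume R: "subring R" "{cos (b 0), sin (b 0)} \<subseteq> R" "inverse (fact (N + 0)) \<in> R"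
    and c: "curve_at 1 b \<gamma> \<Gamma>" and \<Gamma>: "\<And>i. i < 1 \<Longrightarrow> \<Gamma> i \<in> jets_in R N"
    and H: "(\<lambda>t. cos (curve 1 \<gamma> t 0)) has_fps_expansion H"
  define D where "D = \<Gamma> 0 - fps_const (b 0)"
  have g: "\<gamma> 0 has_fps_expansion \<Gamma> 0" "fps_nth (\<Gamma> 0) 0 = b 0" using c by (auto simp: curve_at_def)
  have D: "(\<lambda>t. \<gamma> 0 t - b 0) has_fps_expansion D" "fps_nth D 0 = 0"
    unfolding D_def using g by (auto intro: has_fps_expansion_diff)
  have "(\<lambda>t. cos (b 0) * (cos \<circ> (\<lambda>t. \<gamma> 0 t - b 0)) t - sin (b 0) * (sin \<circ> (\<lambda>t. \<gamma> 0 t - b 0)) t)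
      has_fps_expansion fps_const (cos (b 0)) * (fps_cos 1 oo D) - fps_const (sin (b 0)) * (fps_sin 1 oo D)"
    by (intro has_fps_expansion_diff has_fps_expansion_mult has_fps_expansion_const has_fps_expansion_compose
      has_fps_expansion_cos' has_fps_expansion_sin' D)
  moreover have "cos (curve 1 \<gamma> t 0) = cos (b 0) * (cos \<circ> (\<lambda>t. \<gamma> 0 t - b 0)) t - sin (b 0) * (sin \<circ> (\<lambda>t. \<gamma> 0 t - b 0)) t" for t
    using cos_add[of "b 0" "\<gamma> 0 t - b 0"] by (simp add: cvec_of_nth)
  ultimately have He: "H = fps_const (cos (b 0)) * (fps_cos 1 oo D) - fps_const (sin (b 0)) * (fps_sin 1 oo D)"
    using has_fps_expansion_unique[OF H] by simp
  have DR: "D \<in> jets_in R N"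
  proof -
    have "b 0 \<in> R" using \<Gamma>[of 0] g by (auto simp: jets_in_def)
    then show ?thesis unfolding D_def using R \<Gamma> by (intro jets_in_diff jets_in_const) auto
  qed
  have inv: "(-1) ^ k / fact l \<in> R" if "l \<le> N" for k l
  proof -
    have "inverse (fact l) \<in> R" by (rule inverse_fact_mem[OF R(1), of N]) (use R(3) that in simp_all)
    then show ?thesis
      unfolding divide_inverse by (intro subring_mult[OF R(1)] subring_power[OF R(1)] subring_minus[OF R(1)] subring_one[OF R(1)])
  qed
  have cs: "fps_cos 1 \<in> jets_in R N" "fps_sin 1 \<in> jets_in R N"
    using inv subring_zero[OF R(1)] by (auto simp: jets_in_def fps_cos_def fps_sin_def)
  show "H \<in> jets_in R N"
    unfolding He using R(2)
    by (intro jets_in_diff[OF R(1)] jets_in_mult[OF R(1)] jets_in_const[OF R(1)] jets_in_compose[OF R(1)] cs DR) auto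
qed

section \<open>The sheaf of germs with controlled jets\<close>

text \<open>\<open>P\<close> and \<open>s\<close> may vary with the base point without any
  uniformity. The condition is therefore pointwise, and restriction and gluing preserve it.\<close>

definition tame :: "nat \<Rightarrow> (cvec \<Rightarrow> complex) \<Rightarrow> cvec \<Rightarrow> bool" where
  "tame n h z \<longleftrightarrow> cdiff n h z \<and> (\<exists>P s. finite P \<and> jets_controlled n h z P s)"

lemma tameI: "cdiff n h z \<Longrightarrow> jets_controlled n h z P s \<Longrightarrow> finite P \<Longrightarrow> tame n h z"
  unfolding tame_def by auto

lemma tame_cong:
  assumes ev: "\<forall>\<^sub>F z in nhdsin (Cspace n) a. h z = k z" and h: "tame n h a"
  shows "tame n k a"
proof -
  obtain P s where "finite P" "jets_controlled n h a P s" using h by (auto simp: tame_def)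
  then show ?thesis
    using cdiff_cong[OF ev] jets_controlled_cong[OF ev] h by (auto simp: tame_def)
qed

definition tame_sheaf :: family where
  "tame_sheaf n U = {h. openin (Cspace n) U \<and> h \<in> extensional U \<and> (\<forall>z\<in>U. tame n h z)}"

lemma eventually_restrict_eq:
  "openin X V \<Longrightarrow> z \<in> V \<Longrightarrow> \<forall>\<^sub>F x in nhdsin X z. restrict h V x = h x"
  unfolding eventually_nhdsin by (intro disjI2 exI[of _ V]) auto

lemma is_sheaf_tame_sheaf: "is_sheaf tame_sheaf"
  unfolding is_sheaf_def
proof (intro conjI allI impI)
  fix n U h assume "h \<in> tame_sheaf n U"
  then show "holomorphic_Cn n U h" "h \<in> extensional U"
    by (auto simp: tame_sheaf_def holomorphic_Cn_iff tame_def)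
next
  fix n U V h assume h: "h \<in> tame_sheaf n U" and V: "openin (Cspace n) V" "V \<subseteq> U"
  have "tame n (restrict h V) z" if "z \<in> V" for z
  proof (rule tame_cong)
    show "\<forall>\<^sub>F x in nhdsin (Cspace n) z. h x = restrict h V x"
      using eventually_restrict_eq[OF V(1) that, of h] by (simp add: eq_commute)
    show "tame n h z" using h V that by (auto simp: tame_sheaf_def)
  qed
  then show "restrict h V \<in> tame_sheaf n V"
    using V by (simp add: tame_sheaf_def)
next
  fix n \<U> h
  assume *: "\<forall>U\<in>\<U>. openin (Cspace n) U \<and> restrict h U \<in> tame_sheaf n U" and h: "h \<in> extensional (\<Union>\<U>)"
  have "tame n h z" if "U \<in> \<U>" "z \<in> U" for U z
  proof (rule tame_cong)
    show "\<forall>\<^sub>F x in nhdsin (Cspace n) z. restrict h U x = h x"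
      using * that by (intro eventually_restrict_eq) auto
    show "tame n (restrict h U) z" using * that by (auto simp: tame_sheaf_def)
  qed
  moreover have "openin (Cspace n) (\<Union>\<U>)" using * by (intro openin_Union) auto
  ultimately show "h \<in> tame_sheaf n (\<Union>\<U>)" using h by (auto simp: tame_sheaf_def)
qed

lemma germ_eqI: "\<forall>\<^sub>F z in nhdsin (Cspace n) a. f z = g z \<Longrightarrow> germ n a f = germ n a g"
  unfolding germ_def by (auto elim: eventually_elim2)

lemma germ_eqD:
  assumes "germ n a f = germ m b g"
  shows "n = m" "a = b" "\<forall>\<^sub>F z in nhdsin (Cspace n) a. f z = g z"
proof -
  have "n = m \<and> a = b \<and>
      {k. \<forall>\<^sub>F z in nhdsin (Cspace n) a. k z = f z} = {k. \<forall>\<^sub>F z in nhdsin (Cspace m) b. k z = g z}"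
    using assms unfolding germ_def prod.inject .
  note nm = conjunct1[OF this] conjunct1[OF conjunct2[OF this]] and e = conjunct2[OF conjunct2[OF this]]
  have "f \<in> {k. \<forall>\<^sub>F z in nhdsin (Cspace n) a. k z = f z}" by simp
  then have "f \<in> {k. \<forall>\<^sub>F z in nhdsin (Cspace m) b. k z = g z}" unfolding e .
  then show "\<forall>\<^sub>F z in nhdsin (Cspace n) a. f z = g z" unfolding nm by simp
  show "n = m" "a = b" by (fact nm)+
qed

lemma germ_in_stalks: "a \<in> U \<Longrightarrow> h \<in> G n U \<Longrightarrow> germ n a h \<in> stalks G"
  unfolding stalks_def stalk_def by auto

lemma germ_in_stalksE:
  assumes "germ n a f \<in> stalks G"
  obtains h U where "a \<in> U" "h \<in> G n U" "\<forall>\<^sub>F z in nhdsin (Cspace n) a. f z = h z"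
proof -
  obtain m b h U where "germ n a f = germ m b h" "b \<in> U" "h \<in> G m U"
    using assms unfolding stalks_def stalk_def by auto
  then show thesis using germ_eqD[of n a f m b h] that by auto
qed

lemma germ_in_stalks_tame_sheaf:
  "germ n a f \<in> stalks tame_sheaf \<longleftrightarrow> a \<in> topspace (Cspace n) \<and> (\<forall>\<^sub>F z in nhdsin (Cspace n) a. tame n f z)"
proof
  assume "germ n a f \<in> stalks tame_sheaf"
  then obtain h U where U: "a \<in> U" "h \<in> tame_sheaf n U" and ev: "\<forall>\<^sub>F z in nhdsin (Cspace n) a. f z = h z"
    by (rule germ_in_stalksE)
  have U': "openin (Cspace n) U" "\<forall>z\<in>U. tame n h z" using U by (auto simp: tame_sheaf_def)
  have "\<forall>\<^sub>F z in nhdsin (Cspace n) a. z \<in> U"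
    unfolding eventually_nhdsin using U' U by auto
  with eventually_eventually_nhdsin[OF ev] have "\<forall>\<^sub>F z in nhdsin (Cspace n) a. tame n f z"
  proof eventually_elim
    case (elim z)
    show ?case
      by (rule tame_cong[where h = h]) (use elim U' in \<open>auto simp: eq_commute\<close>)
  qed
  moreover have "a \<in> topspace (Cspace n)" using openin_subset[OF U'(1)] U by auto
  ultimately show "a \<in> topspace (Cspace n) \<and> (\<forall>\<^sub>F z in nhdsin (Cspace n) a. tame n f z)" by simp
next
  assume "a \<in> topspace (Cspace n) \<and> (\<forall>\<^sub>F z in nhdsin (Cspace n) a. tame n f z)"
  then obtain U where U: "openin (Cspace n) U" "a \<in> U" "\<forall>z\<in>U. tame n f z"
    unfolding eventually_nhdsin by auto
  have "restrict f U \<in> tame_sheaf n U"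
    unfolding tame_sheaf_def
  proof (intro CollectI conjI ballI U(1) restrict_extensional)
    fix z assume z: "z \<in> U"
    show "tame n (restrict f U) z"
      by (rule tame_cong[where h = f]) (use eventually_restrict_eq[OF U(1) z, of f] U z in \<open>auto simp: eq_commute\<close>)
  qed
  then have "germ n a (restrict f U) \<in> stalks tame_sheaf"
    using U(2) by (rule germ_in_stalks[rotated])
  moreover have "germ n a (restrict f U) = germ n a f"
    by (rule germ_eqI[OF eventually_restrict_eq[OF U(1,2)]])
  ultimately show "germ n a f \<in> stalks tame_sheaf" by simp
qed

section \<open>Stability of the stalks under the operators defining C\<close>

lemma stable_polynomial: "\<omega> \<in> polynomial_operators K \<Longrightarrow> stable_under \<omega> tame_sheaf"
proof -
  assume "\<omega> \<in> polynomial_operators K"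
  then obtain n a p where \<omega>: "\<omega> = {([], germ n a p)}" and a: "a \<in> topspace (Cspace n)" and p: "polynomial_function K n p"
    unfolding polynomial_operators_def by auto
  obtain S c where S: "finite (S :: (nat \<Rightarrow> nat) set)" and pe: "p = (\<lambda>z. \<Sum>\<alpha>\<in>S. c \<alpha> * (\<Prod>i<n. z i ^ \<alpha> i))"
    using p unfolding polynomial_function_def by auto
  have "\<forall>\<^sub>F z in nhdsin (Cspace n) a. tame n p z"
    using eventually_nhdsin_topspace
  proof eventually_elim
    case (elim z)
    show ?case
      using tameI[OF cdiff_polynomial[OF elim p] _ finite_imageI[OF S, of c], of 0]
        jets_controlled_polynomial[OF elim, where S = S and c = c] by (simp add: pe)
  qed
  then show ?thesis
    unfolding stable_under_def \<omega> using a germ_in_stalks_tame_sheaf by auto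
qed

lemma stable_schwarz:
  assumes "a \<in> topspace (Cspace n)"
  shows "stable_under (schwarz_operator n a) tame_sheaf"
  unfolding stable_under_def
proof (intro allI impI)
  fix xs y assume "(xs, y) \<in> schwarz_operator n a" and xs: "set xs \<subseteq> stalks tame_sheaf"
  then obtain f where f: "xs = [germ n a f]" and y: "y = germ n (\<lambda>i. cnj (a i)) (\<lambda>z. cnj (f (\<lambda>i. cnj (z i))))"
    unfolding schwarz_operator_def by auto
  have "\<forall>\<^sub>F z in nhdsin (Cspace n) a. tame n f z"
    using xs f germ_in_stalks_tame_sheaf by auto
  then have "\<forall>\<^sub>F z in nhdsin (Cspace n) (\<lambda>i. cnj (a i)). tame n f (\<lambda>i. cnj (z i))"
    by (rule eventually_compose_filterlim[OF _ filterlim_conjugate[OF assms]])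
  then have "\<forall>\<^sub>F z in nhdsin (Cspace n) (\<lambda>i. cnj (a i)). tame n (\<lambda>z. cnj (f (\<lambda>i. cnj (z i)))) z"
  proof eventually_elim
    case (elim z)
    obtain P s where "finite P" "jets_controlled n f (\<lambda>i. cnj (z i)) P s" "cdiff n f (\<lambda>i. cnj (z i))"
      using elim by (auto simp: tame_def)
    then show ?case
      using cdiff_conjugate[of n f "\<lambda>i. cnj (z i)"] jets_controlled_conjugate[of n f "\<lambda>i. cnj (z i)" P s]
      by (intro tameI[of _ _ _ "cnj ` P" s]) simp_all
  qed
  then show "y \<in> stalks tame_sheaf"
    unfolding y germ_in_stalks_tame_sheaf using assms by (simp add: topspace_Cspace)
qed

lemma stable_composition:
  assumes a: "a \<in> topspace (Cspace n)" and b: "b \<in> topspace (Cspace m)"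
  shows "stable_under (composition_operator n a m b) tame_sheaf"
  unfolding stable_under_def
proof (intro allI impI)
  fix xs y assume "(xs, y) \<in> composition_operator n a m b" and xs: "set xs \<subseteq> stalks tame_sheaf"
  then obtain f g where f: "xs = germ n a f # map (\<lambda>i. germ m b (g i)) [0..<n]"
    and y: "y = germ m b (\<lambda>z. f (cvec_of n (\<lambda>i. g i z)))" and gb: "\<And>i. i < n \<Longrightarrow> g i b = a i"
    unfolding composition_operator_def cvec_of_def by auto
  have tf: "\<forall>\<^sub>F z in nhdsin (Cspace n) a. tame n f z"
    using xs f germ_in_stalks_tame_sheaf by auto
  have tg: "\<forall>\<^sub>F z in nhdsin (Cspace m) b. tame m (g i) z" if "i < n" for i
  proof -
    have "germ m b (g i) \<in> set xs" unfolding f using that by simp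
    then have "germ m b (g i) \<in> stalks tame_sheaf" by (rule subsetD[OF xs])
    then show ?thesis by (simp add: germ_in_stalks_tame_sheaf)
  qed
  have cg: "cdiff m (g i) b" if "i < n" for i
    using eventually_nhdsin_self[OF tg[OF that] b] by (simp add: tame_def)
  have "\<forall>\<^sub>F z in nhdsin (Cspace m) b. tame n f (cvec_of n (\<lambda>i. g i z))"
    by (rule eventually_compose_filterlim[OF tf filterlim_cdiff[OF a cg gb]])
  moreover have "\<forall>\<^sub>F z in nhdsin (Cspace m) b. \<forall>i\<in>{..<n}. \<forall>\<^sub>F w in nhdsin (Cspace m) z. tame m (g i) w"
    using eventually_eventually_nhdsin[OF tg] by (intro eventually_ball_finite) auto
  moreover have "\<forall>\<^sub>F z in nhdsin (Cspace m) b. z \<in> topspace (Cspace m)"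
    by (rule eventually_nhdsin_topspace)
  ultimately have "\<forall>\<^sub>F z in nhdsin (Cspace m) b. tame m (\<lambda>z. f (cvec_of n (\<lambda>i. g i z))) z"
  proof eventually_elim
    case (elim z)
    obtain P s where P: "finite P" "jets_controlled n f (cvec_of n (\<lambda>i. g i z)) P s" "cdiff n f (cvec_of n (\<lambda>i. g i z))"
      using elim(1) by (auto simp: tame_def)
    have tz: "tame m (g i) z" if "i < n" for i
      using eventually_nhdsin_self[OF _ elim(3)] elim(2) that by auto
    then have "\<forall>i\<in>{..<n}. \<exists>Q q. finite Q \<and> jets_controlled m (g i) z Q q"
      by (auto simp: tame_def)
    then obtain Q q where Q: "\<And>i. i < n \<Longrightarrow> finite (Q i)" "\<And>i. i < n \<Longrightarrow> jets_controlled m (g i) z (Q i) (q i)"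
      by (metis lessThan_iff)
    have ev: "\<forall>\<^sub>F w in nhdsin (Cspace m) z. cdiff m (g i) w" if "i < n" for i
      using elim(2) that by (auto simp: tame_def elim: eventually_mono)
    have J: "jets_controlled m (\<lambda>z. f (cvec_of n (\<lambda>i. g i z))) z (P \<union> (\<Union>i<n. Q i)) (s + (\<Sum>i<n. q i))"
      by (rule jets_controlled_compose[OF P(2) ev Q(2) _ cvec_of_topspace elim(3)]) (simp_all add: cvec_of_nth)
    have C: "cdiff m (\<lambda>z. f (cvec_of n (\<lambda>i. g i z))) z"
      by (rule cdiff_compose[OF elim(3) P(3)]) (use tz in \<open>simp_all add: cvec_of_nth tame_def\<close>)
    show ?case
      using P(1) Q(1) by (intro tameI[OF C J]) auto
  qed
  then show "y \<in> stalks tame_sheaf"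
    unfolding y germ_in_stalks_tame_sheaf using b by simp
qed

lemma eventually_tame_cdiff:
  "\<forall>\<^sub>F w in nhdsin (Cspace m) z. tame m g w \<Longrightarrow> \<forall>\<^sub>F w in nhdsin (Cspace m) z. cdiff m g w"
  by (erule eventually_mono) (simp add: tame_def)

lemma stable_derivative:
  assumes a: "a \<in> topspace (Cspace n)" and j: "j < n"
  shows "stable_under (derivative_operator n a j) tame_sheaf"
  unfolding stable_under_def
proof (intro allI impI)
  fix xs y assume "(xs, y) \<in> derivative_operator n a j" and xs: "set xs \<subseteq> stalks tame_sheaf"
  then obtain f where f: "xs = [germ n a f]" and y: "y = germ n a (partial j f)"
    unfolding derivative_operator_def partial_def[abs_def] by auto
  have "\<forall>\<^sub>F z in nhdsin (Cspace n) a. tame n f z"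
    using xs f germ_in_stalks_tame_sheaf by auto
  from eventually_eventually_nhdsin[OF this] eventually_nhdsin_topspace
  have "\<forall>\<^sub>F z in nhdsin (Cspace n) a. tame n (partial j f) z"
  proof eventually_elim
    case (elim z)
    have "tame n f z" by (rule eventually_nhdsin_self[OF elim])
    then obtain P s where P: "finite P" "jets_controlled n f z P s"
      by (auto simp: tame_def)
    note ev = eventually_tame_cdiff[OF elim(1)]
    show ?case
      by (rule tameI[OF cdiff_partial[OF elim(2) ev j] jets_controlled_partial[OF ev P(2) j] P(1)])
  qed
  then show "y \<in> stalks tame_sheaf"
    unfolding y germ_in_stalks_tame_sheaf using a by simp
qed

text \<open>Base points z of \<phi> correspond to the points (z, \<phi> z) of \<open>f\<close>.
  These tend to \<open>a\<close>, so by continuity the partial derivative is still nonzero there,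
  and control at each of them comes from \<open>f\<close>.\<close>

lemma stable_implicit:
  assumes a: "a \<in> topspace (Cspace (Suc n))"
  shows "stable_under (implicit_operator n a) tame_sheaf"
  unfolding stable_under_def
proof (intro allI impI)
  fix xs y assume "(xs, y) \<in> implicit_operator n a" and xs: "set xs \<subseteq> stalks tame_sheaf"
  then obtain f \<phi> where f: "xs = [germ (Suc n) a f]" and y: "y = germ n (a(n := 0)) \<phi>"
    and d: "partial n f a \<noteq> 0" and \<phi>: "holomorphic_near n (a(n := 0)) \<phi>" "\<phi> (a(n := 0)) = a n"
    and zero: "\<forall>\<^sub>F z in nhdsin (Cspace n) (a(n := 0)). f (z(n := \<phi> z)) = 0"
    unfolding implicit_operator_def partial_def by auto
  let ?b = "a(n := 0)"
  have b: "?b \<in> topspace (Cspace n)" using a by (auto simp: topspace_Cspace)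
  have tf: "\<forall>\<^sub>F z in nhdsin (Cspace (Suc n)) a. tame (Suc n) f z"
    using xs f germ_in_stalks_tame_sheaf by auto
  have ev\<phi>: "\<forall>\<^sub>F z in nhdsin (Cspace n) ?b. cdiff n \<phi> z"
    using \<phi>(1) by (simp add: holomorphic_near_iff)
  have lim: "filterlim (\<lambda>z. z(n := \<phi> z)) (nhdsin (Cspace (Suc n)) a) (nhdsin (Cspace n) ?b)"
  proof (rule filterlim_Cspace[OF a])
    show "\<forall>\<^sub>F z in nhdsin (Cspace n) ?b. z(n := \<phi> z) \<in> topspace (Cspace (Suc n))"
      using eventually_nhdsin_topspace by eventually_elim (simp add: topspace_Cspace)
    show "((\<lambda>z. (z(n := \<phi> z)) i) \<longlongrightarrow> a i) (nhdsin (Cspace n) ?b)" for i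
      using cdiff_tendsto[OF eventually_nhdsin_self[OF ev\<phi> b]] tendsto_coordinate[OF b, of i] \<phi>(2)
      by (cases "i = n") simp_all
  qed
  have "(partial n f \<longlongrightarrow> partial n f a) (nhdsin (Cspace (Suc n)) a)"
    by (rule cdiff_tendsto[OF cdiff_partial[OF a eventually_tame_cdiff[OF tf] lessI]])
  then have "\<forall>\<^sub>F z in nhdsin (Cspace (Suc n)) a. partial n f z \<noteq> 0"
    using d by (rule tendsto_imp_eventually_ne)
  note e1 = eventually_compose_filterlim[OF this lim]
  note e2 = eventually_compose_filterlim[OF eventually_eventually_nhdsin[OF tf] lim]
  from e1 e2 eventually_eventually_nhdsin[OF ev\<phi>] eventually_eventually_nhdsin[OF zero] eventually_nhdsin_topspace
  have "\<forall>\<^sub>F z in nhdsin (Cspace n) ?b. tame n \<phi> z"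
  proof eventually_elim
    case (elim z)
    have t: "z(n := \<phi> z) \<in> topspace (Cspace (Suc n))" using elim(5) by (simp add: topspace_Cspace)
    have "tame (Suc n) f (z(n := \<phi> z))" by (rule eventually_nhdsin_self[OF elim(2) t])
    then obtain P s where P: "finite P" "jets_controlled (Suc n) f (z(n := \<phi> z)) P s"
      by (auto simp: tame_def)
    show ?case
      by (rule tameI[OF eventually_nhdsin_self[OF elim(3,5)]
            jets_controlled_implicit[OF elim(5) eventually_tame_cdiff[OF elim(2)] elim(3,4,1) P(2)]]) (simp add: P)
  qed
  then show "y \<in> stalks tame_sheaf"
    unfolding y germ_in_stalks_tame_sheaf using b by simp
qed

text \<open>Tameness is required at all base points near \<open>a\<close>: those with z n = a n need
  the shearing argument, at the others the divisor is a unit.\<close>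

lemma stable_monomial_division:
  assumes a: "a \<in> topspace (Cspace (Suc n))"
  shows "stable_under (monomial_division_operator n a) tame_sheaf"
  unfolding stable_under_def
proof (intro allI impI)
  fix xs y assume "(xs, y) \<in> monomial_division_operator n a" and xs: "set xs \<subseteq> stalks tame_sheaf"
  then obtain f h V where f: "xs = [germ (Suc n) a f]" and y: "y = germ (Suc n) a h"
    and zero: "\<forall>\<^sub>F z in nhdsin (Cspace n) (a(n := 0)). f (z(n := a n)) = 0"
    and h: "holomorphic_near (Suc n) a h"
    and V: "openin (Cspace (Suc n)) V" "a \<in> V" "\<forall>z\<in>V. z n \<noteq> a n \<longrightarrow> h z = f z / (z n - a n)"
    unfolding monomial_division_operator_def by auto
  have b: "a(n := 0) \<in> topspace (Cspace n)" using a by (auto simp: topspace_Cspace)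
  have tf: "\<forall>\<^sub>F z in nhdsin (Cspace (Suc n)) a. tame (Suc n) f z"
    using xs f germ_in_stalks_tame_sheaf by auto
  \<comment> \<open>The vanishing hypothesis concerns the first \<open>n\<close> coordinates only;
    it is pulled back to a neighbourhood of \<open>a\<close> along this projection.\<close>
  have lim: "filterlim (\<lambda>z. z(n := 0)) (nhdsin (Cspace n) (a(n := 0))) (nhdsin (Cspace (Suc n)) a)"
  proof (rule filterlim_Cspace[OF b])
    show "\<forall>\<^sub>F z in nhdsin (Cspace (Suc n)) a. z(n := 0) \<in> topspace (Cspace n)"
      using eventually_nhdsin_topspace by eventually_elim (auto simp: topspace_Cspace)
    show "((\<lambda>z. (z(n := 0)) i) \<longlongrightarrow> (a(n := 0)) i) (nhdsin (Cspace (Suc n)) a)" for i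
      using tendsto_coordinate[OF a, of i] by (cases "i = n") simp_all
  qed
  have "\<forall>\<^sub>F z in nhdsin (Cspace (Suc n)) a. z \<in> V"
    unfolding eventually_nhdsin using V by auto
  with eventually_compose_filterlim[OF zero lim]
  have fh: "\<forall>\<^sub>F z in nhdsin (Cspace (Suc n)) a. f z = (z n - a n) * h z"
  proof eventually_elim
    case (elim z)
    show ?case
    proof (cases "z n = a n")
      case True
      then have "z(n := 0, n := a n) = z" by auto
      then show ?thesis using elim True by simp
    next
      case False
      then show ?thesis using V(3) elim by simp
    qed
  qed
  have evh: "\<forall>\<^sub>F z in nhdsin (Cspace (Suc n)) a. cdiff (Suc n) h z"
    using h by (simp add: holomorphic_near_iff)
  from tf eventually_eventually_nhdsin[OF evh] eventually_eventually_nhdsin[OF fh] eventually_nhdsin_topspace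
  have "\<forall>\<^sub>F z in nhdsin (Cspace (Suc n)) a. tame (Suc n) h z"
  proof eventually_elim
    case (elim z)
    obtain P s where P: "finite P" "jets_controlled (Suc n) f z P s"
      using elim(1) by (auto simp: tame_def)
    note c = eventually_nhdsin_self[OF elim(2,4)]
    show ?case
    proof (cases "z n = a n")
      case True
      show ?thesis
        by (rule tameI[OF c jets_controlled_monomial_division[OF elim(2) _ P(2)] P(1)]) (use elim(3) True in simp)
    next
      case False
      show ?thesis
        by (rule tameI[OF c jets_controlled_quotient[OF elim(4) False elim(2,3) P(2)]]) (simp add: P)
    qed
  qed
  then show "y \<in> stalks tame_sheaf"
    unfolding y germ_in_stalks_tame_sheaf using a by simp
qed

lemma stable_finite_compositions:
  assumes "\<And>\<omega>. \<omega> \<in> \<Omega> \<Longrightarrow> stable_under \<omega> G" and "\<eta> \<in> finite_compositions \<Omega>"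
  shows "stable_under \<eta> G"
  using assms(2)
proof induction
  case (projection i k)
  then show ?case unfolding stable_under_def by auto
next
  case (compose \<omega> \<eta>s k)
  show ?case
    unfolding stable_under_def
  proof (intro allI impI)
    fix xs y
    assume "(xs, y) \<in> {(xs, y). length xs = k \<and> (\<exists>ys. list_all2 (\<lambda>\<eta> z. (xs, z) \<in> \<eta>) \<eta>s ys \<and> (ys, y) \<in> \<omega>)}"
      and xs: "set xs \<subseteq> stalks G"
    then obtain ys where ys: "list_all2 (\<lambda>\<eta> z. (xs, z) \<in> \<eta>) \<eta>s ys" "(ys, y) \<in> \<omega>" by auto
    have "z \<in> stalks G" if "z \<in> set ys" for z
    proof -
      obtain i where i: "i < length ys" "z = ys ! i" using \<open>z \<in> set ys\<close> by (auto simp: in_set_conv_nth)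
      then have z: "(xs, z) \<in> \<eta>s ! i" "\<eta>s ! i \<in> set \<eta>s" using ys(1) by (auto simp: list_all2_conv_all_nth)
      then have "stable_under (\<eta>s ! i) G" using compose.IH by auto
      then show ?thesis using xs z(1) unfolding stable_under_def by (elim allE[of _ xs] allE[of _ z] impE)
    qed
    then show "y \<in> stalks G"
      using assms(1)[OF compose.hyps(1)] ys(2) unfolding stable_under_def
      by (elim allE[of _ ys] allE[of _ y] impE) auto
  qed
qed

lemma tame_sheaf_stable_C_ops: "\<omega> \<in> C_ops K \<Longrightarrow> stable_under \<omega> tame_sheaf"
proof -
  have B: "stable_under \<omega> tame_sheaf" if "\<omega> \<in> B_ops K" for \<omega>
    using that unfolding B_ops_def
    by (rule stable_finite_compositions[rotated])
      (auto intro: stable_polynomial stable_schwarz stable_composition stable_derivative stable_implicit)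
  show "\<omega> \<in> C_ops K \<Longrightarrow> stable_under \<omega> tame_sheaf"
    unfolding C_ops_def
    by (erule stable_finite_compositions[rotated]) (auto intro: stable_monomial_division B)
qed

section \<open>The function cos (sqrt z)\<close>

definition cos_sqrt_fps :: "complex fps" where
  "cos_sqrt_fps = Abs_fps (\<lambda>k. fps_nth (fps_cos 1) (2 * k))"

definition cos_sqrt :: "complex \<Rightarrow> complex" where
  "cos_sqrt = eval_fps cos_sqrt_fps"

text \<open>The odd coefficients of cos vanish, so its series in w is a series in w^2; the function
  is thereby defined without choosing a square root.\<close>

lemma cos_sqrt_sums: "(\<lambda>k. fps_nth cos_sqrt_fps k * (w\<^sup>2) ^ k) sums cos w"
proof -
  have "(\<lambda>n. fps_nth (fps_cos 1) n * w ^ n) sums cos w"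
  proof -
    have "summable (\<lambda>n. fps_nth (fps_cos (1::complex)) n * w ^ n)" by (rule summable_fps) simp
    moreover have "(\<Sum>n. fps_nth (fps_cos (1::complex)) n * w ^ n) = cos w"
      using eval_fps_cos[of 1 w] by (simp add: eval_fps_def)
    ultimately show ?thesis by (simp add: sums_iff)
  qed
  then have "(\<lambda>k. fps_nth (fps_cos 1) (2 * k) * w ^ (2 * k)) sums cos w"
    by (subst sums_mono_reindex[of "\<lambda>k. 2 * k"]) (auto simp: strict_mono_def fps_cos_def elim: oddE)
  then show ?thesis
    by (simp add: cos_sqrt_fps_def power_mult)
qed

lemma fps_conv_radius_cos_sqrt: "fps_conv_radius cos_sqrt_fps = \<infinity>"
  unfolding fps_conv_radius_def
proof (rule conv_radius_inftyI'')
  fix z :: complex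
  show "summable (\<lambda>n. fps_nth cos_sqrt_fps n * z ^ n)"
    using cos_sqrt_sums[of "csqrt z"] by (simp add: sums_iff)
qed

lemma cos_sqrt_square: "cos_sqrt (w\<^sup>2) = cos w"
  using cos_sqrt_sums[of w] by (simp add: cos_sqrt_def eval_fps_def sums_iff)

lemma cos_sqrt_holomorphic: "cos_sqrt holomorphic_on S"
  unfolding cos_sqrt_def by (rule holomorphic_on_eval_fps) (simp add: fps_conv_radius_cos_sqrt)

text \<open>A prime \<open>p\<close> with \<open>N + s < p \<le> 2 N\<close> divides the denominator \<open>(2 N)!\<close> of the coefficient of
  \<open>t ^ N\<close>, but it may be chosen not to be invertible in the ring generated by \<open>P\<close> and \<open>1 / (N + s)!\<close>.\<close>

lemma cos_sqrt_not_tame: "\<not> tame 1 (\<lambda>z. cos_sqrt (z 0)) (\<lambda>_. 0)"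
proof
  assume "tame 1 (\<lambda>z. cos_sqrt (z 0)) (\<lambda>_. 0)"
  then obtain P s where P: "finite P" "jets_controlled 1 (\<lambda>z. cos_sqrt (z 0)) (\<lambda>_. 0) P s"
    by (auto simp: tame_def)
  obtain p R where p: "prime p" "p > 2 * s + 2" and R: "subring R" "P \<subseteq> R" "inverse (fact (p - 1)) \<in> R"
    and np: "inverse (of_nat p) \<notin> R"
    using subring_inverting_below_prime[OF P(1), of "2 * s + 2"] by auto
  \<comment> \<open>The least N with p \<le> 2 N; the bound p > 2 s + 2 is exactly what makes N + s
    \<le> p - 1.\<close>
  define N where "N = (p + 1) div 2"
  have N: "N + s \<le> p - 1" "p \<le> 2 * N" using p by (auto simp: N_def)
  \<comment> \<open>The test curve is the identity, along which the jet consists of the Taylor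
    coefficients at 0.\<close>
  have cu: "curve_at 1 (\<lambda>_. 0) (\<lambda>_ t. t) (\<lambda>_. fps_X)"
    by (auto simp: curve_at_def topspace_Cspace intro: has_fps_expansion_fps_X)
  have "(\<lambda>t. cos_sqrt (curve 1 (\<lambda>_ t. t) t 0)) has_fps_expansion cos_sqrt_fps"
    unfolding cos_sqrt_def using eval_fps_has_fps_expansion[of cos_sqrt_fps]
    by (simp add: cvec_of_nth fps_conv_radius_cos_sqrt)
  from jets_controlledD'[OF P(2) R N(1) cu _ this] R(1)
  have "cos_sqrt_fps \<in> jets_in R N" by (simp add: jets_in_X)
  then have "(-1) ^ N / fact (2 * N) \<in> R"
    by (auto dest!: jets_inD[where k = N] simp: cos_sqrt_fps_def fps_cos_def)
  from subring_mult[OF R(1) subring_power[OF R(1) subring_minus[OF R(1) subring_one[OF R(1)]], of N] this]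
  have "inverse (fact (2 * N)) \<in> R"
    by (simp add: divide_inverse flip: power_mult_distrib)
  then have "inverse (of_nat p) \<in> R"
    using N(2) p by (intro inverse_of_nat_mem[OF R(1)]) auto
  then show False using np by simp
qed

lemma tame_cos: "b \<in> topspace (Cspace 1) \<Longrightarrow> tame 1 (\<lambda>z. cos (z 0)) b"
  by (rule tameI[OF cdiff_one_variable jets_controlled_cos])
    (auto intro: field_differentiable_at_cos)

section \<open>The square root by deramification\<close>

lemma sheaf_generated_superset: "F \<le> sheaf_generated F"
  unfolding sheaf_generated_def by (rule Inf_greatest) simp

lemma sheaf_generated_least: "is_sheaf G \<Longrightarrow> F \<le> G \<Longrightarrow> sheaf_generated F \<le> G"
  unfolding sheaf_generated_def by (rule Inf_lower) simp

lemma smallest_stable_sheaf_least: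
  "is_sheaf G \<Longrightarrow> A \<le> G \<Longrightarrow> (\<And>\<omega>. \<omega> \<in> \<Omega> \<Longrightarrow> stable_under \<omega> G) \<Longrightarrow> smallest_stable_sheaf \<Omega> A \<le> G"
  unfolding smallest_stable_sheaf_def by (rule Inf_lower) simp

lemma mem_Inf_family: "h \<in> (Inf S :: family) n U \<longleftrightarrow> (\<forall>G\<in>S. h \<in> G n U)"
  by (simp add: Inf_fun_def)

lemma family_leD: "F \<le> (G :: family) \<Longrightarrow> h \<in> F n U \<Longrightarrow> h \<in> G n U"
  by (meson le_funD subsetD)

lemma stalk_mono: "F \<le> G \<Longrightarrow> stalk F n a \<subseteq> stalk G n a"
proof
  fix y assume FG: "F \<le> G" and "y \<in> stalk F n a"
  then obtain h U where "y = germ n a h" "a \<in> U" "h \<in> F n U"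
    unfolding stalk_def by auto
  then show "y \<in> stalk G n a"
    unfolding stalk_def using family_leD[OF FG, of h n U] by (intro CollectI exI[of _ h] exI[of _ U]) simp
qed

lemma stalks_mono: "F \<le> G \<Longrightarrow> stalks F \<subseteq> stalks G"
  unfolding stalks_def using stalk_mono[of F G] by fastforce

text \<open>Stability is given for composites, whose argument lists have a fixed length. On lists of
  length \<open>length xs\<close> the operator agrees with its composite with the projections.
  Repeated use descends from \<open>D_ops\<close> to the generating operators.\<close>

lemma stable_under_basic:
  assumes st: "\<And>\<eta>. \<eta> \<in> finite_compositions \<Omega> \<Longrightarrow> stable_under \<eta> G" and \<omega>: "\<omega> \<in> \<Omega>"
  shows "stable_under \<omega> G"
  unfolding stable_under_def
proof (intro allI impI)
  fix xs y assume xy: "(xs, y) \<in> \<omega>" and xs: "set xs \<subseteq> stalks G"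
  let ?k = "length xs"
  let ?\<eta>s = "map (\<lambda>i. {(xs, xs ! i) | xs :: germ list. length xs = ?k}) [0..<?k]"
  let ?\<eta> = "{(us, y). length us = ?k \<and> (\<exists>ys. list_all2 (\<lambda>\<eta> z. (us, z) \<in> \<eta>) ?\<eta>s ys \<and> (ys, y) \<in> \<omega>)}"
  have "?\<eta> \<in> finite_compositions \<Omega>"
    by (rule finite_compositions.compose[OF \<omega>]) (auto intro: finite_compositions.projection)
  then have "stable_under ?\<eta> G" by (rule st)
  moreover have "list_all2 (\<lambda>\<eta> z. (xs, z) \<in> \<eta>) ?\<eta>s xs"
    by (auto simp: list_all2_conv_all_nth)
  then have "(xs, y) \<in> ?\<eta>" using xy by auto
  ultimately show "y \<in> stalks G"
    using xs unfolding stable_under_def by (elim allE[of _ xs] allE[of _ y] impE)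
qed

section \<open>Germs in one variable and the sheaf generated by cos\<close>

lemma domain1_UNIV: "domain1 UNIV = topspace (Cspace 1)"
  by (simp add: domain1_def)

lemma openin_domain1: "open V \<Longrightarrow> openin (Cspace 1) (domain1 V)"
proof -
  assume "open V"
  then have "open ((\<lambda>z :: cvec. z 0) -` V)"
    by (intro open_vimage continuous_on_product_coordinates)
  moreover have "domain1 V = topspace (Cspace 1) \<inter> (\<lambda>z. z 0) -` V"
    by (auto simp: domain1_def)
  ultimately show ?thesis
    unfolding Cspace_def by (auto simp: openin_open)
qed

lemma germ1_eq: "open V \<Longrightarrow> 0 \<in> V \<Longrightarrow> germ1 V f = germ 1 (\<lambda>_. 0) (\<lambda>z. f (z 0))"
  unfolding germ1_def function1_def
  by (intro germ_eqI eventually_restrict_eq openin_domain1) (auto simp: domain1_def topspace_Cspace)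

definition cos_family :: family where
  "cos_family = sheaf_generated (singleton_family 1 (domain1 UNIV) (function1 UNIV cos))"

lemma cos_in_cos_family: "function1 UNIV cos \<in> cos_family 1 (domain1 UNIV)"
proof -
  have "restrict (function1 UNIV cos) (domain1 UNIV) = function1 UNIV cos"
    by (simp add: function1_def)
  then have "function1 UNIV cos \<in> singleton_family 1 (domain1 UNIV) (function1 UNIV cos) 1 (domain1 UNIV)"
    by (simp add: singleton_family_def)
  then show ?thesis
    unfolding cos_family_def by (rule family_leD[OF sheaf_generated_superset])
qed

lemma cos_family_le_tame_sheaf: "cos_family \<le> tame_sheaf"
  unfolding cos_family_def
proof (rule sheaf_generated_least[OF is_sheaf_tame_sheaf], intro le_funI subsetI)
  fix n U h assume "h \<in> singleton_family 1 (domain1 UNIV) (function1 UNIV cos) n U"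
  then have nU: "n = 1" "U = domain1 UNIV" and h: "h = restrict (\<lambda>z. cos (z 0)) (domain1 UNIV)"
    by (auto simp: singleton_family_def function1_def split: if_splits)
  have op: "openin (Cspace 1) (domain1 UNIV)" by (rule openin_domain1) simp
  have "tame 1 h z" if "z \<in> domain1 UNIV" for z
  proof (rule tame_cong)
    show "\<forall>\<^sub>F x in nhdsin (Cspace 1) z. cos (x 0) = h x"
      using eventually_restrict_eq[OF op that, of "\<lambda>z. cos (z 0)"] by (simp add: h eq_commute)
    show "tame 1 (\<lambda>z. cos (z 0)) z" using that by (intro tame_cos) (simp add: domain1_UNIV)
  qed
  then show "h \<in> tame_sheaf n U"
    unfolding tame_sheaf_def nU using op by (auto simp: h)
qed

lemma C_sheaf_le_tame_sheaf: "C_sheaf K cos_family \<le> tame_sheaf"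
  unfolding C_sheaf_def
  by (rule smallest_stable_sheaf_least[OF is_sheaf_tame_sheaf cos_family_le_tame_sheaf tame_sheaf_stable_C_ops])

lemma germ1_cos_sqrt_not_tame: "open V \<Longrightarrow> 0 \<in> V \<Longrightarrow> germ1 V cos_sqrt \<notin> stalks tame_sheaf"
proof
  assume "open V" "0 \<in> V" "germ1 V cos_sqrt \<in> stalks tame_sheaf"
  then have "\<forall>\<^sub>F z in nhdsin (Cspace 1) (\<lambda>_. 0). tame 1 (\<lambda>z. cos_sqrt (z 0)) z"
    by (simp add: germ1_eq germ_in_stalks_tame_sheaf)
  then have "tame 1 (\<lambda>z. cos_sqrt (z 0)) (\<lambda>_. 0)"
    by (rule eventually_nhdsin_self) (simp add: topspace_Cspace)
  then show False using cos_sqrt_not_tame by simp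
qed

lemma cos_sqrt_eq: "cos_sqrt z = cos (csqrt z)"
  using cos_sqrt_square[of "csqrt z"] by simp

lemma holomorphic_near_cos: "a \<in> topspace (Cspace 1) \<Longrightarrow> holomorphic_near 1 a (\<lambda>z. cos (z 0))"
  unfolding holomorphic_near_iff using eventually_nhdsin_topspace[of "Cspace 1" a] tame_cos
  by (auto simp: tame_def elim: eventually_mono)

text \<open>Evenness of cos is the invariance under the second root of unity -1, and the principal
  root in the operator is \<open>csqrt\<close>.\<close>

lemma germ_cos_sqrt_by_deramification:
  assumes st: "stable_under (deramification_operator 2 0 (\<lambda>_. 0)) G"
    and g: "germ 1 (\<lambda>_. 0) (\<lambda>z. cos (z 0)) \<in> stalks G"
  shows "germ 1 (\<lambda>_. 0) (\<lambda>z. cos_sqrt (z 0)) \<in> stalks G"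
proof -
  let ?f = "\<lambda>z :: cvec. cos (z 0)" and ?a = "\<lambda>_ :: nat. 0 :: complex"
  have "exp (2 * \<i> * of_real pi / of_nat 2) = -1"
    using exp_pi_i by (simp add: mult.commute)
  then have "(\<lambda>z. ?f (z(0 := ?a 0 + (z 0 - ?a 0) powr (1 / of_nat 2)))) = (\<lambda>z. cos_sqrt (z 0))"
    and "\<forall>\<^sub>F z in nhdsin (Cspace (Suc 0)) ?a. ?f z = ?f (z(0 := ?a 0 + exp (2 * \<i> * of_real pi / of_nat 2) * (z 0 - ?a 0)))"
    by (simp_all add: cos_sqrt_eq csqrt_conv_powr)
  moreover have "holomorphic_near (Suc 0) ?a ?f"
    using holomorphic_near_cos[of ?a] by (simp add: topspace_Cspace)
  ultimately have "([germ (Suc 0) ?a ?f], germ (Suc 0) ?a (\<lambda>z. cos_sqrt (z 0))) \<in> deramification_operator 2 0 ?a"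
    unfolding deramification_operator_def by (intro CollectI exI[of _ ?f]) simp
  then show ?thesis
    using st g unfolding stable_under_def
    by (elim allE[of _ "[germ (Suc 0) ?a ?f]"] allE[of _ "germ (Suc 0) ?a (\<lambda>z. cos_sqrt (z 0))"] impE) simp_all
qed

text \<open>Away from 0 a branch of the square root solves z 1 ^ 2 - z 0 = 0 for z 1. The
  coefficients are 1 and -1, so both choices of coefficient set are covered.\<close>

lemma germ_sqrt_by_implicit:
  assumes poly: "\<And>a p. a \<in> topspace (Cspace 2) \<Longrightarrow> polynomial_function {1, -1} 2 p \<Longrightarrow> germ 2 a p \<in> stalks G"
    and st: "\<And>a. a \<in> topspace (Cspace 2) \<Longrightarrow> stable_under (implicit_operator 1 a) G"
    and b: "b \<in> topspace (Cspace 1)" "b 0 \<noteq> 0"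
  obtains \<phi> where "germ 1 b \<phi> \<in> stalks G" "holomorphic_near 1 b \<phi>" "\<And>z. (\<phi> z)\<^sup>2 = z 0"
proof -
  define w where "w = csqrt (b 0)"
  have w: "w \<noteq> 0" "w\<^sup>2 = b 0" using b by (auto simp: w_def)
  define a where "a = b(1 := w)"
  have a: "a \<in> topspace (Cspace 2)" "a(1 := 0) = b" using b by (auto simp: a_def topspace_Cspace)
  define F where "F z = z 1 ^ 2 - z 0" for z :: cvec
  \<comment> \<open>Dividing by w^2 = b 0 moves the argument of \<open>csqrt\<close> close to 1,
    away from its cut, and gives \<phi> the value w at b.\<close>
  define \<phi> where "\<phi> z = w * csqrt (z 0 / w\<^sup>2)" for z :: cvec
  have \<phi>2: "(\<phi> z)\<^sup>2 = z 0" for z using w(1) by (simp add: \<phi>_def power_mult_distrib)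
  have F: "polynomial_function {1, -1} 2 F"
    unfolding polynomial_function_def
  proof (intro exI conjI)
    let ?\<alpha> = "(\<lambda>i. 0)(1 := 2) :: nat \<Rightarrow> nat" and ?\<beta> = "(\<lambda>i. 0)(0 := 1) :: nat \<Rightarrow> nat"
    have ne: "?\<alpha> \<noteq> ?\<beta>" by (auto dest: fun_cong[of _ _ 1])
    show "finite {?\<alpha>, ?\<beta>}" by simp
    show "\<forall>\<alpha>\<in>{?\<alpha>, ?\<beta>}. (if \<alpha> = ?\<alpha> then 1 else -1) \<in> {1, -1 :: complex}" by simp
    show "F = (\<lambda>z. \<Sum>\<alpha>\<in>{?\<alpha>, ?\<beta>}. (if \<alpha> = ?\<alpha> then 1 else -1) * (\<Prod>i<2. z i ^ \<alpha> i))"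
      using ne by (auto simp: F_def fun_eq_iff numeral_2_eq_2)
  qed
  have Fa: "holomorphic_near 2 a F"
    unfolding holomorphic_near_iff using a(1) cdiff_polynomial[OF _ F] eventually_nhdsin_topspace[of "Cspace 2" a]
    by (auto elim: eventually_mono)
  have "((\<lambda>z. Re (z 0 / w\<^sup>2)) \<longlongrightarrow> Re (b 0 / w\<^sup>2)) (nhdsin (Cspace 1) b)"
    by (intro tendsto_intros tendsto_coordinate b(1)) (use w(1) in simp)
  then have "\<forall>\<^sub>F z in nhdsin (Cspace 1) b. Re (z 0 / w\<^sup>2) > 0"
    using w b by (intro order_tendstoD(1)) auto
  with eventually_nhdsin_topspace have "\<forall>\<^sub>F z in nhdsin (Cspace 1) b. cdiff 1 \<phi> z"
  proof eventually_elim
    case (elim z)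
    have "z 0 / w\<^sup>2 \<notin> \<real>\<^sub>\<le>\<^sub>0" using elim(2) by (auto simp: complex_nonpos_Reals_iff)
    then have "csqrt field_differentiable at (z 0 / w\<^sup>2)" by (rule field_differentiable_at_csqrt)
    moreover have "(\<lambda>x. x / w\<^sup>2) field_differentiable at (z 0)"
      unfolding divide_inverse by (intro field_differentiable_mult field_differentiable_ident field_differentiable_const)
    ultimately have "csqrt \<circ> (\<lambda>x. x / w\<^sup>2) field_differentiable at (z 0)"
      by (intro field_differentiable_compose)
    then have "(\<lambda>x. w * csqrt (x / w\<^sup>2)) field_differentiable at (z 0)"
      unfolding o_def by (intro field_differentiable_mult field_differentiable_const)
    then show ?case unfolding \<phi>_def[abs_def] by (rule cdiff_one_variable[OF elim(1)])
  qed
  then have \<phi>: "holomorphic_near 1 b \<phi>"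
    unfolding holomorphic_near_iff using b by simp
  have "((\<lambda>y. F (a(1 := y))) has_field_derivative 2 * w) (at w)"
    unfolding F_def by (auto intro!: derivative_eq_intros)
  then have d: "deriv (\<lambda>y. F (a(1 := y))) (a 1) \<noteq> 0"
    using w(1) by (simp add: DERIV_imp_deriv a_def)
  have "([germ (Suc 1) a F], germ 1 b \<phi>) \<in> implicit_operator 1 a"
    unfolding implicit_operator_def
  proof (rule CollectI, rule exI[of _ F], rule exI[of _ \<phi>], intro conjI)
    show "\<forall>\<^sub>F z in nhdsin (Cspace 1) (a(1 := 0)). F (z(1 := \<phi> z)) = 0"
      by (simp add: F_def \<phi>2)
    show "\<phi> (a(1 := 0)) = a 1" using w b unfolding a by (simp add: \<phi>_def a_def)
    show "F a = 0" using w by (simp add: F_def a_def)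
  qed (use Fa \<phi> d in \<open>simp_all add: a(2)[unfolded One_nat_def] numeral_2_eq_2\<close>)
  then have "germ 1 b \<phi> \<in> stalks G"
    using st[OF a(1)] poly[OF a(1) F] unfolding stable_under_def
    by (elim allE[of _ "[germ (Suc 1) a F]"] allE[of _ "germ 1 b \<phi>"] impE) (simp_all add: numeral_2_eq_2)
  then show thesis using \<phi> \<phi>2 by (rule that)
qed

lemma polynomial_function_mono:
  assumes "K \<subseteq> L" "polynomial_function K n p"
  shows "polynomial_function L n p"
proof -
  obtain S c where "finite (S :: (nat \<Rightarrow> nat) set)" "\<forall>\<alpha>\<in>S. c \<alpha> \<in> K" "p = (\<lambda>z. \<Sum>\<alpha>\<in>S. c \<alpha> * (\<Prod>i<n. z i ^ \<alpha> i))"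
    using assms(2) unfolding polynomial_function_def by (elim exE conjE)
  then show ?thesis
    unfolding polynomial_function_def using assms(1) by (intro exI[of _ S] exI[of _ c]) auto
qed

text \<open>The smallest stable sheaf is an intersection, and a germ lying in a stalk of each member
  could be represented on neighbourhoods that shrink from member to member. A section over one fixed
  domain is therefore built in every stable sheaf, by gluing local sections over the whole plane: at
  0 by deramification, elsewhere by composing cos with a branch of the square root.\<close>

lemma cos_sqrt_in_D_sheaf:
  assumes K: "{1, -1} \<subseteq> K"
  shows "function1 UNIV cos_sqrt \<in> D_sheaf K cos_family 1 (domain1 UNIV)"
  unfolding D_sheaf_def smallest_stable_sheaf_def mem_Inf_family
proof (intro ballI, elim CollectE conjE)
  fix G assume G: "is_sheaf G" "cos_family \<le> G" and stable: "\<forall>\<omega>\<in>D_ops K. stable_under \<omega> G"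
  have D: "stable_under \<omega> G"
    if "\<omega> \<in> {deramification_operator m n a | m n a. m \<ge> 1 \<and> a \<in> topspace (Cspace (Suc n))} \<union> C_ops K" for \<omega>
    by (rule stable_under_basic[OF _ that]) (rule stable[unfolded D_ops_def, rule_format])
  have C: "stable_under \<omega> G"
    if "\<omega> \<in> {monomial_division_operator n a | n a. a \<in> topspace (Cspace (Suc n))} \<union> B_ops K" for \<omega>
    by (rule stable_under_basic[OF D that]) (simp add: C_ops_def)
  have B: "stable_under \<omega> G"
    if "\<omega> \<in> polynomial_operators K \<union>
      {schwarz_operator n a | n a. a \<in> topspace (Cspace n)} \<union>
      {composition_operator n a m b | n a m b. a \<in> topspace (Cspace n) \<and> b \<in> topspace (Cspace m)} \<union>
      {derivative_operator n a j | n a j. a \<in> topspace (Cspace n) \<and> j < n} \<union>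
      {implicit_operator n a | n a. a \<in> topspace (Cspace (Suc n))}" for \<omega>
    by (rule stable_under_basic[OF C that]) (simp add: B_ops_def)
  have cos: "germ 1 b (\<lambda>z. cos (z 0)) \<in> stalks G" if b: "b \<in> topspace (Cspace 1)" for b
  proof -
    have bd: "b \<in> domain1 UNIV" using b by (simp add: domain1_UNIV)
    have "germ 1 b (function1 UNIV cos) \<in> stalks G"
      using bd family_leD[OF G(2) cos_in_cos_family] by (rule germ_in_stalks)
    moreover have "germ 1 b (function1 UNIV cos) = germ 1 b (\<lambda>z. cos (z 0))"
      unfolding function1_def using bd by (intro germ_eqI eventually_restrict_eq openin_domain1) auto
    ultimately show ?thesis by simp
  qed
  have germ: "germ 1 b (\<lambda>z. cos_sqrt (z 0)) \<in> stalks G" if b: "b \<in> topspace (Cspace 1)" for b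
  proof (cases "b 0 = 0")
    case True
    have "b i = 0" for i
      using b True by (cases "i = 0") (simp_all add: topspace_Cspace)
    then have b0: "b = (\<lambda>_. 0)" by (rule ext)
    have z: "(\<lambda>_. 0) \<in> topspace (Cspace n)" for n by (simp add: topspace_Cspace)
    have "stable_under (deramification_operator 2 0 (\<lambda>_. 0)) G"
      by (rule D, rule UnI1, rule CollectI, rule exI[of _ 2], rule exI[of _ 0], rule exI[of _ "\<lambda>_. 0"])
        (simp add: z)
    then show ?thesis unfolding b0 by (rule germ_cos_sqrt_by_deramification[OF _ cos[OF z]])
  next
    case False
    have poly: "germ 2 a p \<in> stalks G" if a: "a \<in> topspace (Cspace 2)" and p: "polynomial_function {1, -1} 2 p" for a p
    proof -
      have "polynomial_function K 2 p"
        using polynomial_function_mono[OF K p] .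
      then have "{([], germ 2 a p)} \<in> polynomial_operators K"
        unfolding polynomial_operators_def using a by (intro CollectI exI[of _ "2::nat"] exI[of _ a] exI[of _ p]) simp
      then have "stable_under {([], germ 2 a p)} G" by (intro B UnI1)
      then show ?thesis unfolding stable_under_def by simp
    qed
    have imp: "stable_under (implicit_operator 1 a) G" if "a \<in> topspace (Cspace 2)" for a
      by (rule B, rule UnI2, rule CollectI, rule exI[of _ 1], rule exI[of _ a]) (use that in \<open>simp add: numeral_2_eq_2\<close>)
    obtain \<phi> where \<phi>: "germ 1 b \<phi> \<in> stalks G" "holomorphic_near 1 b \<phi>" "\<And>z. (\<phi> z)\<^sup>2 = z 0"
      using germ_sqrt_by_implicit[OF poly imp b False] by metis
    define a where "a = cvec_of 1 (\<lambda>_. \<phi> b)"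
    have a: "a \<in> topspace (Cspace 1)" "a 0 = \<phi> b" by (simp_all add: a_def cvec_of_nth)
    let ?xs = "germ 1 a (\<lambda>z. cos (z 0)) # map (\<lambda>i. germ 1 b \<phi>) [0..<1]"
    let ?y = "germ 1 b (\<lambda>z. cos ((\<lambda>i. if i < 1 then \<phi> z else 0) (0::nat)))"
    have "(?xs, ?y) \<in> composition_operator 1 a 1 b"
      unfolding composition_operator_def
    proof (rule CollectI, rule exI[of _ "\<lambda>z. cos (z 0)"], rule exI[of _ "\<lambda>_. \<phi>"], intro conjI refl allI impI)
      show "\<phi> b = a i" if "i < 1" for i using that a by simp
    qed (use holomorphic_near_cos[OF a(1)] \<phi> in auto)
    moreover have "stable_under (composition_operator 1 a 1 b) G"
      by (rule B, rule UnI1, rule UnI1, rule UnI2, rule CollectI, rule exI[of _ 1], rule exI[of _ a],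
          rule exI[of _ 1], rule exI[of _ b]) (use a b in simp)
    moreover have "set ?xs \<subseteq> stalks G" using \<phi>(1) cos[OF a(1)] by simp
    ultimately have "?y \<in> stalks G"
      unfolding stable_under_def by (elim allE[of _ ?xs] allE[of _ ?y] impE)
    moreover have "cos (\<phi> z) = cos_sqrt (z 0)" for z
      using cos_sqrt_square[of "\<phi> z"] \<phi>(3)[of z] by simp
    ultimately show ?thesis by simp
  qed
  have "\<exists>V. openin (Cspace 1) V \<and> b \<in> V \<and> V \<subseteq> domain1 UNIV \<and> restrict (function1 UNIV cos_sqrt) V \<in> G 1 V"
    if b: "b \<in> topspace (Cspace 1)" for b
  proof -
    obtain h U where U: "b \<in> U" "h \<in> G 1 U" and ev: "\<forall>\<^sub>F z in nhdsin (Cspace 1) b. cos_sqrt (z 0) = h z"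
      using germ[OF b] by (rule germ_in_stalksE)
    have opU: "openin (Cspace 1) U"
      using G(1) U(2) unfolding is_sheaf_def holomorphic_Cn_def by auto
    obtain S where S: "openin (Cspace 1) S" "b \<in> S" "\<forall>z\<in>S. cos_sqrt (z 0) = h z"
      using ev b unfolding eventually_nhdsin by auto
    have V: "openin (Cspace 1) (U \<inter> S)" using opU S(1) by (rule openin_Int)
    then have sub: "U \<inter> S \<subseteq> domain1 UNIV" unfolding domain1_UNIV by (rule openin_subset)
    have "restrict h (U \<inter> S) \<in> G 1 (U \<inter> S)"
      using G(1) U(2) V unfolding is_sheaf_def by auto
    moreover have "restrict h (U \<inter> S) = restrict (function1 UNIV cos_sqrt) (U \<inter> S)"
      using S(3) sub by (intro restrict_ext) (auto simp: function1_def)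
    ultimately show ?thesis using V U(1) S(2) sub by (intro exI[of _ "U \<inter> S"]) simp
  qed
  note loc = this
  \<comment> \<open>All open sets over which the function is already known to be a section; by the
    preceding local statement they cover the plane.\<close>
  let ?\<V> = "{V. openin (Cspace 1) V \<and> V \<subseteq> domain1 UNIV \<and> restrict (function1 UNIV cos_sqrt) V \<in> G 1 V}"
  have U: "\<Union>?\<V> = domain1 UNIV"
  proof
    show "domain1 UNIV \<subseteq> \<Union>?\<V>"
    proof
      fix b assume "b \<in> domain1 UNIV"
      then have "b \<in> topspace (Cspace 1)" by (simp only: domain1_UNIV)
      from loc[OF this] obtain V where "openin (Cspace 1) V" "b \<in> V" "V \<subseteq> domain1 UNIV"
        "restrict (function1 UNIV cos_sqrt) V \<in> G 1 V"
        by (elim exE conjE)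
      then show "b \<in> \<Union>?\<V>" by (intro UnionI[of V]) simp_all
    qed
  qed auto
  have "function1 UNIV cos_sqrt \<in> G 1 (\<Union>?\<V>)"
    by (rule G(1)[unfolded is_sheaf_def, THEN conjunct2, THEN conjunct2, rule_format])
      (simp, simp only: U, simp add: function1_def)
  then show "function1 UNIV cos_sqrt \<in> G 1 (domain1 UNIV)" unfolding U .
qed

section \<open>Definability and conclusion\<close>

primrec nat_term :: "nat \<Rightarrow> rterm" where
  "nat_term 0 = Zero"
| "nat_term (Suc k) = Plus (nat_term k) One"

lemma nat_term_value [simp]: "rterm_value e (nat_term k) = real k"
  by (induction k) simp_all

lemma nat_term_vars [simp]: "rterm_vars (nat_term k) = {}"
  by (induction k) simp_all

text \<open>The language has no subtraction, so the numerator is a difference of natural numbers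
  whose second term can be moved across an inequality.\<close>

lemma rat_as_nat_quotient:
  assumes "q \<in> \<rat>"
  obtains b m k :: nat where "b > 0" "q = (real m - real k) / real b"
proof -
  obtain i b :: int where "b > 0" "q = of_int i / of_int b"
    using assms by (rule Rats_cases') auto
  then show thesis
    by (intro that[of "nat b" "nat i" "nat (- i)"]) (auto simp: of_nat_nat)
qed

lemma formula_less_rat:
  assumes "q \<in> \<rat>"
  obtains \<phi> :: "'s fmla" where "set_fmla \<phi> = {}" "free_vars \<phi> \<subseteq> {x}" "\<And>I e. satisfies I e \<phi> \<longleftrightarrow> e x < q"
proof -
  obtain b m k :: nat where q: "b > 0" "q = (real m - real k) / real b"
    using assms by (rule rat_as_nat_quotient)
  show thesis
    by (rule that[of "Less (Plus (Times (nat_term b) (Var x)) (nat_term k)) (nat_term m)"])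
      (use q(1) in \<open>simp_all add: q(2) pos_less_divide_eq less_diff_eq mult.commute\<close>)
qed

lemma formula_greater_rat:
  assumes "q \<in> \<rat>"
  obtains \<phi> :: "'s fmla" where "set_fmla \<phi> = {}" "free_vars \<phi> \<subseteq> {x}" "\<And>I e. satisfies I e \<phi> \<longleftrightarrow> q < e x"
proof -
  obtain b m k :: nat where q: "b > 0" "q = (real m - real k) / real b"
    using assms by (rule rat_as_nat_quotient)
  show thesis
    by (rule that[of "Less (nat_term m) (Plus (Times (nat_term b) (Var x)) (nat_term k))"])
      (use q(1) in \<open>simp_all add: q(2) pos_divide_less_eq diff_less_eq mult.commute\<close>)
qed

lemma formula_gaussian_box:
  assumes "l \<in> gaussian_rationals" "u \<in> gaussian_rationals"
  obtains \<phi> :: "'s fmla" where "set_fmla \<phi> = {}" "free_vars \<phi> \<subseteq> {x, y}"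
    "\<And>I e. satisfies I e \<phi> \<longleftrightarrow> Complex (e x) (e y) \<in> box l u"
proof -
  have q: "Re l \<in> \<rat>" "Im l \<in> \<rat>" "Re u \<in> \<rat>" "Im u \<in> \<rat>"
    using assms by (auto simp: gaussian_rationals_def)
  obtain A :: "'s fmla" where A: "set_fmla A = {}" "free_vars A \<subseteq> {x}" "\<And>I e. satisfies I e A \<longleftrightarrow> Re l < e x"
    using formula_greater_rat[OF q(1)] by metis
  obtain B :: "'s fmla" where B: "set_fmla B = {}" "free_vars B \<subseteq> {y}" "\<And>I e. satisfies I e B \<longleftrightarrow> Im l < e y"
    using formula_greater_rat[OF q(2)] by metis
  obtain C :: "'s fmla" where C: "set_fmla C = {}" "free_vars C \<subseteq> {x}" "\<And>I e. satisfies I e C \<longleftrightarrow> e x < Re u"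
    using formula_less_rat[OF q(3)] by metis
  obtain D :: "'s fmla" where D: "set_fmla D = {}" "free_vars D \<subseteq> {y}" "\<And>I e. satisfies I e D \<longleftrightarrow> e y < Im u"
    using formula_less_rat[OF q(4)] by metis
  show thesis
    by (rule that[of "Conj (Conj A C) (Conj B D)"]) (use A B C D in \<open>auto simp: in_box_complex_iff\<close>)
qed

lemma relatively_compact_gaussian_box:
  assumes "\<Delta> = {z \<in> topspace (Cspace 1). \<forall>i<1. z i \<in> box (l i) (u i)}"
  shows "relatively_compact_in \<Delta> (domain1 UNIV)"
proof -
  let ?e = "\<lambda>c :: complex. \<lambda>i :: nat. if i = 0 then c else 0"
  have "continuous_on (cbox (l 0) (u 0)) ?e"
  proof (rule continuous_on_coordinatewise_then_product)
    show "continuous_on (cbox (l 0) (u 0)) (\<lambda>c. if i = 0 then c else 0)" for i :: nat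
      by (cases "i = 0") (auto intro: continuous_intros)
  qed
  then have K: "compact (?e ` cbox (l 0) (u 0))"
    by (rule compact_continuous_image) (rule compact_cbox)
  have "\<Delta> \<subseteq> ?e ` cbox (l 0) (u 0)"
  proof
    fix z assume "z \<in> \<Delta>"
    then have "z = ?e (z 0)" "z 0 \<in> cbox (l 0) (u 0)"
      using box_subset_cbox by (auto simp: assms topspace_Cspace fun_eq_iff)
    then show "z \<in> ?e ` cbox (l 0) (u 0)" by (rule image_eqI)
  qed
  then have cl: "closure \<Delta> \<subseteq> ?e ` cbox (l 0) (u 0)"
    using compact_imp_closed[OF K] by (rule closure_minimal)
  moreover have "?e ` cbox (l 0) (u 0) \<subseteq> domain1 UNIV"
    by (auto simp: domain1_UNIV topspace_Cspace)
  moreover have "compact (closure \<Delta>)"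
    using compact_Int_closed[OF K closed_closure, of \<Delta>] cl by (simp add: Int_absorb1)
  ultimately show ?thesis
    unfolding relatively_compact_in_def by simp
qed

lemma real_graph_dim_1:
  assumes "\<Delta> = {z \<in> topspace (Cspace 1). \<forall>i<1. z i \<in> box (l i) (u i)}"
  shows "real_graph (1, \<Delta>, restrict (function1 UNIV h) \<Delta>) =
    {[Re \<zeta>, Im \<zeta>, Re (h \<zeta>), Im (h \<zeta>)] | \<zeta>. \<zeta> \<in> box (l 0) (u 0)}"
proof -
  have v: "restrict (function1 UNIV h) \<Delta> z = h (z 0)" if "z \<in> \<Delta>" for z
    using that by (simp add: assms function1_def domain1_UNIV)
  show ?thesis
  proof (intro subset_antisym subsetI)
    fix t assume "t \<in> real_graph (1, \<Delta>, restrict (function1 UNIV h) \<Delta>)"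
    then obtain z where "z \<in> \<Delta>" "t = [Re (z 0), Im (z 0), Re (h (z 0)), Im (h (z 0))]"
      using v by auto
    then show "t \<in> {[Re \<zeta>, Im \<zeta>, Re (h \<zeta>), Im (h \<zeta>)] | \<zeta>. \<zeta> \<in> box (l 0) (u 0)}"
      by (auto simp: assms)
  next
    fix t assume "t \<in> {[Re \<zeta>, Im \<zeta>, Re (h \<zeta>), Im (h \<zeta>)] | \<zeta>. \<zeta> \<in> box (l 0) (u 0)}"
    then obtain \<zeta> where \<zeta>: "\<zeta> \<in> box (l 0) (u 0)" "t = [Re \<zeta>, Im \<zeta>, Re (h \<zeta>), Im (h \<zeta>)]" by auto
    define z where "z = cvec_of 1 (\<lambda>_. \<zeta>)"
    have z: "z \<in> \<Delta>" "z 0 = \<zeta>" using \<zeta> by (simp_all add: assms z_def cvec_of_nth)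
    show "t \<in> real_graph (1, \<Delta>, restrict (function1 UNIV h) \<Delta>)"
      using v[OF z(1)] z \<zeta>(2) by (auto intro!: exI[of _ z])
  qed
qed

text \<open>The value at \<zeta> is cos w for either root w of \<zeta>, so an existential quantifier
  over roots defines a function. One box for cos then has to be large enough to contain a root of
  every point of the given box.\<close>

lemma cos_sqrt_locally_definable:
  "locally_zero_definable cos_family 1 (domain1 UNIV) (function1 UNIV cos_sqrt)"
  unfolding locally_zero_definable_def
proof
  fix r assume "r \<in> proper_restrictions 1 (domain1 UNIV) (function1 UNIV cos_sqrt)"
  then obtain \<Delta> where r: "r = (1, \<Delta>, restrict (function1 UNIV cos_sqrt) \<Delta>)" and "gaussian_box 1 \<Delta>"
    unfolding proper_restrictions_def by auto
  then obtain l u where lu: "l 0 \<in> gaussian_rationals" "u 0 \<in> gaussian_rationals"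
    and \<Delta>: "\<Delta> = {z \<in> topspace (Cspace 1). \<forall>i<1. z i \<in> box (l i) (u i)}"
    unfolding gaussian_box_def by auto
  \<comment> \<open>On the box |Re| + |Im| is at most B. Since B + 1 < M forces M > 1, a root w of a
    point of the box satisfies |w|^2 \<le> B < M \<le> M^2.\<close>
  define B where "B = \<bar>Re (l 0)\<bar> + \<bar>Re (u 0)\<bar> + \<bar>Im (l 0)\<bar> + \<bar>Im (u 0)\<bar>"
  obtain M :: nat where M: "B + 1 < real M" using reals_Archimedean2 by auto
  define L where "L = Complex (- real M) (- real M)"
  define V where "V = Complex (real M) (real M)"
  define \<Delta>' where "\<Delta>' = {z \<in> topspace (Cspace 1). \<forall>i<1. z i \<in> box ((\<lambda>_. L) i) ((\<lambda>_. V) i)}"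
  define s where "s = (1 :: nat, \<Delta>', restrict (function1 UNIV cos) \<Delta>')"
  have "gaussian_box 1 \<Delta>'"
    unfolding gaussian_box_def \<Delta>'_def
    by (rule exI[of _ "\<lambda>_. L"], rule exI[of _ "\<lambda>_. V"]) (simp add: L_def V_def gaussian_rationals_def)
  then have "s \<in> proper_restrictions 1 (domain1 UNIV) (function1 UNIV cos)"
    unfolding proper_restrictions_def s_def using relatively_compact_gaussian_box[OF \<Delta>'_def] by auto
  then have s: "s \<in> family_proper_restrictions cos_family"
    unfolding family_proper_restrictions_def using cos_in_cos_family by blast
  have sqrt_in: "csqrt \<zeta> \<in> box L V" if "\<zeta> \<in> box (l 0) (u 0)" for \<zeta>
  proof -
    have "cmod \<zeta> \<le> \<bar>Re \<zeta>\<bar> + \<bar>Im \<zeta>\<bar>" by (rule cmod_le)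
    also have "\<dots> \<le> B" using that by (auto simp: in_box_complex_iff B_def)
    finally have z: "cmod \<zeta> \<le> B" .
    have "cmod (csqrt \<zeta>) < real M"
    proof (rule power2_less_imp_less)
      have "(cmod (csqrt \<zeta>))\<^sup>2 = cmod \<zeta>" by simp
      also have "\<dots> < real M * 1" using z M by simp
      also have "\<dots> \<le> (real M)\<^sup>2"
        unfolding power2_eq_square using M B_def by (intro mult_left_mono) auto
      finally show "(cmod (csqrt \<zeta>))\<^sup>2 < (real M)\<^sup>2" .
    qed simp
    then have "\<bar>Re (csqrt \<zeta>)\<bar> < real M" "\<bar>Im (csqrt \<zeta>)\<bar> < real M"
      using abs_Re_le_cmod[of "csqrt \<zeta>"] abs_Im_le_cmod[of "csqrt \<zeta>"] by linarith+
    then show ?thesis by (auto simp: in_box_complex_iff L_def V_def)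
  qed
  obtain \<beta> :: "restriction fmla" where \<beta>: "set_fmla \<beta> = {}" "free_vars \<beta> \<subseteq> {0, 1}"
      "\<And>I e. satisfies I e \<beta> \<longleftrightarrow> Complex (e 0) (e 1) \<in> box (l 0) (u 0)"
    using formula_gaussian_box[OF lu, of 0 1] by metis
  \<comment> \<open>Variables 4 and 5 are the real part p and the imaginary part q of a root; p^2 =
    x + q^2 and y = p q + p q express that its square is x + i y without subtraction. The relation
    \<open>s\<close> is the graph of cos on the large box.\<close>
  define \<phi> where "\<phi> = Ex 4 (Ex 5 (Conj \<beta>
      (Conj (Equal (Times (Var 4) (Var 4)) (Plus (Var 0) (Times (Var 5) (Var 5))))
      (Conj (Equal (Var 1) (Plus (Times (Var 4) (Var 5)) (Times (Var 4) (Var 5))))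
        (Rel s [Var 4, Var 5, Var 2, Var 3])))))"
  have "set_fmla \<phi> \<subseteq> family_proper_restrictions cos_family" using s \<beta>(1) by (simp add: \<phi>_def)
  moreover have "free_vars \<phi> \<subseteq> {..<4}" using \<beta>(2) by (auto simp: \<phi>_def)
  moreover have sat: "satisfies real_graph e \<phi> \<longleftrightarrow> Complex (e 0) (e 1) \<in> box (l 0) (u 0) \<and>
      Complex (e 2) (e 3) = cos_sqrt (Complex (e 0) (e 1))" for e
  proof -
    have "satisfies real_graph e \<phi> \<longleftrightarrow> (\<exists>p q. Complex (e 0) (e 1) \<in> box (l 0) (u 0) \<and>
        p * p = e 0 + q * q \<and> e 1 = p * q + p * q \<and> [p, q, e 2, e 3] \<in> real_graph s)"
      by (simp add: \<phi>_def \<beta>(3))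
    also have "\<dots> \<longleftrightarrow> (\<exists>p q. Complex (e 0) (e 1) \<in> box (l 0) (u 0) \<and> (Complex p q)\<^sup>2 = Complex (e 0) (e 1) \<and>
        Complex p q \<in> box L V \<and> Complex (e 2) (e 3) = cos (Complex p q))"
    proof -
      have "(Complex p q)\<^sup>2 = Complex (e 0) (e 1) \<longleftrightarrow> p * p = e 0 + q * q \<and> e 1 = p * q + p * q" for p q
        by (auto simp: power2_eq_square complex_eq_iff)
      moreover have "[p, q, e 2, e 3] \<in> real_graph s \<longleftrightarrow> Complex p q \<in> box L V \<and> Complex (e 2) (e 3) = cos (Complex p q)" for p q
      proof -
        have "[p, q, e 2, e 3] \<in> real_graph s \<longleftrightarrow> (\<exists>\<zeta>. \<zeta> \<in> box L V \<and> \<zeta> = Complex p q \<and> Complex (e 2) (e 3) = cos \<zeta>)"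
          unfolding s_def real_graph_dim_1[OF \<Delta>'_def] by (auto simp: complex_eq_iff)
        then show ?thesis by simp
      qed
      ultimately show ?thesis by simp
    qed
    also have "\<dots> \<longleftrightarrow> Complex (e 0) (e 1) \<in> box (l 0) (u 0) \<and> Complex (e 2) (e 3) = cos_sqrt (Complex (e 0) (e 1))"
    proof
      assume "\<exists>p q. Complex (e 0) (e 1) \<in> box (l 0) (u 0) \<and> (Complex p q)\<^sup>2 = Complex (e 0) (e 1) \<and>
        Complex p q \<in> box L V \<and> Complex (e 2) (e 3) = cos (Complex p q)"
      then show "Complex (e 0) (e 1) \<in> box (l 0) (u 0) \<and> Complex (e 2) (e 3) = cos_sqrt (Complex (e 0) (e 1))"
        using cos_sqrt_square by metis
    next
      assume *: "Complex (e 0) (e 1) \<in> box (l 0) (u 0) \<and> Complex (e 2) (e 3) = cos_sqrt (Complex (e 0) (e 1))"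
      let ?w = "csqrt (Complex (e 0) (e 1))"
      show "\<exists>p q. Complex (e 0) (e 1) \<in> box (l 0) (u 0) \<and> (Complex p q)\<^sup>2 = Complex (e 0) (e 1) \<and>
        Complex p q \<in> box L V \<and> Complex (e 2) (e 3) = cos (Complex p q)"
        by (rule exI[of _ "Re ?w"], rule exI[of _ "Im ?w"])
          (use * sqrt_in in \<open>simp only: complex_surj power2_csqrt cos_sqrt_eq simp_thms\<close>)
    qed
    finally show ?thesis .
  qed
  have "real_graph r = {map e [0..<4] | e. satisfies real_graph e \<phi>}"
    unfolding r real_graph_dim_1[OF \<Delta>] sat
  proof (intro subset_antisym subsetI)
    fix t assume "t \<in> {[Re \<zeta>, Im \<zeta>, Re (cos_sqrt \<zeta>), Im (cos_sqrt \<zeta>)] | \<zeta>. \<zeta> \<in> box (l 0) (u 0)}"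
    then obtain \<zeta> where \<zeta>: "\<zeta> \<in> box (l 0) (u 0)" "t = [Re \<zeta>, Im \<zeta>, Re (cos_sqrt \<zeta>), Im (cos_sqrt \<zeta>)]" by auto
    define e where "e = (\<lambda>i. t ! i)"
    have "e 0 = Re \<zeta>" "e 1 = Im \<zeta>" "e 2 = Re (cos_sqrt \<zeta>)" "e 3 = Im (cos_sqrt \<zeta>)"
      by (simp_all add: e_def \<zeta>(2))
    then have "t = map e [0..<4]" "Complex (e 0) (e 1) \<in> box (l 0) (u 0) \<and> Complex (e 2) (e 3) = cos_sqrt (Complex (e 0) (e 1))"
      using \<zeta> by (simp_all add: numeral_eq_Suc upt_rec)
    then show "t \<in> {map e [0..<4] | e. Complex (e 0) (e 1) \<in> box (l 0) (u 0) \<and> Complex (e 2) (e 3) = cos_sqrt (Complex (e 0) (e 1))}"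
      by (intro CollectI exI[of _ e]) simp
  next
    fix t assume "t \<in> {map e [0..<4] | e. Complex (e 0) (e 1) \<in> box (l 0) (u 0) \<and> Complex (e 2) (e 3) = cos_sqrt (Complex (e 0) (e 1))}"
    then obtain e where e: "t = map e [0..<4]" "Complex (e 0) (e 1) \<in> box (l 0) (u 0)"
      "Complex (e 2) (e 3) = cos_sqrt (Complex (e 0) (e 1))" by auto
    have "t = [e 0, e 1, e 2, e 3]" by (simp add: e(1) numeral_eq_Suc upt_rec)
    then show "t \<in> {[Re \<zeta>, Im \<zeta>, Re (cos_sqrt \<zeta>), Im (cos_sqrt \<zeta>)] | \<zeta>. \<zeta> \<in> box (l 0) (u 0)}"
      using e(2) arg_cong[OF e(3), of Re] arg_cong[OF e(3), of Im]
      by (intro CollectI exI[of _ "Complex (e 0) (e 1)"]) simp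
  qed
  ultimately show "zero_definable (family_proper_restrictions cos_family) real_graph (2 * 1 + 2) (real_graph r)"
    unfolding zero_definable_def by (intro exI[of _ \<phi>]) (simp add: numeral_eq_Suc)
qed

theorem theoremB:
  shows "\<exists>(U :: complex set) (g :: complex \<Rightarrow> complex) (W :: complex set) (f :: complex \<Rightarrow> complex).
    open U \<and> 0 \<in> U \<and> g holomorphic_on U \<and>
    open W \<and> 0 \<in> W \<and> (\<forall>w. w\<^sup>2 \<in> W \<longrightarrow> w \<in> U \<and> f (w\<^sup>2) = g w) \<and> f holomorphic_on W \<and>
    (let A = sheaf_generated (singleton_family 1 (domain1 U) (function1 U g)) in
      locally_zero_definable A 1 (domain1 W) (function1 W f) \<and>
      (\<forall>V. open V \<and> 0 \<in> V \<and> V \<subseteq> W \<longrightarrow>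
        \<not> (\<exists>\<omega>\<in>C_ops gaussian_rationals. \<exists>xs. set xs \<subseteq> stalks A \<and> (xs, germ1 V f) \<in> \<omega>)) \<and>
      germ1 W f \<in> stalk (D_sheaf gaussian_rationals A) 1 (\<lambda>_. 0) - stalk (C_sheaf UNIV A) 1 (\<lambda>_. 0) \<and>
      C_sheaf gaussian_rationals A \<noteq> D_sheaf gaussian_rationals A \<and>
      C_sheaf UNIV A \<noteq> D_sheaf UNIV A)"
proof -
  have inD: "germ1 UNIV cos_sqrt \<in> stalk (D_sheaf K cos_family) 1 (\<lambda>_. 0)" if "{1, -1} \<subseteq> K" for K
    unfolding stalk_def germ1_def
    by (rule CollectI, rule exI[of _ "function1 UNIV cos_sqrt"], rule exI[of _ "domain1 UNIV"])
      (use cos_sqrt_in_D_sheaf[OF that] in \<open>simp add: domain1_UNIV topspace_Cspace\<close>)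
  have notin: "germ1 UNIV cos_sqrt \<notin> stalk (C_sheaf K cos_family) 1 (\<lambda>_. 0)" for K
  proof
    assume "germ1 UNIV cos_sqrt \<in> stalk (C_sheaf K cos_family) 1 (\<lambda>_. 0)"
    then have "germ1 UNIV cos_sqrt \<in> stalk tame_sheaf 1 (\<lambda>_. 0)"
      using stalk_mono[OF C_sheaf_le_tame_sheaf] by (rule subsetD[rotated])
    then have "germ1 UNIV cos_sqrt \<in> stalks tame_sheaf"
      unfolding stalks_def by (intro UN_I[of 1] UN_I[of "\<lambda>_. 0"]) simp_all
    then show False using germ1_cos_sqrt_not_tame[of UNIV] by simp
  qed
  have ne: "C_sheaf K cos_family \<noteq> D_sheaf K cos_family" if "{1, -1} \<subseteq> K" for K
    using inD[OF that] notin[of K] by auto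
  \<comment> \<open>Shown on the operators directly: they preserve the stalks of the tame sheaf,
    which contain those of A but not the germ of f.\<close>
  have no_op: "\<not> (\<exists>\<omega>\<in>C_ops gaussian_rationals. \<exists>xs. set xs \<subseteq> stalks cos_family \<and> (xs, germ1 V cos_sqrt) \<in> \<omega>)"
    if V: "open V" "0 \<in> V" for V
  proof
    assume "\<exists>\<omega>\<in>C_ops gaussian_rationals. \<exists>xs. set xs \<subseteq> stalks cos_family \<and> (xs, germ1 V cos_sqrt) \<in> \<omega>"
    then obtain \<omega> xs where \<omega>: "\<omega> \<in> C_ops gaussian_rationals" "set xs \<subseteq> stalks cos_family" "(xs, germ1 V cos_sqrt) \<in> \<omega>"
      by (elim bexE exE conjE)
    have "set xs \<subseteq> stalks tame_sheaf"
      using \<omega>(2) stalks_mono[OF cos_family_le_tame_sheaf] by (rule subset_trans)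
    then have "germ1 V cos_sqrt \<in> stalks tame_sheaf"
      using tame_sheaf_stable_C_ops[OF \<omega>(1)] \<omega>(3) unfolding stable_under_def
      by (elim allE[of _ xs] allE[of _ "germ1 V cos_sqrt"] impE)
    then show False using germ1_cos_sqrt_not_tame[OF V] by simp
  qed
  have K: "{1, -1} \<subseteq> gaussian_rationals" "{1, -1} \<subseteq> (UNIV :: complex set)"
    by (auto simp: gaussian_rationals_def)
  show ?thesis
  \<comment> \<open>cos and f are entire, so both domains are taken to be the whole plane.\<close>
  proof (rule exI[of _ UNIV], rule exI[of _ cos], rule exI[of _ UNIV], rule exI[of _ cos_sqrt],
      unfold Let_def cos_family_def[symmetric], intro conjI DiffI allI impI)
    show "cos_sqrt (w\<^sup>2) = cos w" for w by (rule cos_sqrt_square)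
    show "cos holomorphic_on UNIV" by (rule holomorphic_on_cos)
    show "cos_sqrt holomorphic_on UNIV" by (rule cos_sqrt_holomorphic)
    show "locally_zero_definable cos_family 1 (domain1 UNIV) (function1 UNIV cos_sqrt)"
      by (rule cos_sqrt_locally_definable)
    show "\<not> (\<exists>\<omega>\<in>C_ops gaussian_rationals. \<exists>xs. set xs \<subseteq> stalks cos_family \<and> (xs, germ1 V cos_sqrt) \<in> \<omega>)"
      if "open V \<and> 0 \<in> V \<and> V \<subseteq> UNIV" for V
      using no_op that by simp
  qed (use inD[OF K(1)] notin ne[OF K(1)] ne[OF K(2)] in simp_all)
qed

end
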